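(* For every $k\ge1$, the interaction cohomology polynomial of order $k$, $G\mapsto p_{G,k}(t)=\sum_{p\ge0}b_{p,k}(G)\,t^p$, extends to a ring homomorphism from the strong ring to $\mathbb{Z}[t]$.
   Context: A finite abstract simplicial complex is a finite set of finite non-empty sets which is closed under taking non-empty subsets; $\dim(x)=|x|-1$. A product complex is a finite Cartesian product $G_1\times\cdots\times G_n$ ($n\ge 1$) of finite abstract simplicial complexes; its cells are the sets $x=x_1\times\cdots\times x_n$ with $x_i\in G_i$, with $\dim(x)=\sum_i\dim(x_i)$. Two product complexes are isomorphic if there is a bijection between their cells preserving inclusion in both directions. A signed complex is a finite formal disjoint union of product complexes, each summand carrying a sign in $\{1,-1\}$. Addition is disjoint union, $-G$ reverses all signs, and products are taken term by term with signs multiplied. The strong ring is the commutative ring of signed complexes modulo isomorphism of summands, splitting of summands into connected components (with the same sign), and cancellation of $G\oplus(-G)$; its zero is the empty complex and its one is the one-point complex $K_1$. Interaction cohomology of order $k$ of a simplicial complex $G$: consider real functions $F$ on ordered $k$-tuples $(x_1,\dots,x_k)$ of simplices of $G$ with $x_1\cap\cdots\cap x_k\neq\emptyset$, graded by $\dim(x_1)+\cdots+\dim(x_k)$. After orienting the simplices, with boundary operation $\delta$, the exterior derivative is $$dF(x_1,\dots,x_k)=\sum_{j=1}^k(-1)^{\dim(x_1)+\cdots+\dim(x_{j-1})}F(x_1,\dots,\delta x_j,\dots,x_k),$$ where $F$ is extended linearly to chains and taken to be $0$ on tuples which do not intersect simultaneously. (For $k=2$: $dF(x,y)=F(\delta x,y)+(-1)^{\dim(x)}F(x,\delta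 y)$ on pairs of intersecting simplices; for $k=1$ this is simplicial cohomology.) For a product $G\times H$, consider functions $F(X,Y)$ of a simultaneously intersecting $k$-tuple $X$ in $G$ and a simultaneously intersecting $k$-tuple $Y$ in $H$, with $dF(X,Y)=d_1F+(-1)^{\dim(X)}d_2F$, where $\dim(X)$ is the total dimension of $X$ and $d_1,d_2$ are the order $k$ interaction exterior derivatives of $G$ and $H$ acting on the first and second variable; for more factors this is iterated. Then $b_{p,k}(G)$ is the dimension of the $p$-th cohomology group of $d$, and for a signed complex with summands $G_i$ and signs $\varepsilon_i$, $b_{p,k}(G)=\sum_i\varepsilon_ib_{p,k}(G_i)$. *)

theory Defs
  imports "HOL-Library.Multiset" "HOL-Computational_Algebra.Polynomial"
begin

section \<open>Product complexes\<close>

definition simplicial_complex :: "'a set set \<Rightarrow> bool" where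
  "simplicial_complex G \<longleftrightarrow>
     finite G \<and> (\<forall>x\<in>G. finite x \<and> x \<noteq> {} \<and> (\<forall>y. y \<noteq> {} \<and> y \<subseteq> x \<longrightarrow> y \<in> G))"

text \<open>The product \<open>G\<^sub>1 \<times> \<dots> \<times> G\<^sub>n\<close> is encoded by the list of its factors, the cell
  \<open>x\<^sub>1 \<times> \<dots> \<times> x\<^sub>n\<close> by the set \<open>listset [x\<^sub>1, \<dots>, x\<^sub>n]\<close> of lists of vertices.\<close>

definition product_complex :: "'a set set list \<Rightarrow> bool" where
  "product_complex Gs \<longleftrightarrow> Gs \<noteq> [] \<and> (\<forall>G\<in>set Gs. simplicial_complex G)"

definition cells :: "'a set set list \<Rightarrow> 'a list set set" where
  "cells Gs = listset ` listset Gs"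

definition complex_iso :: "'a set set list \<Rightarrow> 'a set set list \<Rightarrow> bool" where
  "complex_iso Gs Hs \<longleftrightarrow>
     (\<exists>f. bij_betw f (cells Gs) (cells Hs) \<and>
          (\<forall>x\<in>cells Gs. \<forall>y\<in>cells Gs. x \<subseteq> y \<longleftrightarrow> f x \<subseteq> f y))"

definition connected_in :: "'b set set \<Rightarrow> ('b set \<times> 'b set) set" where
  "connected_in X = {(x, y) \<in> X \<times> X. (x, y) \<in> {(x, y) \<in> X \<times> X. x \<subseteq> y \<or> y \<subseteq> x}\<^sup>*}"

definition components :: "'b set set \<Rightarrow> 'b set set set" where
  "components X = X // connected_in X"


section \<open>Signed complexes\<close>

text \<open>A signed complex is a multiset of pairs (sign, product complex).\<close>

type_synonym 'a summand = "int \<times> 'a set set list"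

definition signed_complex :: "'a summand multiset \<Rightarrow> bool" where
  "signed_complex A \<longleftrightarrow> (\<forall>(e, G)\<in>#A. e \<in> {1, -1} \<and> product_complex G)"

definition sc_neg :: "'a summand multiset \<Rightarrow> 'a summand multiset" where
  "sc_neg A = image_mset (\<lambda>(e, G). (- e, G)) A"

definition sc_mult :: "'a summand multiset \<Rightarrow> 'a summand multiset \<Rightarrow> 'a summand multiset" where
  "sc_mult A B = (\<Sum>(e, G)\<in>#A. image_mset (\<lambda>(f, H). (e * f, G @ H)) B)"

inductive strong_eq :: "'a summand multiset \<Rightarrow> 'a summand multiset \<Rightarrow> bool" where
  refl: "signed_complex A \<Longrightarrow> strong_eq A A"
| sym: "strong_eq A B \<Longrightarrow> strong_eq B A"
| trans: "strong_eq A B \<Longrightarrow> strong_eq B C \<Longrightarrow> strong_eq A C"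
| iso: "signed_complex (add_mset (e, G) A) \<Longrightarrow> product_complex H \<Longrightarrow> complex_iso G H \<Longrightarrow>
    strong_eq (add_mset (e, G) A) (add_mset (e, H) A)"
| split: "signed_complex (add_mset (e, G) A) \<Longrightarrow> \<forall>H\<in>#M. product_complex H \<Longrightarrow>
    image_mset cells M = mset_set (components (cells G)) \<Longrightarrow>
    strong_eq (add_mset (e, G) A) (image_mset (\<lambda>H. (e, H)) M + A)"
| cancel: "signed_complex (add_mset (e, G) A) \<Longrightarrow>
    strong_eq (add_mset (e, G) (add_mset (- e, G) A)) A"


section \<open>Interaction cohomology\<close>

text \<open>An orientation of the simplices is given by signs: \<open>s x = 1\<close> if \<open>x\<close> carries the orientation of
  the increasing order of its vertices, and \<open>s x = -1\<close> if it carries the opposite one. Then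
  \<open>\<delta> x\<close> is the sum of \<open>incidence s x v\<close> times \<open>x - {v}\<close> over the vertices \<open>v\<close> of \<open>x\<close>, and
  \<open>\<delta> {v} = 0\<close>.\<close>

definition orientation :: "('a set \<Rightarrow> real) \<Rightarrow> bool" where
  "orientation s \<longleftrightarrow> (\<forall>x. s x \<in> {1, -1})"

definition incidence :: "('a::linorder set \<Rightarrow> real) \<Rightarrow> 'a set \<Rightarrow> 'a \<Rightarrow> real" where
  "incidence s x v = s x * s (x - {v}) * (-1) ^ card {u \<in> x. u < v}"

definition tuples :: "nat \<Rightarrow> 'a set set \<Rightarrow> 'a set list set" where
  "tuples k G = {X. length X = k \<and> set X \<subseteq> G \<and> \<Inter>(set X) \<noteq> {}}"

definition tuple_dim :: "'a set list \<Rightarrow> nat" where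
  "tuple_dim X = (\<Sum>x\<leftarrow>X. card x - 1)"

definition interaction_deriv ::
  "('a::linorder set \<Rightarrow> real) \<Rightarrow> ('a set list \<Rightarrow> real) \<Rightarrow> 'a set list \<Rightarrow> real" where
  "interaction_deriv s F X =
     (\<Sum>j<length X. (-1) ^ tuple_dim (take j X) *
        (\<Sum>v | v \<in> X ! j \<and> X ! j \<noteq> {v}. incidence s (X ! j) v * F (X[j := X ! j - {v}])))"

text \<open>A cochain of a product with \<open>n\<close> factors takes a list of \<open>n\<close> tuples, one for each factor.\<close>

fun product_deriv ::
  "('a::linorder set \<Rightarrow> real) \<Rightarrow> ('a set list list \<Rightarrow> real) \<Rightarrow> 'a set list list \<Rightarrow> real" where
  "product_deriv s F [] = 0"
| "product_deriv s F (X # Xs) =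
     interaction_deriv s (\<lambda>Y. F (Y # Xs)) X
     + (-1) ^ tuple_dim X * product_deriv s (\<lambda>Ys. F (X # Ys)) Xs"

definition product_tuples :: "nat \<Rightarrow> 'a set set list \<Rightarrow> 'a set list list set" where
  "product_tuples k Gs = listset (map (tuples k) Gs)"

definition cochains :: "nat \<Rightarrow> 'a set set list \<Rightarrow> nat \<Rightarrow> ('a set list list \<Rightarrow> real) set" where
  "cochains k Gs p =
     {F. \<forall>Xs. F Xs \<noteq> 0 \<longrightarrow> Xs \<in> product_tuples k Gs \<and> (\<Sum>X\<leftarrow>Xs. tuple_dim X) = p}"

definition exterior_deriv ::
  "('a::linorder set \<Rightarrow> real) \<Rightarrow> nat \<Rightarrow> 'a set set list \<Rightarrow>
     ('a set list list \<Rightarrow> real) \<Rightarrow> 'a set list list \<Rightarrow> real" where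
  "exterior_deriv s k Gs F Xs = (if Xs \<in> product_tuples k Gs then product_deriv s F Xs else 0)"

definition cocycles ::
  "('a::linorder set \<Rightarrow> real) \<Rightarrow> nat \<Rightarrow> 'a set set list \<Rightarrow> nat \<Rightarrow> ('a set list list \<Rightarrow> real) set" where
  "cocycles s k Gs p = {F \<in> cochains k Gs p. exterior_deriv s k Gs F = (\<lambda>_. 0)}"

definition coboundaries ::
  "('a::linorder set \<Rightarrow> real) \<Rightarrow> nat \<Rightarrow> 'a set set list \<Rightarrow> nat \<Rightarrow> ('a set list list \<Rightarrow> real) set" where
  "coboundaries s k Gs p =
     (case p of 0 \<Rightarrow> {\<lambda>_. 0} | Suc q \<Rightarrow> exterior_deriv s k Gs ` cochains k Gs q)"

text \<open>\<open>bs\<close> lists representatives of a basis of the quotient space \<open>Z / B\<close>: modulo \<open>B\<close>, every element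
  of \<open>Z\<close> is a linear combination of \<open>bs\<close> in exactly one way.\<close>

definition quotient_basis :: "('b \<Rightarrow> real) set \<Rightarrow> ('b \<Rightarrow> real) set \<Rightarrow> ('b \<Rightarrow> real) list \<Rightarrow> bool" where
  "quotient_basis Z B bs \<longleftrightarrow> set bs \<subseteq> Z \<and>
     (\<forall>z\<in>Z. \<exists>!c :: real list. length c = length bs \<and>
        (\<lambda>x. z x - (\<Sum>i<length bs. c ! i * (bs ! i) x)) \<in> B)"

definition quotient_dim :: "('b \<Rightarrow> real) set \<Rightarrow> ('b \<Rightarrow> real) set \<Rightarrow> nat" where
  "quotient_dim Z B = (THE n. \<exists>bs. quotient_basis Z B bs \<and> length bs = n)"

definition betti :: "('a::linorder set \<Rightarrow> real) \<Rightarrow> nat \<Rightarrow> 'a set set list \<Rightarrow> nat \<Rightarrow> nat" where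
  "betti s k Gs p = quotient_dim (cocycles s k Gs p) (coboundaries s k Gs p)"

definition signed_betti :: "('a::linorder set \<Rightarrow> real) \<Rightarrow> nat \<Rightarrow> 'a summand multiset \<Rightarrow> nat \<Rightarrow> int" where
  "signed_betti s k A p = (\<Sum>(e, Gs)\<in>#A. e * int (betti s k Gs p))"

definition interaction_poly :: "('a::linorder set \<Rightarrow> real) \<Rightarrow> nat \<Rightarrow> 'a summand multiset \<Rightarrow> int poly" where
  "interaction_poly s k A = Abs_poly (signed_betti s k A)"


section \<open>The strong ring\<close>

subsection \<open>Well-definedness of the ring operations\<close>

lemma strong_eq_signed:
  "strong_eq A B \<Longrightarrow> signed_complex A \<and> signed_complex B"
  by (induction rule: strong_eq.induct) (auto simp: signed_complex_def)

lemma signed_add [simp]: "signed_complex (A + B) \<longleftrightarrow> signed_complex A \<and> signed_complex B"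
  by (auto simp: signed_complex_def)

lemma signed_add_mset [simp]:
  "signed_complex (add_mset (e, G) A) \<longleftrightarrow> e \<in> {1, -1} \<and> product_complex G \<and> signed_complex A"
  by (auto simp: signed_complex_def)

lemma signed_empty [simp]: "signed_complex {#}"
  by (auto simp: signed_complex_def)

lemma strong_eq_self [simp]: "strong_eq A A \<longleftrightarrow> signed_complex A"
  using strong_eq_signed strong_eq.refl by blast

lemma strong_eq_add_right:
  assumes "strong_eq A B" "signed_complex C"
  shows "strong_eq (A + C) (B + C)"
  using assms
proof (induction rule: strong_eq.induct)
  case (split e G A M)
  then show ?case
    using strong_eq.split[of e G "A + C" M] by (simp add: add.assoc)
qed (auto intro: strong_eq.intros)

lemma strong_eq_add:
  assumes "strong_eq A B" "strong_eq C D"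
  shows "strong_eq (A + C) (B + D)"
proof -
  have "strong_eq (A + C) (B + C)"
    using assms strong_eq_add_right strong_eq_signed by blast
  moreover have "strong_eq (B + C) (B + D)"
    using assms strong_eq_add_right[of C D B] strong_eq_signed by (metis add.commute)
  ultimately show ?thesis by (rule strong_eq.trans)
qed

lemma signed_neg [simp]: "signed_complex A \<Longrightarrow> signed_complex (sc_neg A)"
  by (auto simp: signed_complex_def sc_neg_def)

lemma sc_neg_simps [simp]:
  "sc_neg {#} = {#}" "sc_neg (add_mset (e, G) A) = add_mset (- e, G) (sc_neg A)"
  "sc_neg (A + B) = sc_neg A + sc_neg B"
  "sc_neg (image_mset (\<lambda>H. (e, H)) M) = image_mset (\<lambda>H. (- e, H)) M"
  by (auto simp: sc_neg_def image_mset.compositionality comp_def)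

lemma strong_eq_neg:
  assumes "strong_eq A B"
  shows "strong_eq (sc_neg A) (sc_neg B)"
  using assms
proof (induction rule: strong_eq.induct)
  case (split e G A M)
  then show ?case
    using strong_eq.split[of "- e" G "sc_neg A" M] by auto
next
  case (cancel e G A)
  then show ?case
    using strong_eq.cancel[of "- e" G "sc_neg A"] by auto
next
  case (iso e G A H)
  then show ?case
    using strong_eq.iso[of "- e" G "sc_neg A" H] by auto
qed (auto intro: strong_eq.intros)

lemma strong_eq_sum:
  assumes "\<forall>x\<in>#M. strong_eq (f x) (g x)"
  shows "strong_eq (\<Sum>x\<in>#M. f x) (\<Sum>x\<in>#M. g x)"
  using assms by (induction M) (auto intro: strong_eq_add strong_eq.refl)

lemma sc_mult_simps [simp]:
  "sc_mult {#} B = {#}" "sc_mult A {#} = {#}"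
  "sc_mult (A + A') B = sc_mult A B + sc_mult A' B"
  "sc_mult A (B + B') = sc_mult A B + sc_mult A B'"
proof -
  show "sc_mult A {#} = {#}" by (induction A) (auto simp: sc_mult_def)
  show "sc_mult A (B + B') = sc_mult A B + sc_mult A B'"
    by (induction A) (auto simp: sc_mult_def)
qed (auto simp: sc_mult_def)

lemma sc_mult_single [simp]: "sc_mult {#(e, G)#} {#(f, H)#} = {#(e * f, G @ H)#}"
  by (simp add: sc_mult_def)

lemma sc_mult_add_mset:
  "sc_mult (add_mset a A) B = sc_mult {#a#} B + sc_mult A B"
  "sc_mult B (add_mset a A) = sc_mult B {#a#} + sc_mult B A"
  by (metis add_mset_add_single add.commute sc_mult_simps)+

lemma product_complex_append:
  "product_complex G \<Longrightarrow> product_complex H \<Longrightarrow> product_complex (G @ H)"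
  by (auto simp: product_complex_def)

lemma signed_mult [simp]:
  assumes "signed_complex A" "signed_complex B"
  shows "signed_complex (sc_mult A B)"
  using assms by (fastforce simp: sc_mult_def signed_complex_def product_complex_append)

lemma sc_mult_assoc: "sc_mult (sc_mult A B) C = sc_mult A (sc_mult B C)"
proof -
  have 1: "sc_mult (sc_mult {#a#} {#b#}) {#c#} = sc_mult {#a#} (sc_mult {#b#} {#c#})"
    for a b c :: "'a summand"
    by (cases a; cases b; cases c) (simp add: mult.assoc)
  have 2: "sc_mult (sc_mult {#a#} {#b#}) C = sc_mult {#a#} (sc_mult {#b#} C)"
    for a b :: "'a summand"
  proof (induction C)
    case (add c C)
    then show ?case by (simp add: sc_mult_add_mset(2)[of _ c C] 1)
  qed auto
  have 3: "sc_mult (sc_mult {#a#} B) C = sc_mult {#a#} (sc_mult B C)" for a :: "'a summand"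
  proof (induction B)
    case (add b B)
    then show ?case by (simp add: sc_mult_add_mset(1)[of b B] sc_mult_add_mset(2)[of _ b B] 2)
  qed auto
  show ?thesis
  proof (induction A)
    case (add a A)
    then show ?case by (simp add: sc_mult_add_mset(1)[of a A] 3)
  qed auto
qed


lemma listset_iff: "xs \<in> listset As \<longleftrightarrow> list_all2 (\<in>) xs As"
  by (induction As arbitrary: xs) (auto simp: set_Cons_def list_all2_Cons2)

lemma listset_nonempty: "{} \<notin> set xs \<Longrightarrow> listset xs \<noteq> {}"
  by (induction xs) (auto simp: set_Cons_def)

lemma listset_mono_iff:
  assumes "length xs = length ys" "{} \<notin> set xs"
  shows "listset xs \<subseteq> listset ys \<longleftrightarrow> list_all2 (\<subseteq>) xs ys"
  using assms
proof (induction xs ys rule: list_induct2)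
  case (Cons x xs y ys)
  then have "listset xs \<noteq> {}" "x \<noteq> {}"
    using listset_nonempty[of xs] by auto
  then have "set_Cons x (listset xs) \<subseteq> set_Cons y (listset ys) \<longleftrightarrow>
      x \<subseteq> y \<and> listset xs \<subseteq> listset ys"
    unfolding set_Cons_def by blast
  with Cons show ?case by simp
qed auto

abbreviation cell_le :: "'a set list \<Rightarrow> 'a set list \<Rightarrow> bool" where
  "cell_le \<equiv> list_all2 (\<subseteq>)"

lemma product_complex_listset:
  assumes "product_complex Gs" "xs \<in> listset Gs"
  shows "length xs = length Gs" "{} \<notin> set xs"
proof -
  have xs: "list_all2 (\<in>) xs Gs" using assms by (simp add: listset_iff)
  then show "length xs = length Gs" by (rule list_all2_lengthD)
  show "{} \<notin> set xs"
  proof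
    assume "{} \<in> set xs"
    then obtain i where i: "i < length xs" "xs ! i = {}" by (auto simp: in_set_conv_nth)
    then have "{} \<in> Gs ! i" "Gs ! i \<in> set Gs" using xs by (auto simp: list_all2_conv_all_nth)
    then show False using assms(1) by (auto simp: product_complex_def simplicial_complex_def)
  qed
qed

lemma cell_le_iff:
  assumes "product_complex Gs" "xs \<in> listset Gs" "ys \<in> listset Gs"
  shows "listset xs \<subseteq> listset ys \<longleftrightarrow> cell_le xs ys"
  using product_complex_listset[OF assms(1,2)] product_complex_listset[OF assms(1,3)]
  by (intro listset_mono_iff) auto

lemma cell_le_antisym: "cell_le xs ys \<Longrightarrow> cell_le ys xs \<Longrightarrow> xs = ys"
  by (auto simp: list_all2_conv_all_nth intro!: nth_equalityI)

lemma bij_listset: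
  assumes "product_complex Gs"
  shows "bij_betw listset (listset Gs) (cells Gs)"
  unfolding bij_betw_def cells_def
proof (intro conjI inj_onI)
  fix xs ys assume *: "xs \<in> listset Gs" "ys \<in> listset Gs" "listset xs = listset ys"
  then have "cell_le xs ys" "cell_le ys xs"
    using cell_le_iff[OF assms *(1,2)] cell_le_iff[OF assms *(2,1)] by auto
  then show "xs = ys" by (rule cell_le_antisym)
qed simp

lemma complex_isoI:
  assumes Gs: "product_complex Gs" and Hs: "product_complex Hs"
    and f: "bij_betw f (listset Gs) (listset Hs)"
    and le: "\<And>xs ys. xs \<in> listset Gs \<Longrightarrow> ys \<in> listset Gs \<Longrightarrow> cell_le xs ys \<longleftrightarrow> cell_le (f xs) (f ys)"
  shows "complex_iso Gs Hs"
proof -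
  define i where "i = inv_into (listset Gs) listset"
  have i: "bij_betw i (cells Gs) (listset Gs)"
    unfolding i_def using bij_listset[OF Gs] by (rule bij_betw_inv_into)
  have inv: "listset (i c) = c" if "c \<in> cells Gs" for c
    unfolding i_def using that by (simp add: cells_def f_inv_into_f)
  have "bij_betw (listset \<circ> f \<circ> i) (cells Gs) (cells Hs)"
    using bij_betw_trans[OF bij_betw_trans[OF i f] bij_listset[OF Hs]] by (simp add: comp_assoc)
  moreover have "c \<subseteq> d \<longleftrightarrow> (listset \<circ> f \<circ> i) c \<subseteq> (listset \<circ> f \<circ> i) d"
    if c: "c \<in> cells Gs" and d: "d \<in> cells Gs" for c d
  proof -
    have m: "i c \<in> listset Gs" "i d \<in> listset Gs" "f (i c) \<in> listset Hs" "f (i d) \<in> listset Hs"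
      using c d i f by (auto dest: bij_betwE)
    have "c \<subseteq> d \<longleftrightarrow> listset (i c) \<subseteq> listset (i d)"
      by (simp add: inv c d)
    also have "\<dots> \<longleftrightarrow> cell_le (f (i c)) (f (i d))"
      using m Gs le by (simp add: cell_le_iff)
    also have "\<dots> \<longleftrightarrow> listset (f (i c)) \<subseteq> listset (f (i d))"
      using m Hs by (simp add: cell_le_iff)
    finally show ?thesis by simp
  qed
  ultimately show ?thesis unfolding complex_iso_def by blast
qed

lemma complex_isoE:
  assumes Gs: "product_complex Gs" and Hs: "product_complex Hs" and "complex_iso Gs Hs"
  obtains f where "bij_betw f (listset Gs) (listset Hs)"
    and "\<And>xs ys. xs \<in> listset Gs \<Longrightarrow> ys \<in> listset Gs \<Longrightarrow> cell_le xs ys \<longleftrightarrow> cell_le (f xs) (f ys)"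
proof -
  obtain g where g: "bij_betw g (cells Gs) (cells Hs)"
    and le': "\<forall>x\<in>cells Gs. \<forall>y\<in>cells Gs. x \<subseteq> y \<longleftrightarrow> g x \<subseteq> g y"
    using assms(3) unfolding complex_iso_def by (elim exE conjE)
  have le: "x \<subseteq> y \<longleftrightarrow> g x \<subseteq> g y" if "x \<in> cells Gs" "y \<in> cells Gs" for x y
    using le' that by simp
  define i where "i = inv_into (listset Hs) listset"
  have i: "bij_betw i (cells Hs) (listset Hs)"
    unfolding i_def using bij_listset[OF Hs] by (rule bij_betw_inv_into)
  have inv: "listset (i c) = c" if "c \<in> cells Hs" for c
    unfolding i_def using that by (simp add: cells_def f_inv_into_f)
  have "bij_betw (i \<circ> g \<circ> listset) (listset Gs) (listset Hs)"
    using bij_betw_trans[OF bij_betw_trans[OF bij_listset[OF Gs] g] i] by (simp add: comp_assoc)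
  moreover have "cell_le xs ys \<longleftrightarrow> cell_le ((i \<circ> g \<circ> listset) xs) ((i \<circ> g \<circ> listset) ys)"
    if x: "xs \<in> listset Gs" and y: "ys \<in> listset Gs" for xs ys
  proof -
    have m: "listset xs \<in> cells Gs" "listset ys \<in> cells Gs"
      using x y by (auto simp: cells_def)
    then have m': "g (listset xs) \<in> cells Hs" "g (listset ys) \<in> cells Hs"
      using bij_betw_apply[OF g] by blast+
    then have m'': "i (g (listset xs)) \<in> listset Hs" "i (g (listset ys)) \<in> listset Hs"
      using bij_betw_apply[OF i] by blast+
    have "cell_le xs ys \<longleftrightarrow> listset xs \<subseteq> listset ys"
      using cell_le_iff[OF Gs x y] by simp
    also have "\<dots> \<longleftrightarrow> g (listset xs) \<subseteq> g (listset ys)"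
      using m by (rule le)
    also have "\<dots> \<longleftrightarrow> listset (i (g (listset xs))) \<subseteq> listset (i (g (listset ys)))"
      using m' by (simp add: inv)
    also have "\<dots> \<longleftrightarrow> cell_le (i (g (listset xs))) (i (g (listset ys)))"
      using cell_le_iff[OF Hs m''] by simp
    finally show ?thesis by simp
  qed
  ultimately show ?thesis by (rule that)
qed

lemma listset_append:
  "zs \<in> listset (As @ Bs) \<longleftrightarrow> take (length As) zs \<in> listset As \<and> drop (length As) zs \<in> listset Bs"
proof
  assume "zs \<in> listset (As @ Bs)"
  then obtain us vs where "zs = us @ vs" "list_all2 (\<in>) us As" "list_all2 (\<in>) vs Bs"
    by (auto simp: listset_iff list_all2_append2)
  then show "take (length As) zs \<in> listset As \<and> drop (length As) zs \<in> listset Bs"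
    by (auto simp: listset_iff list_all2_lengthD)
next
  assume "take (length As) zs \<in> listset As \<and> drop (length As) zs \<in> listset Bs"
  then have "list_all2 (\<in>) (take (length As) zs @ drop (length As) zs) (As @ Bs)"
    by (intro list_all2_appendI) (auto simp: listset_iff)
  then show "zs \<in> listset (As @ Bs)" by (simp add: listset_iff)
qed

lemma listset_appendE:
  assumes "zs \<in> listset (As @ Bs)"
  obtains us vs where "zs = us @ vs" "us \<in> listset As" "vs \<in> listset Bs"
    "length us = length As" "length vs = length Bs"
  using assms listset_append[of zs As Bs]
  by (metis append_take_drop_id list_all2_lengthD listset_iff)

lemma listset_appendI:
  "us \<in> listset As \<Longrightarrow> vs \<in> listset Bs \<Longrightarrow> us @ vs \<in> listset (As @ Bs)"
  by (simp add: listset_iff list_all2_appendI)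

lemma cell_le_append:
  "length us = length us' \<Longrightarrow> cell_le (us @ vs) (us' @ vs') \<longleftrightarrow> cell_le us us' \<and> cell_le vs vs'"
  by (metis list_all2_append list_all2_lengthD)

lemma iso_append:
  assumes G: "product_complex G" and G': "product_complex G'" and H: "product_complex H"
    and "complex_iso G G'"
  shows "complex_iso (G @ H) (G' @ H)"
proof -
  obtain f where f: "bij_betw f (listset G) (listset G')"
    and le: "\<And>xs ys. xs \<in> listset G \<Longrightarrow> ys \<in> listset G \<Longrightarrow> cell_le xs ys \<longleftrightarrow> cell_le (f xs) (f ys)"
    using complex_isoE[OF G G' assms(4)] by blast
  define F where "F zs = f (take (length G) zs) @ drop (length G) zs" for zs
  have F: "F (us @ vs) = f us @ vs" if "us \<in> listset G" for us vs
    using product_complex_listset[OF G that] by (simp add: F_def)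
  have len: "length (f us) = length G'" if "us \<in> listset G" for us
    using that f product_complex_listset[OF G'] by (auto dest: bij_betwE)
  have "inj_on F (listset (G @ H))"
  proof (rule inj_onI)
    fix a b assume a: "a \<in> listset (G @ H)" and b: "b \<in> listset (G @ H)" and eq: "F a = F b"
    from a obtain u v where a': "a = u @ v" "u \<in> listset G" by (rule listset_appendE)
    from b obtain u' v' where b': "b = u' @ v'" "u' \<in> listset G" by (rule listset_appendE)
    have "f u = f u' \<and> v = v'" using eq a' b' len by (simp add: F)
    then show "a = b" using f a' b' by (auto simp: bij_betw_def inj_on_def)
  qed
  moreover have "F ` listset (G @ H) = listset (G' @ H)"
  proof (intro equalityI subsetI)
    fix z assume "z \<in> F ` listset (G @ H)"
    then obtain a where a: "a \<in> listset (G @ H)" and z: "z = F a" by blast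
    from a obtain u v where "a = u @ v" "u \<in> listset G" "v \<in> listset H" by (rule listset_appendE)
    then show "z \<in> listset (G' @ H)"
      using z f by (auto simp: F intro!: listset_appendI dest: bij_betwE)
  next
    fix z assume "z \<in> listset (G' @ H)"
    then obtain u v where uv: "z = u @ v" "u \<in> listset G'" "v \<in> listset H" by (rule listset_appendE)
    then have "u \<in> f ` listset G"
      using f by (simp add: bij_betw_def)
    then obtain u' where u': "u = f u'" "u' \<in> listset G" by (rule imageE)
    then have "z = F (u' @ v)" using uv by (simp add: F)
    then show "z \<in> F ` listset (G @ H)"
      using listset_appendI[OF u'(2) uv(3)] by (rule image_eqI)
  qed
  moreover have "cell_le a b \<longleftrightarrow> cell_le (F a) (F b)"
    if a: "a \<in> listset (G @ H)" and b: "b \<in> listset (G @ H)" for a b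
  proof -
    from a obtain u v where a': "a = u @ v" "u \<in> listset G" "length u = length G"
      by (rule listset_appendE)
    from b obtain u' v' where b': "b = u' @ v'" "u' \<in> listset G" "length u' = length G"
      by (rule listset_appendE)
    have "cell_le a b \<longleftrightarrow> cell_le u u' \<and> cell_le v v'"
      unfolding a'(1) b'(1) using a'(3) b'(3) by (intro cell_le_append) simp
    moreover have "cell_le (f u @ v) (f u' @ v') \<longleftrightarrow> cell_le (f u) (f u') \<and> cell_le v v'"
      using len[OF a'(2)] len[OF b'(2)] by (intro cell_le_append) simp
    ultimately show ?thesis
      unfolding a'(1) b'(1) F[OF a'(2)] F[OF b'(2)] using le[OF a'(2) b'(2)] by blast
  qed
  ultimately show ?thesis
    using product_complex_append[OF G H] product_complex_append[OF G' H]
    by (intro complex_isoI[of _ _ F]) (simp_all add: bij_betw_def)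
qed

lemma iso_swap:
  assumes G: "product_complex G" and H: "product_complex H"
  shows "complex_iso (G @ H) (H @ G)"
proof -
  define F :: "'a set list \<Rightarrow> 'a set list" where "F zs = drop (length G) zs @ take (length G) zs" for zs
  have F: "F (us @ vs) = vs @ us" if "length us = length G" for us vs
    using that by (simp add: F_def)
  have "bij_betw F (listset (G @ H)) (listset (H @ G))"
  proof (rule bij_betw_byWitness[where f' = "\<lambda>zs. drop (length H) zs @ take (length H) zs"])
    show "F ` listset (G @ H) \<subseteq> listset (H @ G)"
      by (auto elim!: listset_appendE simp: F intro: listset_appendI)
    show "(\<lambda>zs. drop (length H) zs @ take (length H) zs) ` listset (H @ G) \<subseteq> listset (G @ H)"
      by (auto elim!: listset_appendE intro: listset_appendI)
  qed (auto elim!: listset_appendE simp: F)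
  moreover have "cell_le a b \<longleftrightarrow> cell_le (F a) (F b)"
    if a: "a \<in> listset (G @ H)" and b: "b \<in> listset (G @ H)" for a b
  proof -
    from a obtain u v where a': "a = u @ v" "length u = length G" "length v = length H"
      by (rule listset_appendE)
    from b obtain u' v' where b': "b = u' @ v'" "length u' = length G" "length v' = length H"
      by (rule listset_appendE)
    show ?thesis using a' b' by (auto simp: F cell_le_append)
  qed
  ultimately show ?thesis
    using product_complex_append[OF G H] product_complex_append[OF H G]
    by (intro complex_isoI[of _ _ F])
qed

lemma iso_one:
  assumes H: "product_complex H"
  shows "complex_iso ([{{v}}] @ H) H"
proof -
  have "simplicial_complex {{v}}"
    by (auto simp: simplicial_complex_def)
  then have "product_complex ([{{v}}] @ H)"
    using H by (auto simp: product_complex_def)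
  moreover have "bij_betw tl (listset ([{{v}}] @ H)) (listset H)"
    by (rule bij_betw_byWitness[where f' = "Cons {v}"]) (auto simp: set_Cons_def)
  moreover have "cell_le a b \<longleftrightarrow> cell_le (tl a) (tl b)"
    if "a \<in> listset ([{{v}}] @ H)" "b \<in> listset ([{{v}}] @ H)" for a b
  proof -
    from that obtain a' b' where "a = {v} # a'" "b = {v} # b'" by (auto simp: set_Cons_def)
    then show ?thesis by simp
  qed
  ultimately show ?thesis
    using H by (intro complex_isoI[of _ _ tl])
qed


lemma connected_refl: "x \<in> X \<Longrightarrow> (x, x) \<in> connected_in X"
  by (auto simp: connected_in_def)

lemma connected_mem: "(x, y) \<in> connected_in X \<Longrightarrow> x \<in> X \<and> y \<in> X"
  by (auto simp: connected_in_def)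

lemma connected_trans:
  "(x, y) \<in> connected_in X \<Longrightarrow> (y, z) \<in> connected_in X \<Longrightarrow> (x, z) \<in> connected_in X"
  by (auto simp: connected_in_def)

lemma connected_step:
  "x \<in> X \<Longrightarrow> y \<in> X \<Longrightarrow> x \<subseteq> y \<or> y \<subseteq> x \<Longrightarrow> (x, y) \<in> connected_in X"
  by (auto simp: connected_in_def)

lemma connected_sym: "(x, y) \<in> connected_in X \<Longrightarrow> (y, x) \<in> connected_in X"
proof -
  have "sym ({(x, y) \<in> X \<times> X. x \<subseteq> y \<or> y \<subseteq> x}\<^sup>*)"
    by (rule sym_rtrancl) (auto simp: sym_def)
  then show "(x, y) \<in> connected_in X \<Longrightarrow> (y, x) \<in> connected_in X"
    by (auto simp: connected_in_def sym_def)
qed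

lemma connected_induct [consumes 1, case_names base step]:
  assumes "(x, y) \<in> connected_in X" and "P x"
    and "\<And>y z. (x, y) \<in> connected_in X \<Longrightarrow> z \<in> X \<Longrightarrow> y \<subseteq> z \<or> z \<subseteq> y \<Longrightarrow> P y \<Longrightarrow> P z"
  shows "P y"
proof -
  let ?R = "{(x, y) \<in> X \<times> X. x \<subseteq> y \<or> y \<subseteq> x}"
  have x: "x \<in> X" and R: "(x, y) \<in> ?R\<^sup>*"
    using assms(1) by (auto simp: connected_in_def)
  from R have "P y \<and> (x, y) \<in> connected_in X"
  proof (induction rule: rtrancl_induct)
    case base
    then show ?case using x assms(2) connected_refl by auto
  next
    case (step y z)
    then have xy: "(x, y) \<in> connected_in X" "P y" and yz: "z \<in> X" "y \<in> X" "y \<subseteq> z \<or> z \<subseteq> y"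
      by auto
    have "P z" using assms(3)[OF xy(1) yz(1,3) xy(2)] .
    moreover have "(x, z) \<in> connected_in X"
      using connected_trans[OF xy(1) connected_step[OF yz(2,1,3)]] .
    ultimately show ?case by blast
  qed
  then show ?thesis by blast
qed

lemma equiv_connected: "equiv X (connected_in X)"
proof (rule equivI)
  show "connected_in X \<subseteq> X \<times> X" by (auto dest: connected_mem)
  show "refl_on X (connected_in X)" by (rule refl_onI) (rule connected_refl)
  show "sym (connected_in X)" by (rule symI) (rule connected_sym)
  show "trans (connected_in X)" by (rule transI) (rule connected_trans)
qed

lemma Union_components: "\<Union>(components X) = X"
  unfolding components_def by (rule Union_quotient[OF equiv_connected])

lemma component_nonempty: "K \<in> components X \<Longrightarrow> K \<noteq> {}"
  unfolding components_def using in_quotient_imp_non_empty[OF equiv_connected] by blast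

lemma finite_components: "finite X \<Longrightarrow> finite (components X)"
  by (metis Union_components finite_UnionD)

lemma connected_image:
  assumes "(x, y) \<in> connected_in X"
    and "\<And>x. x \<in> X \<Longrightarrow> f x \<in> Y" and "\<And>x y. x \<in> X \<Longrightarrow> y \<in> X \<Longrightarrow> x \<subseteq> y \<Longrightarrow> f x \<subseteq> f y"
  shows "(f x, f y) \<in> connected_in Y"
  using assms(1)
proof (induction rule: connected_induct)
  case base
  show ?case using assms(2) connected_mem[OF assms(1)] by (intro connected_refl) blast
next
  case (step y z)
  then have "(f y, f z) \<in> connected_in Y"
    using assms(2,3) connected_mem[OF step(1)] by (intro connected_step) blast+
  with step(4) show ?case by (rule connected_trans)
qed

lemma connected_product:
  assumes "product_complex Gs \<or> Gs = []"
    and "list_all2 (\<in>) xs Gs"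
    and "list_all2 (\<lambda>(x, G) y. (x, y) \<in> connected_in G) (zip xs Gs) ys"
  shows "(listset xs, listset ys) \<in> connected_in (cells Gs)"
  using assms
proof (induction Gs arbitrary: xs ys)
  case Nil
  then show ?case by (auto simp: cells_def intro: connected_refl)
next
  case (Cons G Gs)
  then obtain x xs' where xs: "xs = x # xs'" "x \<in> G" "list_all2 (\<in>) xs' Gs"
    by (auto simp: list_all2_Cons2)
  with Cons.prems obtain y ys' where ys: "ys = y # ys'" "(x, y) \<in> connected_in G"
    "list_all2 (\<lambda>(x, G) y. (x, y) \<in> connected_in G) (zip xs' Gs) ys'"
    by (auto simp: list_all2_Cons1)
  have tl: "product_complex Gs \<or> Gs = []"
    using Cons.prems by (auto simp: product_complex_def)
  have IH: "(listset xs', listset ys') \<in> connected_in (cells Gs)"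
    using Cons.IH[OF tl xs(3) ys(3)] .
  have "(set_Cons x (listset xs'), set_Cons y (listset xs')) \<in> connected_in (cells (G # Gs))"
    using ys(2)
  proof (rule connected_image)
    show "set_Cons x' (listset xs') \<in> cells (G # Gs)" if "x' \<in> G" for x'
    proof -
      have "x' # xs' \<in> listset (G # Gs)" using that xs by (simp add: listset_iff del: listset.simps)
      then have "listset (x' # xs') \<in> cells (G # Gs)" unfolding cells_def by blast
      then show ?thesis by simp
    qed
  qed (auto simp: set_Cons_def)
  moreover have "(set_Cons y (listset xs'), set_Cons y (listset ys')) \<in> connected_in (cells (G # Gs))"
    using IH
  proof (rule connected_image)
    show "set_Cons y c \<in> cells (G # Gs)" if c: "c \<in> cells Gs" for c
    proof -
      obtain zs where "c = listset zs" "zs \<in> listset Gs"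
        using c unfolding cells_def by (rule imageE)
      moreover from this have "y # zs \<in> listset (G # Gs)"
        using connected_mem[OF ys(2)] by (simp add: listset_iff del: listset.simps)
      then have "listset (y # zs) \<in> cells (G # Gs)" unfolding cells_def by blast
      ultimately show ?thesis by simp
    qed
  qed (auto simp: set_Cons_def)
  ultimately show ?case using xs ys connected_trans by (metis listset.simps(2))
qed

lemma simplicial_complex_face:
  "simplicial_complex G \<Longrightarrow> x \<in> G \<Longrightarrow> y \<noteq> {} \<Longrightarrow> y \<subseteq> x \<Longrightarrow> y \<in> G"
  unfolding simplicial_complex_def by blast

lemma component_product_complex:
  assumes Gs: "product_complex Gs" and K: "K \<in> components (cells Gs)"
  shows "\<exists>Cs. product_complex Cs \<and> cells Cs = K"
proof -
  obtain xs where xs: "xs \<in> listset Gs" and Kx: "K = connected_in (cells Gs) `` {listset xs}"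
    using K by (auto simp: components_def quotient_def cells_def)
  have lx: "length xs = length Gs" using product_complex_listset[OF Gs xs] by simp
  have xG: "xs ! i \<in> Gs ! i" if "i < length Gs" for i
    using xs that by (auto simp: listset_iff list_all2_conv_all_nth)
  define Cs where "Cs = map2 (\<lambda>x G. connected_in G `` {x}) xs Gs"
  have lC: "length Cs = length Gs" by (simp add: Cs_def lx)
  have Ci: "Cs ! i = connected_in (Gs ! i) `` {xs ! i}" if "i < length Gs" for i
    using that by (simp add: Cs_def lx)
  have CG: "Cs ! i \<subseteq> Gs ! i" if "i < length Gs" for i
    using that Ci connected_mem by fastforce
  have sc: "simplicial_complex (Cs ! i)" if i: "i < length Gs" for i
  proof -
    have G: "simplicial_complex (Gs ! i)" using Gs i by (auto simp: product_complex_def)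
    have 1: "y \<in> Cs ! i" if x: "x \<in> Cs ! i" and y: "y \<noteq> {}" "y \<subseteq> x" for x y
    proof -
      have xG: "x \<in> Gs ! i" using x CG i by blast
      have "y \<in> Gs ! i" using simplicial_complex_face[OF G xG y] .
      then have "(x, y) \<in> connected_in (Gs ! i)" using xG y(2) by (intro connected_step) auto
      moreover have "(xs ! i, x) \<in> connected_in (Gs ! i)" using x Ci[OF i] by simp
      ultimately have "(xs ! i, y) \<in> connected_in (Gs ! i)" using connected_trans by metis
      then show ?thesis using Ci[OF i] by simp
    qed
    have 2: "finite (Cs ! i)"
      using G CG[OF i] unfolding simplicial_complex_def by (metis finite_subset)
    have 3: "finite x \<and> x \<noteq> {}" if "x \<in> Cs ! i" for x
    proof -
      have "x \<in> Gs ! i" using that CG[OF i] by (rule subsetD[rotated])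
      then show ?thesis using G unfolding simplicial_complex_def by simp
    qed
    show ?thesis unfolding simplicial_complex_def
      using 2 3 by (intro conjI ballI allI impI) (blast, blast, blast, erule conjE, rule 1)
  qed
  have "Cs \<noteq> []" using Gs lC by (auto simp: product_complex_def)
  then have Cs: "product_complex Cs"
    using sc lC by (auto simp: product_complex_def in_set_conv_nth)
  have "cells Cs = K"
  proof (intro equalityI subsetI)
    fix c assume "c \<in> cells Cs"
    then obtain ys where ys: "c = listset ys" "ys \<in> listset Cs" by (auto simp: cells_def)
    then have "length ys = length Gs" "\<And>i. i < length Gs \<Longrightarrow> (xs ! i, ys ! i) \<in> connected_in (Gs ! i)"
      using Ci lC by (auto simp: listset_iff list_all2_conv_all_nth)
    then have "list_all2 (\<lambda>(x, G) y. (x, y) \<in> connected_in G) (zip xs Gs) ys"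
      using lx by (auto simp: list_all2_conv_all_nth)
    then have "(listset xs, listset ys) \<in> connected_in (cells Gs)"
      using connected_product[of Gs xs ys] Gs xs by (auto simp: listset_iff)
    then show "c \<in> K" using Kx ys by blast
  next
    fix c assume "c \<in> K"
    then have "(listset xs, c) \<in> connected_in (cells Gs)" using Kx by blast
    then show "c \<in> cells Cs"
    proof (induction rule: connected_induct)
      case base
      have "xs ! i \<in> Cs ! i" if "i < length Gs" for i
        using Ci[OF that] connected_refl[OF xG[OF that]] by simp
      then have "xs \<in> listset Cs"
        using lC lx by (simp add: listset_iff list_all2_conv_all_nth)
      then show ?case by (simp add: cells_def)
    next
      case (step c d)
      obtain ys where ys: "c = listset ys" "ys \<in> listset Cs"
        using step(4) unfolding cells_def by (rule imageE)
      obtain zs where zs: "d = listset zs" "zs \<in> listset Gs"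
        using step(2) unfolding cells_def by (rule imageE)
      have lys: "length ys = length Gs" and lzs: "length zs = length Gs"
        using ys(2) zs(2) lC by (simp_all add: listset_iff list_all2_lengthD)
      have ysi: "ys ! i \<in> Cs ! i" and zsi: "zs ! i \<in> Gs ! i" if "i < length Gs" for i
        using ys(2) zs(2) lC that by (simp_all add: listset_iff list_all2_conv_all_nth)
      have ysG: "ys ! i \<in> Gs ! i" if "i < length Gs" for i
        using ysi[OF that] CG[OF that] by (rule subsetD[rotated])
      then have "ys \<in> listset Gs"
        using lys by (simp add: listset_iff list_all2_conv_all_nth)
      then have le: "cell_le ys zs \<or> cell_le zs ys"
        using step(3) cell_le_iff[OF Gs _ zs(2), of ys] cell_le_iff[OF Gs zs(2), of ys]
        unfolding ys(1) zs(1) by simp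
      have "zs ! i \<in> Cs ! i" if i: "i < length Gs" for i
      proof -
        have "ys ! i \<subseteq> zs ! i \<or> zs ! i \<subseteq> ys ! i"
          using le i lys lzs by (auto simp: list_all2_conv_all_nth)
        then have "(ys ! i, zs ! i) \<in> connected_in (Gs ! i)"
          by (rule connected_step[OF ysG[OF i] zsi[OF i]])
        moreover have "(xs ! i, ys ! i) \<in> connected_in (Gs ! i)"
          using ysi[OF i] Ci[OF i] by simp
        ultimately have "(xs ! i, zs ! i) \<in> connected_in (Gs ! i)" using connected_trans by metis
        then show ?thesis using Ci[OF i] by simp
      qed
      then have "zs \<in> listset Cs"
        using lzs lC by (simp add: listset_iff list_all2_conv_all_nth)
      then show ?case using zs(1) by (simp add: cells_def)
    qed
  qed
  with Cs show ?thesis by blast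
qed

lemma finite_listset: "\<forall>A\<in>set As. finite A \<Longrightarrow> finite (listset As)"
proof (induction As)
  case (Cons A As)
  have "listset (A # As) = (\<lambda>(x, xs). x # xs) ` (A \<times> listset As)"
    by (auto simp: set_Cons_def)
  then show ?case using Cons by simp
qed auto

lemma finite_cells: "product_complex Gs \<Longrightarrow> finite (cells Gs)"
  unfolding cells_def
  by (intro finite_imageI finite_listset) (simp add: product_complex_def simplicial_complex_def)

lemma splitting_exists:
  assumes "product_complex G"
  shows "\<exists>M. (\<forall>H\<in>#M. product_complex H) \<and> image_mset cells M = mset_set (components (cells G))"
proof -
  obtain c where c: "\<And>K. K \<in> components (cells G) \<Longrightarrow> product_complex (c K) \<and> cells (c K) = K"
    using component_product_complex[OF assms] by metis
  let ?K = "components (cells G)"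
  have "finite ?K" using finite_components finite_cells assms by blast
  then have "\<forall>H\<in>#image_mset c (mset_set ?K). product_complex H"
    and "image_mset cells (image_mset c (mset_set ?K)) = mset_set ?K"
    using c by (auto simp: image_mset.compositionality intro!: multiset.map_ident_strong)
  then show ?thesis by blast
qed

lemma sum_components:
  assumes fin: "finite I" and finB: "finite X" and X: "(\<Union>i\<in>I. B i) = X"
    and disj: "\<And>i j. i \<in> I \<Longrightarrow> j \<in> I \<Longrightarrow> i \<noteq> j \<Longrightarrow> B i \<inter> B j = {}"
    and closed: "\<And>i x y. i \<in> I \<Longrightarrow> x \<in> B i \<Longrightarrow> y \<in> X \<Longrightarrow> x \<subseteq> y \<or> y \<subseteq> x \<Longrightarrow> y \<in> B i"
  shows "(\<Sum>i\<in>I. mset_set (components (B i))) = mset_set (components X)"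
proof -
  have conn: "(x, y) \<in> connected_in X \<longleftrightarrow> (x, y) \<in> connected_in (B i)" if i: "i \<in> I" "x \<in> B i" for i x y
  proof
    assume "(x, y) \<in> connected_in X"
    then show "(x, y) \<in> connected_in (B i)"
    proof (induction rule: connected_induct)
      case base
      then show ?case using i connected_refl by blast
    next
      case (step y z)
      then have "y \<in> B i" using connected_mem by blast
      then have "(y, z) \<in> connected_in (B i)"
        using step closed i by (meson connected_step)
      then show ?case using step connected_trans by blast
    qed
  next
    assume "(x, y) \<in> connected_in (B i)"
    then show "(x, y) \<in> connected_in X"
      by (rule connected_image[where f = "\<lambda>x. x", simplified]) (use i X in auto)
  qed
  have comps: "components X = (\<Union>i\<in>I. components (B i))"
    unfolding components_def quotient_def using conn X by (auto 0 4)
  have disj': "components (B i) \<inter> components (B j) = {}" if "i \<in> I" "j \<in> I" "i \<noteq> j" for i j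
  proof (rule ccontr)
    assume "components (B i) \<inter> components (B j) \<noteq> {}"
    then obtain K where K: "K \<in> components (B i)" "K \<in> components (B j)" by blast
    then have "K \<subseteq> B i \<inter> B j" using Union_components by blast
    then show False using disj[OF that] component_nonempty[OF K(1)] by blast
  qed
  have finC: "finite (components (B i))" if "i \<in> I" for i
    using that X finB finite_components by (metis UN_upper finite_subset)
  have "(\<Sum>i\<in>J. mset_set (components (B i))) = mset_set (\<Union>i\<in>J. components (B i))" if "J \<subseteq> I" for J
    using finite_subset[OF that fin] that
  proof (induction J rule: finite_induct)
    case (insert j J)
    have "mset_set (components (B j) \<union> (\<Union>i\<in>J. components (B i))) =
        mset_set (components (B j)) + mset_set (\<Union>i\<in>J. components (B i))"
    proof (rule mset_set_Union)
      show "finite (components (B j))" using finC insert.prems by simp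
      show "finite (\<Union>i\<in>J. components (B i))" using finC insert.prems insert.hyps by auto
      have "components (B j) \<inter> components (B i) = {}" if "i \<in> J" for i
        using insert.prems insert.hyps that by (intro disj') auto
      then show "components (B j) \<inter> (\<Union>i\<in>J. components (B i)) = {}" by blast
    qed
    moreover have "(\<Sum>i\<in>J. mset_set (components (B i))) = mset_set (\<Union>i\<in>J. components (B i))"
      using insert.prems by (intro insert.IH) blast
    ultimately show ?case
      by (simp only: UN_insert sum.insert[OF insert.hyps])
  qed auto
  from this[OF subset_refl] show ?thesis unfolding comps .
qed

lemma cells_append_image:
  "cells (G @ H) = (\<lambda>(us, vs). listset (us @ vs)) ` (listset G \<times> listset H)"
proof -
  have "listset (G @ H) = (\<lambda>(us, vs). us @ vs) ` (listset G \<times> listset H)"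
  proof (intro equalityI subsetI)
    fix c assume "c \<in> listset (G @ H)"
    then obtain us vs where "c = us @ vs" "us \<in> listset G" "vs \<in> listset H"
      by (rule listset_appendE)
    then show "c \<in> (\<lambda>(us, vs). us @ vs) ` (listset G \<times> listset H)" by auto
  next
    fix c assume "c \<in> (\<lambda>(us, vs). us @ vs) ` (listset G \<times> listset H)"
    then obtain us vs where "c = us @ vs" "us \<in> listset G" "vs \<in> listset H" by auto
    then show "c \<in> listset (G @ H)" by (simp add: listset_appendI)
  qed
  then show ?thesis by (simp add: cells_def image_image case_prod_unfold)
qed

lemma cells_appendE:
  assumes "c \<in> cells (G @ H)"
  obtains us vs where "c = listset (us @ vs)" "us \<in> listset G" "vs \<in> listset H"
  using assms unfolding cells_append_image by auto

lemma cells_appendI: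
  "us \<in> listset G \<Longrightarrow> vs \<in> listset H \<Longrightarrow> listset (us @ vs) \<in> cells (G @ H)"
  unfolding cells_append_image by auto

lemma listset_cells: "us \<in> listset G \<Longrightarrow> listset us \<in> cells G"
  by (simp add: cells_def)

lemma cellsE:
  assumes "c \<in> cells G"
  obtains us where "c = listset us" "us \<in> listset G"
  using assms unfolding cells_def by blast

lemma listset_inj:
  "product_complex G \<Longrightarrow> us \<in> listset G \<Longrightarrow> vs \<in> listset G \<Longrightarrow> listset us = listset vs \<Longrightarrow> us = vs"
  using bij_listset[of G] by (auto simp: bij_betw_def dest: inj_onD)

lemma split_append:
  assumes G: "product_complex G" and H: "product_complex H" and M: "\<forall>C\<in>#M. product_complex C"
    and MG: "image_mset cells M = mset_set (components (cells G))" and e: "e \<in> {1, -1}"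
  shows "strong_eq {#(e, G @ H)#} (image_mset (\<lambda>C. (e, C @ H)) M)"
proof -
  have GH: "product_complex (G @ H)" using G H by (rule product_complex_append)
  have CH: "product_complex (C @ H)" if "C \<in># M" for C
    using that M H by (auto intro: product_complex_append)
  have finG: "finite (components (cells G))" using finite_components finite_cells G by blast
  have cellsM: "cells ` set_mset M = components (cells G)"
    using arg_cong[OF MG, of set_mset] finG by simp
  have Mset: "M = mset_set (set_mset M)"
  proof (rule multiset_eqI)
    fix C
    have "count M C \<le> 1"
    proof (rule ccontr)
      assume "\<not> count M C \<le> 1"
      then have "{#C, C#} \<subseteq># M" by (simp add: mset_subset_eq_count subseteq_mset_def)
      then have "{#cells C, cells C#} \<subseteq># mset_set (components (cells G))"
        using image_mset_subseteq_mono[of _ _ cells] MG by fastforce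
      then have "2 \<le> count (mset_set (components (cells G))) (cells C)"
        by (auto dest!: mset_subset_eq_count[where a = "cells C"])
      then show False by (simp add: count_mset_set' split: if_splits)
    qed
    then show "count M C = count (mset_set (set_mset M)) C"
      by (cases "C \<in># M") (simp_all add: le_Suc_eq not_in_iff, metis not_in_iff)
  qed
  have inj: "inj_on cells (set_mset M)"
  proof (rule eq_card_imp_inj_on)
    show "card (cells ` set_mset M) = card (set_mset M)"
      using arg_cong[OF MG, of size] Mset cellsM by (metis size_image_mset size_mset_set)
  qed simp
  obtain D where D: "\<And>C. C \<in># M \<Longrightarrow> \<forall>H\<in>#D C. product_complex H"
    "\<And>C. C \<in># M \<Longrightarrow> image_mset cells (D C) = mset_set (components (cells (C @ H)))"
    using splitting_exists[OF CH] by metis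
  have comp: "cells C \<in> components (cells G)" if "C \<in># M" for C
    unfolding cellsM[symmetric] using that by (rule imageI)
  have sub: "us \<in> listset G" if C: "C \<in># M" and us: "us \<in> listset C" for C us
  proof -
    have "cells C \<subseteq> cells G"
      using Union_upper[OF comp[OF C]] unfolding Union_components .
    then have "listset us \<in> cells G" using listset_cells[OF us] by (rule subsetD)
    then obtain ys where ys: "listset us = listset ys" "ys \<in> listset G" by (rule cellsE)
    have nx: "{} \<notin> set us" "{} \<notin> set ys"
      using product_complex_listset(2)[OF bspec[OF M C] us] product_complex_listset(2)[OF G ys(2)]
      by simp_all
    obtain z where "z \<in> listset us" using listset_nonempty[OF nx(1)] by blast
    then have "list_all2 (\<in>) z us" "list_all2 (\<in>) z ys" using ys(1) by (auto simp: listset_iff)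
    then have len: "length us = length ys" using list_all2_lengthD by metis
    have "cell_le us ys" "cell_le ys us"
      using listset_mono_iff[OF len nx(1)] listset_mono_iff[OF len[symmetric] nx(2)] ys(1) by auto
    then have "us = ys" by (rule cell_le_antisym)
    then show ?thesis using ys by simp
  qed
  have cover: "\<exists>C\<in>#M. us \<in> listset C" if us: "us \<in> listset G" for us
  proof -
    have "listset us \<in> \<Union>(components (cells G))"
      using listset_cells[OF us] by (simp add: Union_components)
    then obtain C where C: "C \<in># M" "listset us \<in> cells C"
      unfolding cellsM[symmetric] by blast
    obtain ys where ys: "listset us = listset ys" "ys \<in> listset C" using C(2) by (rule cellsE)
    have "us = ys" using listset_inj[OF G us sub[OF C(1) ys(2)] ys(1)] .
    then show ?thesis using ys C by blast
  qed
  have closed: "us' \<in> listset C"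
    if C: "C \<in># M" and us: "us \<in> listset C" "us' \<in> listset G"
      and le: "cell_le us us' \<or> cell_le us' us" for C us us'
  proof -
    have usG: "us \<in> listset G" using sub[OF C us(1)] .
    have "listset us \<subseteq> listset us' \<or> listset us' \<subseteq> listset us"
      using le cell_le_iff[OF G usG us(2)] cell_le_iff[OF G us(2) usG] by blast
    then have conn: "(listset us, listset us') \<in> connected_in (cells G)"
      by (rule connected_step[OF listset_cells[OF usG] listset_cells[OF us(2)]])
    have "cells C \<in> cells G // connected_in (cells G)"
      using comp[OF C] unfolding components_def .
    from in_quotient_imp_closed[OF equiv_connected this listset_cells[OF us(1)] conn]
    obtain ys where ys: "listset us' = listset ys" "ys \<in> listset C" by (rule cellsE)
    have "us' = ys" using listset_inj[OF G us(2) sub[OF C ys(2)] ys(1)] .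
    then show ?thesis using ys by simp
  qed
  have disj: "C = C'" if C: "C \<in># M" "C' \<in># M" and us: "us \<in> listset C" "us \<in> listset C'" for C C' us
  proof -
    have "cells C \<in> cells G // connected_in (cells G)" "cells C' \<in> cells G // connected_in (cells G)"
      using comp[OF C(1)] comp[OF C(2)] unfolding components_def .
    from quotient_disj[OF equiv_connected this] have "cells C = cells C' \<or> cells C \<inter> cells C' = {}" .
    then have "cells C = cells C'" using listset_cells[OF us(1)] listset_cells[OF us(2)] by blast
    then show ?thesis using inj_onD[OF inj _ C] by simp
  qed
  have sum: "(\<Sum>C\<in>set_mset M. mset_set (components (cells (C @ H)))) = mset_set (components (cells (G @ H)))"
  proof (rule sum_components)
    show "finite (set_mset M)" by simp
    show "finite (cells (G @ H))" using GH by (rule finite_cells)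
    show "(\<Union>C\<in>set_mset M. cells (C @ H)) = cells (G @ H)"
    proof (intro equalityI subsetI)
      fix c assume "c \<in> (\<Union>C\<in>set_mset M. cells (C @ H))"
      then obtain C where C: "C \<in># M" "c \<in> cells (C @ H)" by blast
      from C(2) show "c \<in> cells (G @ H)"
        by (rule cells_appendE) (simp add: cells_appendI sub[OF C(1)])
    next
      fix c assume "c \<in> cells (G @ H)"
      then obtain us vs where c: "c = listset (us @ vs)" "us \<in> listset G" "vs \<in> listset H"
        by (rule cells_appendE)
      from cover[OF c(2)] obtain C where "C \<in># M" "us \<in> listset C" by blast
      then show "c \<in> (\<Union>C\<in>set_mset M. cells (C @ H))" using c cells_appendI by blast
    qed
    show "y \<in> cells (C @ H)" if C: "C \<in># M" and x: "x \<in> cells (C @ H)" and y: "y \<in> cells (G @ H)"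
      and xy: "x \<subseteq> y \<or> y \<subseteq> x" for C x y
    proof -
      obtain us vs where uv: "x = listset (us @ vs)" "us \<in> listset C" "vs \<in> listset H"
        using x by (rule cells_appendE)
      obtain us' vs' where uv': "y = listset (us' @ vs')" "us' \<in> listset G" "vs' \<in> listset H"
        using y by (rule cells_appendE)
      have uG: "us \<in> listset G" using sub[OF C uv(2)] .
      note m = listset_appendI[OF uG uv(3)] listset_appendI[OF uv'(2,3)]
      have le: "cell_le (us @ vs) (us' @ vs') \<or> cell_le (us' @ vs') (us @ vs)"
        using xy cell_le_iff[OF GH m] cell_le_iff[OF GH m(2,1)] unfolding uv(1) uv'(1) by blast
      have len: "length us = length us'"
        using product_complex_listset(1)[OF G uG] product_complex_listset(1)[OF G uv'(2)] by simp
      have "cell_le us us' \<or> cell_le us' us"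
        using le cell_le_append[OF len] cell_le_append[OF len[symmetric]] by blast
      then have "us' \<in> listset C" by (rule closed[OF C uv(2) uv'(2)])
      then show ?thesis using uv'(3) unfolding uv'(1) by (rule cells_appendI)
    qed
    show "cells (C @ H) \<inter> cells (C' @ H) = {}"
      if C: "C \<in> set_mset M" "C' \<in> set_mset M" "C \<noteq> C'" for C C'
    proof (rule ccontr)
      assume "cells (C @ H) \<inter> cells (C' @ H) \<noteq> {}"
      then obtain c where c: "c \<in> cells (C @ H)" "c \<in> cells (C' @ H)" by blast
      from c(1) obtain us vs where uv: "c = listset (us @ vs)" "us \<in> listset C" "vs \<in> listset H"
        by (rule cells_appendE)
      from c(2) obtain us' vs' where uv': "c = listset (us' @ vs')" "us' \<in> listset C'" "vs' \<in> listset H"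
        by (rule cells_appendE)
      note uG = sub[OF C(1) uv(2)] sub[OF C(2) uv'(2)]
      have "us @ vs = us' @ vs'"
        using listset_inj[OF GH listset_appendI[OF uG(1) uv(3)] listset_appendI[OF uG(2) uv'(3)]]
          uv(1) uv'(1) by simp
      moreover have "length us = length us'"
        using product_complex_listset(1)[OF G uG(1)] product_complex_listset(1)[OF G uG(2)] by simp
      ultimately have "us = us'" by simp
      then show False using disj[OF C(1,2) uv(2)] uv'(2) C(3) by simp
    qed
  qed
  define N where "N = (\<Sum>C\<in>#M. D C)"
  have "\<forall>K\<in>#N. product_complex K" using D(1) by (auto simp: N_def)
  moreover have "image_mset cells N = mset_set (components (cells (G @ H)))"
  proof -
    have "image_mset cells (\<Sum>C\<in>#M'. D C) = (\<Sum>C\<in>#M'. image_mset cells (D C))" for M'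
      by (induction M') auto
    then have "image_mset cells N = (\<Sum>C\<in>#M. image_mset cells (D C))" by (simp add: N_def)
    also have "\<dots> = (\<Sum>C\<in>#M. mset_set (components (cells (C @ H))))"
      using D(2) by (intro arg_cong[where f = sum_mset] image_mset_cong)
    also have "\<dots> = (\<Sum>C\<in>#mset_set (set_mset M). mset_set (components (cells (C @ H))))"
      using Mset by (rule arg_cong)
    also have "\<dots> = (\<Sum>C\<in>set_mset M. mset_set (components (cells (C @ H))))"
      by (rule sum_unfold_sum_mset[symmetric])
    finally show ?thesis unfolding sum .
  qed
  ultimately have 1: "strong_eq {#(e, G @ H)#} (image_mset (\<lambda>K. (e, K)) N)"
    using strong_eq.split[of e "G @ H" "{#}" N] GH e by simp
  have "strong_eq (\<Sum>C\<in>#M. {#(e, C @ H)#}) (\<Sum>C\<in>#M. image_mset (\<lambda>K. (e, K)) (D C))"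
  proof (rule strong_eq_sum, rule ballI)
    fix C assume C: "C \<in># M"
    then show "strong_eq {#(e, C @ H)#} (image_mset (\<lambda>K. (e, K)) (D C))"
      using strong_eq.split[of e "C @ H" "{#}" "D C"] D(1)[OF C] D(2)[OF C] CH[OF C] e
      by simp
  qed
  moreover have "(\<Sum>C\<in>#M. {#(e, C @ H)#}) = image_mset (\<lambda>C. (e, C @ H)) M"
    by (induction M) auto
  moreover have "(\<Sum>C\<in>#M. image_mset (\<lambda>K. (e, K)) (D C)) = image_mset (\<lambda>K. (e, K)) N"
    unfolding N_def by (induction M) auto
  ultimately have "strong_eq (image_mset (\<lambda>C. (e, C @ H)) M) (image_mset (\<lambda>K. (e, K)) N)"
    by simp
  with 1 show ?thesis by (blast intro: strong_eq.sym strong_eq.trans)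
qed

lemma strong_eq_mult_single:
  assumes "strong_eq A B" and f: "f \<in> {1, -1}" and H: "product_complex H"
  shows "strong_eq (sc_mult A {#(f, H)#}) (sc_mult B {#(f, H)#})"
  using assms(1)
proof (induction rule: strong_eq.induct)
  case (refl A)
  then show ?case using f H by (intro strong_eq.refl signed_mult) auto
next
  case (iso e G A G')
  then have "e * f \<in> {1, -1}" "signed_complex (sc_mult A {#(f, H)#})"
    "product_complex (G @ H)" "product_complex (G' @ H)" "complex_iso (G @ H) (G' @ H)"
    using f H by (auto intro: product_complex_append iso_append signed_mult)
  then show ?case
    using strong_eq.iso[of "e * f" "G @ H" "sc_mult A {#(f, H)#}" "G' @ H"]
    by (simp add: sc_mult_add_mset(1)[of _ A])
next
  case (split e G A M)
  then have "e * f \<in> {1, -1}" and s: "signed_complex (sc_mult A {#(f, H)#})"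
    using f H by (auto intro: signed_mult)
  then have "strong_eq {#(e * f, G @ H)#} (image_mset (\<lambda>C. (e * f, C @ H)) M)"
    using split H by (intro split_append) auto
  then have "strong_eq ({#(e * f, G @ H)#} + sc_mult A {#(f, H)#})
      (image_mset (\<lambda>C. (e * f, C @ H)) M + sc_mult A {#(f, H)#})"
    using s by (rule strong_eq_add_right)
  moreover have "sc_mult (image_mset (\<lambda>C. (e, C)) M) {#(f, H)#} = image_mset (\<lambda>C. (e * f, C @ H)) M"
    by (induction M) (auto simp: sc_mult_def)
  ultimately show ?case by (simp add: sc_mult_add_mset(1)[of _ A])
next
  case (cancel e G A)
  then have "e * f \<in> {1, -1}" "signed_complex (sc_mult A {#(f, H)#})" "product_complex (G @ H)"
    using f H by (auto intro: product_complex_append signed_mult)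
  then show ?case
    using strong_eq.cancel[of "e * f" "G @ H" "sc_mult A {#(f, H)#}"]
    by (simp add: sc_mult_add_mset(1)[of _ A] sc_mult_add_mset(1)[of _ "add_mset _ A"]
        add_mset_commute)
next
  case (sym A B)
  show ?case by (rule strong_eq.sym[OF sym.IH])
next
  case (trans A B C)
  show ?case by (rule strong_eq.trans[OF trans.IH])
qed

lemma strong_eq_mult_left:
  assumes "strong_eq A B" and "signed_complex C"
  shows "strong_eq (sc_mult A C) (sc_mult B C)"
  using assms(2)
proof (induction C)
  case empty
  then show ?case by (auto intro: strong_eq.refl)
next
  case (add c C)
  obtain f H where c: "c = (f, H)" by (cases c)
  then have "strong_eq (sc_mult A {#c#}) (sc_mult B {#c#})"
    using add.prems assms(1) by (auto intro: strong_eq_mult_single)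
  moreover have "strong_eq (sc_mult A C) (sc_mult B C)"
    using add c by auto
  ultimately show ?case
    by (simp add: sc_mult_add_mset(2)[of _ c C] strong_eq_add)
qed

lemma strong_eq_mult_commute:
  assumes "signed_complex A" "signed_complex B"
  shows "strong_eq (sc_mult A B) (sc_mult B A)"
proof -
  have 1: "strong_eq (sc_mult {#a#} {#b#}) (sc_mult {#b#} {#a#})"
    if a: "signed_complex {#a#}" and b: "signed_complex {#b#}" for a b :: "'a summand"
  proof -
    obtain e G f H where ab: "a = (e, G)" "b = (f, H)" by (cases a; cases b)
    then have "strong_eq {#(e * f, G @ H)#} {#(e * f, H @ G)#}"
      using a b by (intro strong_eq.iso) (auto intro: product_complex_append iso_swap)
    then show ?thesis using ab by (simp add: mult.commute)
  qed
  have 2: "strong_eq (sc_mult {#a#} B) (sc_mult B {#a#})" if a: "signed_complex {#a#}" for a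
    using assms(2)
  proof (induction B)
    case (add b B)
    moreover have "signed_complex {#b#}" "signed_complex B"
      using add.prems by (cases b; simp)+
    ultimately show ?case using 1[OF a, of b]
      by (simp add: sc_mult_add_mset(1)[of b B] sc_mult_add_mset(2)[of _ b B] strong_eq_add)
  qed (auto intro: strong_eq.refl)
  show ?thesis
    using assms(1)
  proof (induction A)
    case (add a A)
    moreover have "signed_complex {#a#}" "signed_complex A"
      using add.prems by (cases a; simp)+
    ultimately show ?case using 2[of a]
      by (simp add: sc_mult_add_mset(1)[of a A] sc_mult_add_mset(2)[of _ a A] strong_eq_add)
  qed (auto intro: strong_eq.refl)
qed

lemma strong_eq_mult:
  assumes "strong_eq A B" "strong_eq C D"
  shows "strong_eq (sc_mult A C) (sc_mult B D)"
proof -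
  have s: "signed_complex B" "signed_complex C" "signed_complex D"
    using strong_eq_signed[OF assms(1)] strong_eq_signed[OF assms(2)] by simp_all
  have "strong_eq (sc_mult A C) (sc_mult B C)"
    using assms(1) s(2) by (rule strong_eq_mult_left)
  from strong_eq.trans[OF this strong_eq_mult_commute[OF s(1,2)]]
  have "strong_eq (sc_mult A C) (sc_mult C B)" .
  from strong_eq.trans[OF this strong_eq_mult_left[OF assms(2) s(1)]]
  have "strong_eq (sc_mult A C) (sc_mult D B)" .
  from strong_eq.trans[OF this strong_eq_mult_commute[OF s(3,1)]] show ?thesis .
qed

lemma strong_eq_neg_cancel:
  "signed_complex A \<Longrightarrow> strong_eq (sc_neg A + A) {#}"
proof (induction A)
  case (add a A)
  obtain e G where a: "a = (e, G)" by (cases a)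
  have s: "signed_complex A" "signed_complex (add_mset (- e, G) (sc_neg A + A))"
    using add.prems unfolding a by auto
  have "strong_eq (add_mset (- e, G) (add_mset (- (- e), G) (sc_neg A + A))) (sc_neg A + A)"
    using s(2) by (rule strong_eq.cancel)
  then have "strong_eq (add_mset (- e, G) (add_mset (- (- e), G) (sc_neg A + A))) {#}"
    using add.IH[OF s(1)] by (rule strong_eq.trans)
  moreover have "sc_neg (add_mset a A) + add_mset a A =
      add_mset (- e, G) (add_mset (- (- e), G) (sc_neg A + A))"
    unfolding a sc_neg_simps by (simp add: add_mset_commute[of "(- e, G)"])
  ultimately show ?case by (simp only:)
next
  case empty
  show ?case using strong_eq.refl[OF signed_empty] by simp
qed

text \<open>The signed number of cells separates one from zero in the quotient.\<close>

lemma cell_count_strong_eq: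
  assumes "strong_eq A B"
  shows "(\<Sum>(e, G)\<in>#A. e * int (card (cells G))) = (\<Sum>(e, G)\<in>#B. e * int (card (cells G)))"
  using assms
proof (induction rule: strong_eq.induct)
  case (iso e G A H)
  then show ?case by (auto simp: complex_iso_def dest: bij_betw_same_card)
next
  case (split e G A M)
  let ?X = "cells G"
  have fin: "finite ?X" "finite (components ?X)"
    using split finite_cells finite_components by auto
  have "card ?X = (\<Sum>K\<in>components ?X. card K)"
  proof -
    have "card (\<Union>(components ?X)) = (\<Sum>K\<in>components ?X. card K)"
      using fin Union_components[of ?X]
        quotient_disj[OF equiv_connected[of ?X], folded components_def]
      by (intro card_Union_disjoint)
        (auto simp: pairwise_def disjnt_def intro: finite_subset)
    then show ?thesis by (simp add: Union_components)
  qed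
  also have "\<dots> = (\<Sum>K\<in>#image_mset cells M. card K)"
    using split fin by (simp add: sum_unfold_sum_mset)
  finally have "int (card ?X) = (\<Sum>H\<in>#M. int (card (cells H)))"
    by (simp add: image_mset.compositionality comp_def of_nat_sum_mset)
  moreover have "(\<Sum>H\<in>#M. e * int (card (cells H))) = e * (\<Sum>H\<in>#M. int (card (cells H)))"
    by (simp add: sum_mset_distrib_left)
  ultimately show ?case by (simp add: image_mset.compositionality comp_def)
qed auto


subsection \<open>The quotient\<close>

quotient_type 'a strong_ring = "'a summand multiset" / partial: strong_eq
  morphisms rep_strong_ring strong_class
proof (rule part_equivpI)
  show "\<exists>x. strong_eq x x" using strong_eq.refl[OF signed_empty] by blast
  show "symp strong_eq" by (rule sympI) (rule strong_eq.sym)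
  show "transp strong_eq" by (rule transpI) (rule strong_eq.trans)
qed

lemma signed_one: "signed_complex {#(1, [{{v}}])#}"
  by (auto simp: product_complex_def simplicial_complex_def)

instantiation strong_ring :: (type) comm_ring_1
begin

lift_definition zero_strong_ring :: "'a strong_ring" is "{#}"
  by (auto intro: strong_eq.refl)

text \<open>Any vertex will do: all one-point complexes are isomorphic.\<close>

lift_definition one_strong_ring :: "'a strong_ring" is "{#(1, [{{undefined}}])#}"
  by (rule strong_eq.refl[OF signed_one])

lift_definition plus_strong_ring :: "'a strong_ring \<Rightarrow> 'a strong_ring \<Rightarrow> 'a strong_ring" is "(+)"
  by (rule strong_eq_add)

lift_definition uminus_strong_ring :: "'a strong_ring \<Rightarrow> 'a strong_ring" is sc_neg
  by (rule strong_eq_neg)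

lift_definition times_strong_ring :: "'a strong_ring \<Rightarrow> 'a strong_ring \<Rightarrow> 'a strong_ring" is sc_mult
  by (rule strong_eq_mult)

definition minus_strong_ring :: "'a strong_ring \<Rightarrow> 'a strong_ring \<Rightarrow> 'a strong_ring" where
  "minus_strong_ring x y = x + - y"

instance
proof
  fix a b c :: "'a strong_ring"
  show "a + b + c = a + (b + c)"
    by transfer (simp add: add.assoc)
  show "a + b = b + a"
    by transfer (simp add: add.commute)
  show "0 + a = a"
    by transfer simp
  show "- a + a = 0"
    by transfer (simp add: strong_eq_neg_cancel)
  show "a - b = a + - b"
    by (rule minus_strong_ring_def)
  show "a * b * c = a * (b * c)"
    by transfer (simp add: sc_mult_assoc)
  show "a * b = b * a"
    by transfer (simp add: strong_eq_mult_commute)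
  show "(a + b) * c = a * c + b * c"
    by transfer simp
  show "1 * a = a"
  proof transfer
    fix A :: "'a summand multiset"
    assume "strong_eq A A"
    then have "signed_complex A" by simp
    then show "strong_eq (sc_mult {#(1, [{{undefined}}])#} A) A"
    proof (induction A)
      case (add a A)
      obtain e G where a: "a = (e, G)" by (cases a)
      have e: "e \<in> {1, -1}" and G: "product_complex G" and A: "signed_complex A"
        using add.prems unfolding a by auto
      have U: "product_complex [{{undefined :: 'a}}]" using signed_one by auto
      have "signed_complex {#(e, [{{undefined}}] @ G)#}"
        using e product_complex_append[OF U G] by simp
      then have "strong_eq {#(e, [{{undefined}}] @ G)#} {#(e, G)#}"
        by (rule strong_eq.iso[OF _ G iso_one[OF G]])
      from strong_eq_add[OF this add.IH[OF A]]
      show ?case using a by (simp add: sc_mult_add_mset(2)[of _ "(e, G)" A])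
    qed simp
  qed
  show "(0 :: 'a strong_ring) \<noteq> 1"
  proof transfer
    have "cells [{{undefined :: 'a}}] = {listset [{undefined}]}"
      by (auto simp: cells_def set_Cons_def)
    then show "\<not> strong_eq {#} {#(1, [{{undefined :: 'a}}])#}"
      using cell_count_strong_eq[of "{#}" "{#(1, [{{undefined :: 'a}}])#}"] by auto
  qed
qed

end


section \<open>The coefficients of the interaction polynomial\<close>

lemma finite_product_tuples:
  assumes "product_complex Gs"
  shows "finite (product_tuples k Gs)"
proof -
  have "finite (tuples k G)" if "G \<in> set Gs" for G
  proof -
    have "finite G" using assms that by (simp add: product_complex_def simplicial_complex_def)
    moreover have "tuples k G \<subseteq> {X. set X \<subseteq> G \<and> length X = k}" by (auto simp: tuples_def)
    ultimately show ?thesis using finite_lists_length_eq finite_subset by blast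
  qed
  then show ?thesis unfolding product_tuples_def by (intro finite_listset) simp
qed

lemma product_deriv_zero: "product_deriv s (\<lambda>_. 0) Xs = 0"
  by (induction Xs) (simp_all add: interaction_deriv_def)

lemma exterior_deriv_zero: "exterior_deriv s k Gs (\<lambda>_. 0) = (\<lambda>_. 0)"
  by (simp add: exterior_deriv_def product_deriv_zero fun_eq_iff)

lemma zero_cochain: "(\<lambda>_. 0) \<in> cochains k Gs p"
  by (simp add: cochains_def)

lemma zero_coboundary: "(\<lambda>_. 0) \<in> coboundaries s k Gs p"
proof (cases p)
  case (Suc q)
  have "exterior_deriv s k Gs (\<lambda>_. 0) \<in> exterior_deriv s k Gs ` cochains k Gs q"
    by (rule imageI[OF zero_cochain])
  then show ?thesis by (simp add: coboundaries_def Suc exterior_deriv_zero)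
qed (simp add: coboundaries_def)

lemma quotient_dim_zero:
  assumes "(\<lambda>_. 0) \<in> B"
  shows "quotient_dim {\<lambda>_. 0} B = 0"
  unfolding quotient_dim_def
proof (rule the_equality)
  have "quotient_basis {\<lambda>_. 0} B []" using assms by (simp add: quotient_basis_def)
  then show "\<exists>bs. quotient_basis {\<lambda>_. 0} B bs \<and> length bs = 0" by auto
next
  fix n assume "\<exists>bs. quotient_basis {\<lambda>_. 0} B bs \<and> length bs = n"
  then obtain bs where bs: "quotient_basis {\<lambda>_. 0} B bs" and n: "length bs = n" by blast
  have "set bs \<subseteq> {\<lambda>_. 0}" using bs by (simp add: quotient_basis_def)
  then have "bs ! i = (\<lambda>_. 0)" if "i < n" for i
    using that nth_mem[of i bs] n by blast
  then have all: "(\<lambda>x. 0 - (\<Sum>i<length bs. c ! i * (bs ! i) x)) = (\<lambda>_. 0)" for c :: "real list"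
    using n by (simp add: fun_eq_iff)
  have "\<exists>!c :: real list. length c = length bs \<and> (\<lambda>x. 0 - (\<Sum>i<length bs. c ! i * (bs ! i) x)) \<in> B"
    using bs by (simp add: quotient_basis_def)
  then have "\<exists>!c :: real list. length c = n"
    unfolding all using assms n by simp
  then have "replicate n (0 :: real) = replicate n 1" by (metis length_replicate)
  then show "n = 0" by (cases n) simp_all
qed

lemma betti_eventually_zero:
  assumes "product_complex Gs"
  shows "\<exists>N. \<forall>p>N. betti s k Gs p = 0"
proof -
  let ?d = "(\<lambda>Xs. \<Sum>X\<leftarrow>Xs. tuple_dim X) ` product_tuples k Gs"
  have "finite ?d" using finite_product_tuples[OF assms] by (rule finite_imageI)
  then obtain N where N: "\<forall>d\<in>?d. d \<le> N" using finite_nat_set_iff_bounded_le by auto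
  have "betti s k Gs p = 0" if "p > N" for p
  proof -
    have "cochains k Gs p \<subseteq> {\<lambda>_. 0}"
      using N that by (fastforce simp: cochains_def)
    then have "cocycles s k Gs p = {\<lambda>_. 0}"
      using zero_cochain[of k Gs p] exterior_deriv_zero[of s k Gs] by (auto simp: cocycles_def)
    then show ?thesis by (simp add: betti_def quotient_dim_zero zero_coboundary)
  qed
  then show ?thesis by blast
qed

lemma coeff_interaction_poly:
  assumes "signed_complex A"
  shows "coeff (interaction_poly s k A) p = signed_betti s k A p"
proof -
  have "\<exists>N. \<forall>p>N. signed_betti s k A p = 0"
    using assms
  proof (induction A)
    case empty
    then show ?case by (simp add: signed_betti_def)
  next
    case (add a A)
    obtain e G where a: "a = (e, G)" by (cases a)
    obtain N where N: "\<forall>p>N. signed_betti s k A p = 0" using add a by auto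
    obtain M where M: "\<forall>p>M. betti s k G p = 0"
      using betti_eventually_zero add.prems a by fastforce
    have "\<forall>p>max N M. signed_betti s k (add_mset a A) p = 0"
      using N M a by (simp add: signed_betti_def)
    then show ?case by blast
  qed
  then show ?thesis
    unfolding interaction_poly_def by (metis coeff_Abs_poly)
qed

end

theory Submission
  imports Defs
begin

text \<open>
  Evaluating a polynomial of signed Betti numbers is additive for trivial reasons. What has to be
  shown is that the Betti numbers of a product complex are independent of the orientation, depend only
  on the inclusion order of the cells, add up over connected components, and obey the Kuenneth formula.

  All four are proved on harmonic cochains. The cochains are the real functions on a finite set of
  tuples, which carries the standard inner product, and every cohomology class contains exactly one
  cochain that is annihilated by the exterior derivative and by its adjoint
  (\<open>quotient_dim_harmonic\<close>). A Betti number is therefore the dimension of a concrete space of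
  functions, and this dimension is the trace of the reproducing kernel of the space. Reproducing
  kernels are unique and easy to write down: they can be carried along a bijection of the tuples that
  respects the exterior derivative up to signs, they are block diagonal on disjoint unions, and on a
  product they are sums of products of kernels. The last point is the Kuenneth formula
  (\<open>trace_dim_tensor\<close>); it rests on the fact that in \<open>|dF|\<^sup>2 + |d\<^sup>*F|\<^sup>2\<close> the mixed terms of the two
  variables cancel because of the sign \<open>(-1)\<^bsup>dim X\<^esup>\<close>, so that a cochain on a product is harmonic only if
  it is harmonic in each variable separately.

  The delicate point is invariance under isomorphism, since an order isomorphism between the cells of
  two products says nothing about their factors. A list of \<open>n\<close> intersecting \<open>k\<close>-tuples, one in each
  factor, is an \<open>n \<times> k\<close> matrix of simplices. Its transpose is a \<open>k\<close>-tuple of cells of the product, and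
  the rows of the matrix intersect if and only if these \<open>k\<close> cells have a common lower bound. Up to a
  Koszul sign the transposition respects the exterior derivative (\<open>betti_cell_tuples\<close>). In this form
  everything except the incidence numbers of the cells is visible in the order. The incidence numbers
  are determined by the order up to a change of the sign of each cell: the products along the two
  chains of a diamond are opposite, the two ends of an edge are opposite, and any two facets of a cell
  of dimension at least two are linked by common facets (\<open>incidence_unique\<close>, \<open>betti_isomorphic\<close>).

  The description by cells also settles the components: a common lower bound forces all cells of a
  tuple into the same component, and as \<open>k \<ge> 1\<close> the tuple determines that component
  (\<open>betti_components\<close>).\<close>

section \<open>Dimensions of quotient spaces\<close>

definition linear_closed :: "('b \<Rightarrow> real) set \<Rightarrow> bool" where
  "linear_closed V \<longleftrightarrow> (\<lambda>_. 0) \<in> V \<and> (\<forall>F\<in>V. \<forall>G\<in>V. \<forall>a. (\<lambda>x. F x + a * G x) \<in> V)"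

lemma linear_closedD:
  assumes "linear_closed V"
  shows "(\<lambda>_. 0) \<in> V" and "F \<in> V \<Longrightarrow> G \<in> V \<Longrightarrow> (\<lambda>x. F x + a * G x) \<in> V"
  using assms by (auto simp: linear_closed_def)

lemma linear_closed_diff:
  "linear_closed V \<Longrightarrow> F \<in> V \<Longrightarrow> G \<in> V \<Longrightarrow> (\<lambda>x. F x - G x) \<in> V"
  using linear_closedD(2)[of V F G "- 1"] by simp

lemma linear_closed_scale:
  "linear_closed V \<Longrightarrow> F \<in> V \<Longrightarrow> (\<lambda>x. a * F x) \<in> V"
  using linear_closedD(2)[of V "\<lambda>_. 0" F a] linear_closedD(1)[of V] by simp

lemma linear_closed_sum:
  assumes "linear_closed V" "finite I" "\<And>i. i \<in> I \<Longrightarrow> F i \<in> V"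
  shows "(\<lambda>x. \<Sum>i\<in>I. c i * F i x) \<in> V"
  using assms(2,3)
proof (induction I rule: finite_induct)
  case empty
  then show ?case using linear_closedD(1)[OF assms(1)] by simp
next
  case (insert i I)
  then have "(\<lambda>x. \<Sum>i\<in>I. c i * F i x) \<in> V" "F i \<in> V" by auto
  from linear_closedD(2)[OF assms(1) this, of "c i"] show ?case
    using insert.hyps by (simp add: add.commute)
qed

text \<open>The same notion as \<open>quotient_basis\<close> for an indexed family, with uniqueness of the coefficients
  expressed as linear independence modulo \<open>B\<close>.\<close>

definition basis_modulo :: "('b \<Rightarrow> real) set \<Rightarrow> ('b \<Rightarrow> real) set \<Rightarrow> nat \<Rightarrow> (nat \<Rightarrow> 'b \<Rightarrow> real) \<Rightarrow> bool" where
  "basis_modulo Z B n h \<longleftrightarrow> (\<forall>i<n. h i \<in> Z) \<and>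
     (\<forall>z\<in>Z. \<exists>c. (\<lambda>x. z x - (\<Sum>i<n. c i * h i x)) \<in> B) \<and>
     (\<forall>c. (\<lambda>x. \<Sum>i<n. c i * h i x) \<in> B \<longrightarrow> (\<forall>i<n. c i = 0))"

lemma basis_modulo_indep:
  "basis_modulo Z B n h \<Longrightarrow> (\<lambda>x. \<Sum>i<n. c i * h i x) \<in> B \<Longrightarrow> i < n \<Longrightarrow> c i = 0"
  by (auto simp: basis_modulo_def)

text \<open>Substituting one change of basis into the other returns every \<open>h j\<close> with coefficient 1. Only the
  diagonal of the product of the two matrices is recorded, because only its trace is used.\<close>

lemma basis_modulo_inverse:
  fixes m n :: nat
  assumes B: "linear_closed B" and h: "basis_modulo Z B n h"
    and A: "\<And>i. i < m \<Longrightarrow> (\<lambda>x. g i x - (\<Sum>l<n. A i l * h l x)) \<in> B"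
    and C: "\<And>j. j < n \<Longrightarrow> (\<lambda>x. h j x - (\<Sum>i<m. C j i * g i x)) \<in> B"
    and j: "j < n"
  shows "(\<Sum>i<m. C j i * A i j) = (1::real)"
proof -
  have "(\<lambda>x. (h j x - (\<Sum>i<m. C j i * g i x)) + 1 * (\<Sum>i<m. C j i * (g i x - (\<Sum>l<n. A i l * h l x)))) \<in> B"
    using A C[OF j] by (intro linear_closedD(2)[OF B] linear_closed_sum[OF B] finite_lessThan) simp_all
  also have "(\<lambda>x. (h j x - (\<Sum>i<m. C j i * g i x)) + 1 * (\<Sum>i<m. C j i * (g i x - (\<Sum>l<n. A i l * h l x))))
      = (\<lambda>x. \<Sum>l<n. (of_bool (l = j) - (\<Sum>i<m. C j i * A i l)) * h l x)"
  proof
    fix x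
    have "(\<Sum>l<n. of_bool (l = j) * h l x) = h j x"
      using j by (simp add: of_bool_def if_distrib[where f="\<lambda>a. a * _"] cong: if_cong)
    moreover have "(\<Sum>i<m. C j i * (\<Sum>l<n. A i l * h l x)) = (\<Sum>l<n. (\<Sum>i<m. C j i * A i l) * h l x)"
      unfolding sum_distrib_left sum_distrib_right by (subst sum.swap) (simp add: mult.assoc)
    ultimately show "(h j x - (\<Sum>i<m. C j i * g i x)) + 1 * (\<Sum>i<m. C j i * (g i x - (\<Sum>l<n. A i l * h l x)))
      = (\<Sum>l<n. (of_bool (l = j) - (\<Sum>i<m. C j i * A i l)) * h l x)"
      by (simp add: sum_subtractf algebra_simps)
  qed
  finally have "of_bool (j = j) - (\<Sum>i<m. C j i * A i j) = 0"
    using j by (rule basis_modulo_indep[OF h])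
  then show ?thesis by simp
qed

text \<open>If \<open>A\<close> and \<open>C\<close> are the two matrices of a change of basis, then \<open>CA\<close> and \<open>AC\<close> are identity matrices
  of sizes \<open>n\<close> and \<open>m\<close>, and they have the same trace.\<close>

lemma basis_modulo_unique:
  assumes B: "linear_closed B" and h: "basis_modulo Z B n h" and g: "basis_modulo Z B m g"
  shows "n = m"
proof -
  have "\<forall>i\<in>{..<m}. \<exists>c. (\<lambda>x. g i x - (\<Sum>l<n. c l * h l x)) \<in> B"
    using h g by (simp add: basis_modulo_def)
  then obtain A where A: "\<And>i. i < m \<Longrightarrow> (\<lambda>x. g i x - (\<Sum>l<n. A i l * h l x)) \<in> B"
    unfolding bchoice_iff by auto
  have "\<forall>j\<in>{..<n}. \<exists>c. (\<lambda>x. h j x - (\<Sum>i<m. c i * g i x)) \<in> B"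
    using h g by (simp add: basis_modulo_def)
  then obtain C where C: "\<And>j. j < n \<Longrightarrow> (\<lambda>x. h j x - (\<Sum>i<m. C j i * g i x)) \<in> B"
    unfolding bchoice_iff by auto
  have "real n = (\<Sum>j<n. \<Sum>i<m. C j i * A i j)"
    using basis_modulo_inverse[OF B h A C] by simp
  also have "\<dots> = (\<Sum>i<m. \<Sum>j<n. A i j * C j i)"
    by (subst sum.swap) (simp add: mult.commute)
  also have "\<dots> = real m"
    using basis_modulo_inverse[OF B g C A] by simp
  finally show ?thesis by simp
qed

lemma quotient_basis_imp_basis_modulo:
  assumes B: "linear_closed B" and bs: "quotient_basis Z B bs"
  shows "basis_modulo Z B (length bs) (nth bs)"
  unfolding basis_modulo_def
proof (intro conjI allI impI ballI)
  show Z: "bs ! i \<in> Z" if "i < length bs" for i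
    using bs that by (auto simp: quotient_basis_def)
  have ex1: "\<exists>!c :: real list. length c = length bs \<and> (\<lambda>x. z x - (\<Sum>i<length bs. c ! i * (bs ! i) x)) \<in> B"
    if "z \<in> Z" for z
    using bs that by (simp add: quotient_basis_def)
  show "\<exists>c. (\<lambda>x. z x - (\<Sum>i<length bs. c i * (bs ! i) x)) \<in> B" if "z \<in> Z" for z
    using ex1[OF that] by blast
  fix c :: "nat \<Rightarrow> real" and j
  assume c: "(\<lambda>x. \<Sum>i<length bs. c i * (bs ! i) x) \<in> B" and j: "j < length bs"
  \<comment> \<open>If \<open>c\<close> is a relation modulo \<open>B\<close>, then the unit vector \<open>e\<close> and \<open>e - c\<close> both represent \<open>bs ! j\<close>.\<close>
  let ?e = "map (\<lambda>i. of_bool (i = j)) [0..<length bs] :: real list"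
  let ?d = "map (\<lambda>i. of_bool (i = j) - c i) [0..<length bs] :: real list"
  have "(\<Sum>i<length bs. of_bool (i = j) * (bs ! i) x) = (bs ! j) x" for x
    using j by (simp add: of_bool_def if_distrib[where f="\<lambda>a. a * _"] cong: if_cong)
  then have "(\<lambda>x. (bs ! j) x - (\<Sum>i<length bs. ?e ! i * (bs ! i) x)) \<in> B"
    "(\<lambda>x. (bs ! j) x - (\<Sum>i<length bs. ?d ! i * (bs ! i) x)) \<in> B"
    using c linear_closedD(1)[OF B] by (simp_all add: left_diff_distrib sum_subtractf)
  then have "(THE c. length c = length bs \<and> (\<lambda>x. (bs ! j) x - (\<Sum>i<length bs. c ! i * (bs ! i) x)) \<in> B) = ?e"
    "(THE c. length c = length bs \<and> (\<lambda>x. (bs ! j) x - (\<Sum>i<length bs. c ! i * (bs ! i) x)) \<in> B) = ?d"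
    by (intro the1_equality ex1 Z j conjI; simp)+
  then have "?e = ?d" by metis
  then have "?e ! j = ?d ! j" by (rule arg_cong)
  then show "c j = 0" using j by simp
qed

lemma basis_modulo_imp_quotient_basis:
  assumes B: "linear_closed B" and h: "basis_modulo Z B n h"
  shows "quotient_basis Z B (map h [0..<n])"
  unfolding quotient_basis_def
proof (intro conjI ballI)
  show "set (map h [0..<n]) \<subseteq> Z" using h by (auto simp: basis_modulo_def)
  fix z assume "z \<in> Z"
  then obtain c where c: "(\<lambda>x. z x - (\<Sum>i<n. c i * h i x)) \<in> B"
    using h by (auto simp: basis_modulo_def)
  show "\<exists>!c :: real list. length c = length (map h [0..<n]) \<and>
      (\<lambda>x. z x - (\<Sum>i<length (map h [0..<n]). c ! i * (map h [0..<n] ! i) x)) \<in> B"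
  proof (rule ex1I[of _ "map c [0..<n]"])
    show "length (map c [0..<n]) = length (map h [0..<n]) \<and>
      (\<lambda>x. z x - (\<Sum>i<length (map h [0..<n]). map c [0..<n] ! i * (map h [0..<n] ! i) x)) \<in> B"
      using c by simp
  next
    fix d :: "real list"
    assume "length d = length (map h [0..<n]) \<and>
      (\<lambda>x. z x - (\<Sum>i<length (map h [0..<n]). d ! i * (map h [0..<n] ! i) x)) \<in> B"
    then have d: "length d = n" "(\<lambda>x. z x - (\<Sum>i<n. d ! i * h i x)) \<in> B" by simp_all
    have "(\<lambda>x. \<Sum>i<n. (d ! i - c i) * h i x) \<in> B"
      using linear_closed_diff[OF B c d(2)] by (simp add: left_diff_distrib sum_subtractf)
    from basis_modulo_indep[OF h this] show "d = map c [0..<n]"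
      using d(1) by (intro nth_equalityI) auto
  qed
qed

lemma quotient_dim_eqI:
  assumes B: "linear_closed B" and h: "basis_modulo Z B n h"
  shows "quotient_dim Z B = n"
  unfolding quotient_dim_def
proof (rule the_equality)
  show "\<exists>bs. quotient_basis Z B bs \<and> length bs = n"
    using basis_modulo_imp_quotient_basis[OF B h] by (intro exI[of _ "map h [0..<n]"]) simp
next
  fix m assume "\<exists>bs. quotient_basis Z B bs \<and> length bs = m"
  then obtain bs where bs: "quotient_basis Z B bs" "length bs = m" by blast
  from basis_modulo_unique[OF B h quotient_basis_imp_basis_modulo[OF B bs(1)]] bs(2)
  show "m = n" by simp
qed


section \<open>Reproducing kernels\<close>

definition inner_on :: "'b set \<Rightarrow> ('b \<Rightarrow> real) \<Rightarrow> ('b \<Rightarrow> real) \<Rightarrow> real" where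
  "inner_on T F G = (\<Sum>x\<in>T. F x * G x)"

definition supported :: "'b set \<Rightarrow> ('b \<Rightarrow> real) set" where
  "supported T = {F. \<forall>x. F x \<noteq> 0 \<longrightarrow> x \<in> T}"

definition orthonormal :: "'b set \<Rightarrow> nat \<Rightarrow> (nat \<Rightarrow> 'b \<Rightarrow> real) \<Rightarrow> bool" where
  "orthonormal T n h \<longleftrightarrow> (\<forall>i<n. \<forall>j<n. inner_on T (h i) (h j) = of_bool (i = j))"

lemma inner_on_commute: "inner_on T F G = inner_on T G F"
  by (simp add: inner_on_def mult.commute)

lemma inner_on_diff:
  "inner_on T (\<lambda>x. F x - G x) H = inner_on T F H - inner_on T G H"
  by (simp add: inner_on_def left_diff_distrib sum_subtractf)

lemma inner_on_sum:
  "inner_on T (\<lambda>x. \<Sum>i\<in>I. c i * F i x) H = (\<Sum>i\<in>I. c i * inner_on T (F i) H)"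
  unfolding inner_on_def sum_distrib_left sum_distrib_right by (subst sum.swap) (simp add: mult.assoc)

lemma inner_on_eq_0:
  assumes "finite T" "F \<in> supported T" "inner_on T F F = 0"
  shows "F = (\<lambda>_. 0)"
proof -
  have "\<forall>x\<in>T. F x * F x = 0"
    using assms(1,3) unfolding inner_on_def by (subst (asm) sum_nonneg_eq_0_iff) auto
  then show ?thesis using assms(2) by (auto simp: supported_def)
qed

lemma orthonormal_coeff:
  assumes "orthonormal T n h" "j < n"
  shows "inner_on T (\<lambda>x. \<Sum>i<n. c i * h i x) (h j) = c j"
proof -
  have "inner_on T (\<lambda>x. \<Sum>i<n. c i * h i x) (h j) = (\<Sum>i<n. c i * of_bool (i = j))"
    unfolding inner_on_sum using assms by (simp add: orthonormal_def)
  also have "\<dots> = c j"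
    using assms(2) by (simp add: of_bool_def if_distrib[where f="\<lambda>a. _ * a"] cong: if_cong)
  finally show ?thesis .
qed

text \<open>Summing Bessel's inequality for the delta functions over \<open>T\<close> gives the length of the system on the
  left and \<open>card T\<close> on the right.\<close>

lemma orthonormal_length:
  assumes T: "finite T" and h: "orthonormal T n h"
  shows "n \<le> card T"
proof -
  have bessel: "(\<Sum>i<n. h i x * h i x) \<le> 1" if x: "x \<in> T" for x
  proof -
    let ?d = "\<lambda>y. of_bool (y = x) :: real" and ?p = "\<lambda>y. \<Sum>i<n. h i x * h i y"
    have d: "inner_on T ?d G = G x" for G
      using T x by (simp add: inner_on_def of_bool_def if_distrib[where f="\<lambda>a. a * _"] cong: if_cong)
    have p: "inner_on T ?p (h j) = h j x" if "j < n" for j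
      using orthonormal_coeff[OF h that] .
    have "0 \<le> inner_on T (\<lambda>y. ?d y - ?p y) (\<lambda>y. ?d y - ?p y)"
      unfolding inner_on_def by (intro sum_nonneg) simp
    also have "\<dots> = inner_on T ?d (\<lambda>y. ?d y - ?p y) - inner_on T ?p (\<lambda>y. ?d y - ?p y)"
      by (rule inner_on_diff)
    also have "inner_on T ?d (\<lambda>y. ?d y - ?p y) = 1 - ?p x"
      by (simp add: d)
    also have "inner_on T ?p (\<lambda>y. ?d y - ?p y) = 0"
    proof -
      have "inner_on T (h i) (\<lambda>y. ?d y - ?p y) = 0" if "i < n" for i
        using d[of "h i"] p[OF that] by (subst inner_on_commute) (simp add: inner_on_diff)
      then show ?thesis by (simp add: inner_on_sum)
    qed
    finally show ?thesis by simp
  qed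
  have "real n = (\<Sum>i<n. inner_on T (h i) (h i))"
    using h by (simp add: orthonormal_def)
  also have "\<dots> = (\<Sum>x\<in>T. \<Sum>i<n. h i x * h i x)"
    unfolding inner_on_def by (rule sum.swap)
  also have "\<dots> \<le> (\<Sum>x\<in>T. 1)" using bessel by (intro sum_mono)
  finally show ?thesis by simp
qed

text \<open>An orthonormal system in \<open>V\<close> of maximal length spans \<open>V\<close>: otherwise a Gram-Schmidt step would
  lengthen it.\<close>

lemma orthonormal_basis_exists:
  assumes T: "finite T" and V: "linear_closed V" "V \<subseteq> supported T"
  obtains n h where "orthonormal T n h" "\<forall>i<n. h i \<in> V"
    "\<forall>F\<in>V. F = (\<lambda>x. \<Sum>i<n. inner_on T F (h i) * h i x)"
proof -
  define N where "N = {n. \<exists>h. orthonormal T n h \<and> (\<forall>i<n. h i \<in> V)}"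
  have "0 \<in> N" by (auto simp: N_def orthonormal_def)
  moreover have N: "N \<subseteq> {..card T}" using orthonormal_length[OF T] by (auto simp: N_def)
  ultimately have "Max N \<in> N" and max: "\<And>n. n \<in> N \<Longrightarrow> n \<le> Max N"
    using finite_subset[OF N] by (auto intro: Max_in)
  then obtain h where h: "orthonormal T (Max N) h" "\<forall>i<Max N. h i \<in> V"
    by (auto simp: N_def)
  have "F = (\<lambda>x. \<Sum>i<Max N. inner_on T F (h i) * h i x)" if F: "F \<in> V" for F
  proof (rule ccontr)
    assume neq: "F \<noteq> (\<lambda>x. \<Sum>i<Max N. inner_on T F (h i) * h i x)"
    define G where "G = (\<lambda>x. F x - (\<Sum>i<Max N. inner_on T F (h i) * h i x))"
    define r where "r = inner_on T G G"
    define g where "g = (\<lambda>x. (1 / sqrt r) * G x)"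
    have G: "G \<in> V"
      unfolding G_def using h F by (intro linear_closed_diff[OF V(1)] linear_closed_sum[OF V(1)]) auto
    have orth: "inner_on T G (h j) = 0" if "j < Max N" for j
      unfolding G_def inner_on_diff orthonormal_coeff[OF h(1) that] by simp
    have "G \<noteq> (\<lambda>_. 0)" using neq by (auto simp: G_def fun_eq_iff)
    then have "r \<noteq> 0" using inner_on_eq_0[OF T] G V(2) by (auto simp: r_def)
    moreover have "r \<ge> 0" unfolding r_def inner_on_def by (intro sum_nonneg) simp
    ultimately have r: "r > 0" by simp
    have scale: "inner_on T g H = (1 / sqrt r) * inner_on T G H" for H
      unfolding g_def inner_on_def sum_distrib_left by (simp add: mult.assoc)
    have "inner_on T g g = (1 / sqrt r) * ((1 / sqrt r) * r)"
      by (metis scale inner_on_commute r_def)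
    also have "\<dots> = 1" using r by (simp add: field_simps)
    finally have gg: "inner_on T g g = 1" .
    have gh: "inner_on T g (h j) = 0" "inner_on T (h j) g = 0" if "j < Max N" for j
      using orth[OF that] scale[of "h j"] inner_on_commute[of T "h j" g] by simp_all
    have "orthonormal T (Suc (Max N)) (h(Max N := g))"
      using h(1) gg gh by (auto simp: orthonormal_def less_Suc_eq)
    moreover have "g \<in> V" unfolding g_def by (rule linear_closed_scale[OF V(1) G])
    ultimately have "Suc (Max N) \<in> N"
      using h(2) unfolding N_def
      by (intro CollectI exI[of _ "h(Max N := g)"]) (simp add: less_Suc_eq N_def)
    from max[OF this] show False by simp
  qed
  with h show ?thesis using that by blast
qed

text \<open>\<open>K x\<close> is the element of \<open>V\<close> that represents evaluation at \<open>x\<close>; as a matrix, \<open>K\<close> is the orthogonal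
  projection onto \<open>V\<close>.\<close>

definition reproducing :: "'b set \<Rightarrow> ('b \<Rightarrow> real) set \<Rightarrow> ('b \<Rightarrow> 'b \<Rightarrow> real) \<Rightarrow> bool" where
  "reproducing T V K \<longleftrightarrow> (\<forall>x\<in>T. K x \<in> V) \<and> (\<forall>F\<in>V. \<forall>x\<in>T. F x = inner_on T F (K x))"

lemma reproducingD:
  assumes "reproducing T V K"
  shows "x \<in> T \<Longrightarrow> K x \<in> V" and "F \<in> V \<Longrightarrow> x \<in> T \<Longrightarrow> F x = inner_on T F (K x)"
  using assms by (auto simp: reproducing_def)

text \<open>For two kernels of the same space, each value is obtained by evaluating one kernel with the other.
  With \<open>K = K'\<close> this is symmetry, and in general it makes the diagonal independent of the kernel.\<close>

lemma reproducing_sym: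
  assumes "reproducing T V K" "reproducing T V K'" "x \<in> T" "y \<in> T"
  shows "K x y = K' y x"
  using assms unfolding reproducing_def by (metis inner_on_commute)

text \<open>The trace of the orthogonal projection onto \<open>V\<close>, which is its dimension
  (\<open>orthonormal_basis_reproducing\<close>). It is real-valued, and it can be computed from any reproducing
  kernel without a basis.\<close>

definition trace_dim :: "'b set \<Rightarrow> ('b \<Rightarrow> real) set \<Rightarrow> real" where
  "trace_dim T V = (\<Sum>x\<in>T. (SOME K. reproducing T V K) x x)"

lemma trace_dim_eq:
  assumes "reproducing T V K"
  shows "trace_dim T V = (\<Sum>x\<in>T. K x x)"
proof -
  have "reproducing T V (SOME K. reproducing T V K)" using someI[of "reproducing T V", OF assms] .
  then show ?thesis
    unfolding trace_dim_def using reproducing_sym[OF _ assms] by (intro sum.cong) auto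
qed

lemma orthonormal_basis_reproducing:
  assumes T: "finite T" and V: "linear_closed V" and h: "orthonormal T n h" "\<forall>i<n. h i \<in> V"
    "\<forall>F\<in>V. F = (\<lambda>x. \<Sum>i<n. inner_on T F (h i) * h i x)"
  shows "reproducing T V (\<lambda>x y. \<Sum>i<n. h i x * h i y)" and "trace_dim T V = real n"
proof -
  show *: "reproducing T V (\<lambda>x y. \<Sum>i<n. h i x * h i y)"
    unfolding reproducing_def
  proof (intro conjI ballI)
    show "(\<lambda>y. \<Sum>i<n. h i x * h i y) \<in> V" for x
      using h(2) by (intro linear_closed_sum[OF V]) auto
    fix F x assume F: "F \<in> V"
    have "inner_on T F (\<lambda>y. \<Sum>i<n. h i x * h i y) = (\<Sum>i<n. h i x * inner_on T (h i) F)"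
      by (subst inner_on_commute) (rule inner_on_sum)
    also have "\<dots> = (\<Sum>i<n. inner_on T F (h i) * h i x)"
      by (simp add: inner_on_commute mult.commute)
    also have "\<dots> = F x" using h(3) F by metis
    finally show "F x = inner_on T F (\<lambda>y. \<Sum>i<n. h i x * h i y)" ..
  qed
  have "trace_dim T V = (\<Sum>i<n. inner_on T (h i) (h i))"
    unfolding trace_dim_eq[OF *] inner_on_def by (rule sum.swap)
  also have "\<dots> = real n" using h(1) by (simp add: orthonormal_def)
  finally show "trace_dim T V = real n" .
qed

lemma reproducing_exists:
  assumes "finite T" "linear_closed V" "V \<subseteq> supported T"
  shows "\<exists>K. reproducing T V K"
proof -
  obtain n h where "orthonormal T n h" "\<forall>i<n. h i \<in> V"
    "\<forall>F\<in>V. F = (\<lambda>x. \<Sum>i<n. inner_on T F (h i) * h i x)"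
    using orthonormal_basis_exists[OF assms] .
  from orthonormal_basis_reproducing(1)[OF assms(1,2) this] show ?thesis by blast
qed



section \<open>Harmonic cochains\<close>

definition chains :: "'b set \<Rightarrow> ('b \<Rightarrow> nat) \<Rightarrow> nat \<Rightarrow> ('b \<Rightarrow> real) set" where
  "chains T deg p = {F. \<forall>x. F x \<noteq> 0 \<longrightarrow> x \<in> T \<and> deg x = p}"

definition harmonic :: "'b set \<Rightarrow> ('b \<Rightarrow> nat) \<Rightarrow> ('b \<Rightarrow> 'b \<Rightarrow> real) \<Rightarrow> nat \<Rightarrow> ('b \<Rightarrow> real) set" where
  "harmonic T deg D p = {F \<in> chains T deg p.
     (\<forall>x\<in>T. (\<Sum>y\<in>T. D x y * F y) = 0) \<and> (\<forall>y\<in>T. (\<Sum>x\<in>T. D x y * F x) = 0)}"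

text \<open>\<open>D x y\<close> is the coefficient of \<open>F y\<close> in \<open>(dF) x\<close>, so \<open>D\<close> is the matrix of an operator that raises the
  degree of a cochain by one.\<close>

definition raises_degree :: "'b set \<Rightarrow> ('b \<Rightarrow> nat) \<Rightarrow> ('b \<Rightarrow> 'b \<Rightarrow> real) \<Rightarrow> bool" where
  "raises_degree T deg D \<longleftrightarrow> (\<forall>x\<in>T. \<forall>y\<in>T. D x y \<noteq> 0 \<longrightarrow> deg x = Suc (deg y))"

lemma harmonicI:
  assumes "\<And>x. F x \<noteq> 0 \<Longrightarrow> x \<in> T \<and> deg x = p"
    and "\<And>x. x \<in> T \<Longrightarrow> (\<Sum>y\<in>T. D x y * F y) = 0"
    and "\<And>y. y \<in> T \<Longrightarrow> (\<Sum>x\<in>T. D x y * F x) = 0"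
  shows "F \<in> harmonic T deg D p"
  using assms by (simp add: harmonic_def chains_def)

lemma harmonicD:
  assumes "F \<in> harmonic T deg D p"
  shows "F x \<noteq> 0 \<Longrightarrow> x \<in> T" "F x \<noteq> 0 \<Longrightarrow> deg x = p"
    and "x \<in> T \<Longrightarrow> (\<Sum>y\<in>T. D x y * F y) = 0" "y \<in> T \<Longrightarrow> (\<Sum>x\<in>T. D x y * F x) = 0"
  using assms by (auto simp: harmonic_def chains_def)

lemma harmonic_supported: "harmonic T deg D p \<subseteq> supported T"
  by (auto simp: supported_def dest: harmonicD)

lemma harmonic_linear_closed: "linear_closed (harmonic T deg D p)"
  unfolding linear_closed_def
proof (intro conjI ballI allI)
  fix F G a assume F: "F \<in> harmonic T deg D p" and G: "G \<in> harmonic T deg D p"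
  show "(\<lambda>x. F x + a * G x) \<in> harmonic T deg D p"
  proof (rule harmonicI)
    have "F x \<noteq> 0 \<or> G x \<noteq> 0" if "F x + a * G x \<noteq> 0" for x using that by auto
    then show "x \<in> T \<and> deg x = p" if "F x + a * G x \<noteq> 0" for x
      using that harmonicD(1,2)[OF F, of x] harmonicD(1,2)[OF G, of x] by blast
    show "(\<Sum>y\<in>T. D x y * (F y + a * G y)) = 0" if "x \<in> T" for x
    proof -
      have "(\<Sum>y\<in>T. D x y * (F y + a * G y)) = (\<Sum>y\<in>T. D x y * F y) + a * (\<Sum>y\<in>T. D x y * G y)"
        by (simp add: sum_distrib_left sum.distrib algebra_simps)
      then show ?thesis using harmonicD(3)[OF F that] harmonicD(3)[OF G that] by simp
    qed
    show "(\<Sum>x\<in>T. D x y * (F x + a * G x)) = 0" if "y \<in> T" for y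
    proof -
      have "(\<Sum>x\<in>T. D x y * (F x + a * G x)) = (\<Sum>x\<in>T. D x y * F x) + a * (\<Sum>x\<in>T. D x y * G x)"
        by (simp add: sum_distrib_left sum.distrib algebra_simps)
      then show ?thesis using harmonicD(4)[OF F that] harmonicD(4)[OF G that] by simp
    qed
  qed
qed (simp add: harmonic_def chains_def)

lemma harmonic_reproducing_exists:
  "finite T \<Longrightarrow> \<exists>K. reproducing T (harmonic T deg D p) K"
  by (intro reproducing_exists harmonic_linear_closed harmonic_supported)

definition derivative :: "'b set \<Rightarrow> ('b \<Rightarrow> 'b \<Rightarrow> real) \<Rightarrow> ('b \<Rightarrow> real) \<Rightarrow> 'b \<Rightarrow> real" where
  "derivative T D F x = (if x \<in> T then \<Sum>y\<in>T. D x y * F y else 0)"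

lemma derivative_adjoint:
  "inner_on T (derivative T D F) G = (\<Sum>y\<in>T. F y * (\<Sum>x\<in>T. D x y * G x))"
proof -
  have "inner_on T (derivative T D F) G = (\<Sum>x\<in>T. \<Sum>y\<in>T. D x y * F y * G x)"
    by (simp add: inner_on_def derivative_def sum_distrib_right)
  also have "\<dots> = (\<Sum>y\<in>T. \<Sum>x\<in>T. D x y * F y * G x)" by (rule sum.swap)
  finally show ?thesis by (simp add: sum_distrib_left mult_ac)
qed

text \<open>The theorem of Hodge in finite dimension. Subtracting from a cocycle its orthogonal projection to
  the coboundaries leaves a cocycle that is orthogonal to all coboundaries, which means that the adjoint
  of the derivative annihilates it. Harmonic cochains are orthogonal to the coboundaries, so an
  orthonormal basis of them is independent modulo coboundaries. The source of the derivative is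
  described by \<open>Suc (deg x) = p\<close> so that the case \<open>p = 0\<close> needs no separate treatment.\<close>

theorem quotient_dim_harmonic:
  assumes T: "finite T" and D: "raises_degree T deg D"
    and square: "\<And>x z. x \<in> T \<Longrightarrow> z \<in> T \<Longrightarrow> (\<Sum>y\<in>T. D x y * D y z) = 0"
  shows "real (quotient_dim {F \<in> chains T deg p. derivative T D F = (\<lambda>_. 0)}
      (derivative T D ` {F. \<forall>x. F x \<noteq> 0 \<longrightarrow> x \<in> T \<and> Suc (deg x) = p}))
    = trace_dim T (harmonic T deg D p)" (is "real (quotient_dim ?Z (derivative T D ` ?C)) = _")
proof -
  let ?B = "derivative T D ` ?C" and ?H = "harmonic T deg D p"
  have raise: "deg x = Suc (deg y)" if "D x y \<noteq> 0" "x \<in> T" "y \<in> T" for x y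
    using D that by (simp add: raises_degree_def)
  have lin: "derivative T D (\<lambda>x. F x + a * G x) = (\<lambda>x. derivative T D F x + a * derivative T D G x)" for F G a
    by (auto simp: derivative_def sum_distrib_left sum.distrib algebra_simps)
  have zero: "derivative T D (\<lambda>_. 0) = (\<lambda>_. 0)" by (auto simp: derivative_def)
  have B: "linear_closed ?B"
    unfolding linear_closed_def
  proof (intro conjI ballI allI)
    show "(\<lambda>_. 0) \<in> ?B" using zero by (intro image_eqI[of _ _ "\<lambda>_. 0"]) simp_all
    fix F G a assume "F \<in> ?B" and "G \<in> ?B"
    then obtain F' G' where F': "F = derivative T D F'" "F' \<in> ?C" and G': "G = derivative T D G'" "G' \<in> ?C"
      by (elim imageE)
    have "F' x \<noteq> 0 \<or> G' x \<noteq> 0" if "F' x + a * G' x \<noteq> 0" for x using that by auto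
    then have "(\<lambda>x. F' x + a * G' x) \<in> ?C" using F'(2) G'(2) by blast
    then have "derivative T D (\<lambda>x. F' x + a * G' x) \<in> ?B" by (rule imageI)
    then show "(\<lambda>x. F x + a * G x) \<in> ?B" by (simp add: lin F'(1) G'(1))
  qed
  have B_supp: "?B \<subseteq> supported T" by (auto simp: supported_def derivative_def split: if_splits)
  have B_Z: "derivative T D F \<in> ?Z" if F: "F \<in> ?C" for F
  proof -
    have "x \<in> T \<and> deg x = p" if "derivative T D F x \<noteq> 0" for x
    proof -
      have x: "x \<in> T" and "(\<Sum>y\<in>T. D x y * F y) \<noteq> 0"
        using that by (auto simp: derivative_def split: if_splits)
      then obtain y where "y \<in> T" "D x y * F y \<noteq> 0" by (meson sum.neutral)
      then show ?thesis using F raise[of x y] x by auto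
    qed
    moreover have "derivative T D (derivative T D F) x = 0" for x
    proof (cases "x \<in> T")
      case True
      then have "derivative T D (derivative T D F) x = (\<Sum>y\<in>T. \<Sum>z\<in>T. D x y * D y z * F z)"
        by (simp add: derivative_def sum_distrib_left mult.assoc)
      also have "\<dots> = (\<Sum>z\<in>T. (\<Sum>y\<in>T. D x y * D y z) * F z)"
        unfolding sum_distrib_right by (rule sum.swap)
      also have "\<dots> = 0" using square True by (intro sum.neutral) simp
      finally show ?thesis .
    qed (simp add: derivative_def)
    ultimately show ?thesis by (auto simp: chains_def)
  qed
  have H_Z: "?H \<subseteq> ?Z" by (auto simp: harmonic_def derivative_def)
  have orth: "inner_on T b h = 0" if "b \<in> ?B" "h \<in> ?H" for b h
    using that harmonicD(4)[OF that(2)]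
    by (auto simp: derivative_adjoint intro!: sum.neutral)
  obtain n h where h: "orthonormal T n h" "\<forall>i<n. h i \<in> ?H"
    "\<forall>F\<in>?H. F = (\<lambda>x. \<Sum>i<n. inner_on T F (h i) * h i x)"
    using orthonormal_basis_exists[OF T harmonic_linear_closed harmonic_supported] .
  obtain m b where b: "orthonormal T m b" "\<forall>i<m. b i \<in> ?B"
    "\<forall>F\<in>?B. F = (\<lambda>x. \<Sum>i<m. inner_on T F (b i) * b i x)"
    using orthonormal_basis_exists[OF T B B_supp] .
  have "basis_modulo ?Z ?B n h"
    unfolding basis_modulo_def
  proof (intro conjI allI impI ballI)
    show "h i \<in> ?Z" if "i < n" for i using that h(2) H_Z by blast
    show "c i = 0" if "(\<lambda>x. \<Sum>i<n. c i * h i x) \<in> ?B" "i < n" for c i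
      using orth[OF that(1), of "h i"] h(2) that(2) orthonormal_coeff[OF h(1) that(2), of c] by simp
    fix z assume z: "z \<in> ?Z"
    \<comment> \<open>\<open>y\<close> is the projection of the cocycle to the coboundaries, \<open>u\<close> is its harmonic part.\<close>
    define y where "y = (\<lambda>x. \<Sum>i<m. inner_on T z (b i) * b i x)"
    define u where "u = (\<lambda>x. z x - y x)"
    have yB: "y \<in> ?B" unfolding y_def using b(2) by (intro linear_closed_sum[OF B]) auto
    then have yZ: "y \<in> ?Z" using B_Z by blast
    have chain: "x \<in> T \<and> deg x = p" if "w \<in> ?Z" "w x \<noteq> 0" for w x
      using that by (simp add: chains_def)
    have u_chain: "u x \<noteq> 0 \<Longrightarrow> x \<in> T \<and> deg x = p" for x
      using chain[OF z, of x] chain[OF yZ, of x] by (cases "z x = 0") (simp_all add: u_def)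
    have u_orth: "inner_on T u w = 0" if w: "w \<in> ?B" for w
    proof -
      have ub: "inner_on T u (b i) = 0" if "i < m" for i
        unfolding u_def inner_on_diff y_def orthonormal_coeff[OF b(1) that] by simp
      have "inner_on T w u = inner_on T (\<lambda>x. \<Sum>i<m. inner_on T w (b i) * b i x) u"
        by (rule arg_cong[where f = "\<lambda>F. inner_on T F u"]) (rule bspec[OF b(3) w])
      also have "\<dots> = 0" unfolding inner_on_sum using ub by (simp add: inner_on_commute)
      finally show ?thesis by (simp add: inner_on_commute)
    qed
    have "u \<in> ?H"
    proof (rule harmonicI[OF u_chain])
      show "(\<Sum>y\<in>T. D x y * u y) = 0" if "x \<in> T" for x
      proof -
        have "derivative T D z x = 0" "derivative T D y x = 0" using z yZ by simp_all
        then have "(\<Sum>t\<in>T. D x t * z t) = 0" "(\<Sum>t\<in>T. D x t * y t) = 0"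
          using that by (simp_all add: derivative_def)
        then show ?thesis by (simp add: u_def right_diff_distrib sum_subtractf)
      qed
      show "(\<Sum>x\<in>T. D x y * u x) = 0" if y: "y \<in> T" for y
      proof (cases "Suc (deg y) = p")
        case True
        \<comment> \<open>The adjoint derivative of \<open>u\<close> at \<open>y\<close> is the inner product of \<open>u\<close> with the coboundary of \<open>?e\<close>.\<close>
        let ?e = "\<lambda>t. of_bool (t = y) :: real"
        have "derivative T D ?e \<in> ?B" using True y by (intro imageI) auto
        from u_orth[OF this] show ?thesis
          using T y by (simp add: inner_on_commute[of T u] derivative_adjoint of_bool_def
              if_distrib[where f="\<lambda>a. a * _"] cong: if_cong)
      next
        case False
        then show ?thesis using raise y u_chain by (intro sum.neutral) force
      qed
    qed
    then have u: "u = (\<lambda>x. \<Sum>i<n. inner_on T u (h i) * h i x)" using h(3) by blast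
    have eq: "(\<lambda>x. z x - (\<Sum>i<n. inner_on T u (h i) * h i x)) = y"
    proof
      fix x
      have "u x = z x - y x" by (simp add: u_def)
      with fun_cong[OF u, of x] show "z x - (\<Sum>i<n. inner_on T u (h i) * h i x) = y x" by linarith
    qed
    show "\<exists>c. (\<lambda>x. z x - (\<Sum>i<n. c i * h i x)) \<in> ?B"
      by (rule exI, rule back_subst[of "\<lambda>F. F \<in> ?B", OF yB eq[symmetric]])
  qed
  then have "quotient_dim ?Z ?B = n" by (rule quotient_dim_eqI[OF B])
  then show ?thesis
    using orthonormal_basis_reproducing(2)[OF T harmonic_linear_closed h] by simp
qed

section \<open>Isomorphisms, disjoint unions and tensor products\<close>

lemma harmonic_pullback:
  assumes \<phi>: "bij_betw \<phi> T T'" and deg: "\<And>x. x \<in> T \<Longrightarrow> deg' (\<phi> x) = deg x"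
    and \<tau>: "\<And>x. x \<in> T \<Longrightarrow> \<tau> x * \<tau> x = (1::real)"
    and D: "\<And>x y. x \<in> T \<Longrightarrow> y \<in> T \<Longrightarrow> D' (\<phi> x) (\<phi> y) = \<tau> x * \<tau> y * D x y"
    and F: "F \<in> harmonic T' deg' D' p"
  shows "(\<lambda>x. if x \<in> T then \<tau> x * F (\<phi> x) else 0) \<in> harmonic T deg D p"
proof (rule harmonicI)
  have D': "D x y * \<tau> y = \<tau> x * D' (\<phi> x) (\<phi> y)" "D x y * \<tau> x = \<tau> y * D' (\<phi> x) (\<phi> y)"
    if "x \<in> T" "y \<in> T" for x y
  proof -
    have "\<tau> x * D' (\<phi> x) (\<phi> y) = (\<tau> x * \<tau> x) * (D x y * \<tau> y)"
      "\<tau> y * D' (\<phi> x) (\<phi> y) = (\<tau> y * \<tau> y) * (D x y * \<tau> x)"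
      unfolding D[OF that] by (simp_all only: mult_ac)
    then show "D x y * \<tau> y = \<tau> x * D' (\<phi> x) (\<phi> y)" "D x y * \<tau> x = \<tau> y * D' (\<phi> x) (\<phi> y)"
      using \<tau> that by simp_all
  qed
  show "x \<in> T \<and> deg x = p" if "(if x \<in> T then \<tau> x * F (\<phi> x) else 0) \<noteq> 0" for x
    using that harmonicD(2)[OF F, of "\<phi> x"] deg by (auto split: if_splits)
  show "(\<Sum>y\<in>T. D x y * (if y \<in> T then \<tau> y * F (\<phi> y) else 0)) = 0" if x: "x \<in> T" for x
  proof -
    have "(\<Sum>y\<in>T. D x y * (if y \<in> T then \<tau> y * F (\<phi> y) else 0)) = (\<Sum>y\<in>T. \<tau> x * (D' (\<phi> x) (\<phi> y) * F (\<phi> y)))"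
      by (rule sum.cong[OF HOL.refl]) (simp add: mult.assoc[symmetric] D'(1)[OF x])
    also have "\<dots> = \<tau> x * (\<Sum>y\<in>T'. D' (\<phi> x) y * F y)"
      unfolding sum_distrib_left[symmetric] by (simp add: sum.reindex_bij_betw[OF \<phi>, of "\<lambda>y. D' (\<phi> x) y * F y"])
    finally show ?thesis using harmonicD(3)[OF F] bij_betwE[OF \<phi>] x by simp
  qed
  show "(\<Sum>x\<in>T. D x y * (if x \<in> T then \<tau> x * F (\<phi> x) else 0)) = 0" if y: "y \<in> T" for y
  proof -
    have "(\<Sum>x\<in>T. D x y * (if x \<in> T then \<tau> x * F (\<phi> x) else 0)) = (\<Sum>x\<in>T. \<tau> y * (D' (\<phi> x) (\<phi> y) * F (\<phi> x)))"
      by (rule sum.cong[OF HOL.refl]) (simp add: mult.assoc[symmetric] D'(2)[OF _ y])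
    also have "\<dots> = \<tau> y * (\<Sum>x\<in>T'. D' x (\<phi> y) * F x)"
      unfolding sum_distrib_left[symmetric] by (simp add: sum.reindex_bij_betw[OF \<phi>, of "\<lambda>x. D' x (\<phi> y) * F x"])
    finally show ?thesis using harmonicD(4)[OF F] bij_betwE[OF \<phi>] y by simp
  qed
qed

text \<open>Two complexes whose bases correspond bijectively, and whose derivatives agree after changing the
  signs of basis elements, have equally many harmonic cochains: the kernel of one is carried to the
  other, and the signs square away on the diagonal.\<close>

theorem trace_dim_isomorphic:
  assumes T: "finite T" and \<phi>: "bij_betw \<phi> T T'" and deg: "\<And>x. x \<in> T \<Longrightarrow> deg' (\<phi> x) = deg x"
    and \<tau>: "\<And>x. x \<in> T \<Longrightarrow> \<tau> x * \<tau> x = (1::real)"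
    and D: "\<And>x y. x \<in> T \<Longrightarrow> y \<in> T \<Longrightarrow> D' (\<phi> x) (\<phi> y) = \<tau> x * \<tau> y * D x y"
  shows "trace_dim T' (harmonic T' deg' D' p) = trace_dim T (harmonic T deg D p)"
proof -
  have "finite T'" using T \<phi> bij_betw_finite by blast
  then obtain K' where K': "reproducing T' (harmonic T' deg' D' p) K'"
    using harmonic_reproducing_exists by metis
  define \<psi> where "\<psi> = inv_into T \<phi>"
  have \<psi>: "bij_betw \<psi> T' T" unfolding \<psi>_def by (rule bij_betw_inv_into[OF \<phi>])
  have \<psi>\<phi>: "\<psi> (\<phi> x) = x" if "x \<in> T" for x unfolding \<psi>_def by (rule bij_betw_inv_into_left[OF \<phi> that])
  have \<phi>\<psi>: "\<phi> (\<psi> x) = x" if "x \<in> T'" for x unfolding \<psi>_def by (rule bij_betw_inv_into_right[OF \<phi> that])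
  have \<psi>T: "\<psi> x \<in> T" if "x \<in> T'" for x using that bij_betwE[OF \<psi>] by blast
  have \<phi>T: "\<phi> x \<in> T'" if "x \<in> T" for x using that bij_betwE[OF \<phi>] by blast
  define K where "K x y = (if y \<in> T then \<tau> y * (\<tau> x * K' (\<phi> x) (\<phi> y)) else 0)" for x y
  have "reproducing T (harmonic T deg D p) K"
    unfolding reproducing_def
  proof (intro conjI ballI)
    show "K x \<in> harmonic T deg D p" if x: "x \<in> T" for x
    proof -
      have "K' (\<phi> x) \<in> harmonic T' deg' D' p" using K' \<phi>T[OF x] by (simp add: reproducing_def)
      then have "(\<lambda>y. \<tau> x * K' (\<phi> x) y) \<in> harmonic T' deg' D' p"
        by (rule linear_closed_scale[OF harmonic_linear_closed])
      from harmonic_pullback[where F="\<lambda>y. \<tau> x * K' (\<phi> x) y" and deg=deg and D=D and \<tau>=\<tau>, OF \<phi> deg \<tau> D this] show ?thesis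
        unfolding K_def .
    qed
    fix F x assume F: "F \<in> harmonic T deg D p" and x: "x \<in> T"
    let ?F = "\<lambda>y. if y \<in> T' then \<tau> (\<psi> y) * F (\<psi> y) else 0"
    have D'': "D (\<psi> x) (\<psi> y) = \<tau> (\<psi> x) * \<tau> (\<psi> y) * D' x y" if "x \<in> T'" "y \<in> T'" for x y
    proof -
      have "\<tau> (\<psi> x) * \<tau> (\<psi> y) * D' (\<phi> (\<psi> x)) (\<phi> (\<psi> y)) =
        (\<tau> (\<psi> x) * \<tau> (\<psi> x)) * (\<tau> (\<psi> y) * \<tau> (\<psi> y)) * D (\<psi> x) (\<psi> y)"
        using D[OF \<psi>T \<psi>T] that by simp
      then show ?thesis using that \<phi>\<psi> \<tau>[OF \<psi>T] by simp
    qed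
    have "?F \<in> harmonic T' deg' D' p"
      using deg \<phi>\<psi> \<psi>T \<tau> D''
      by (intro harmonic_pullback[where \<phi>=\<psi> and \<tau>="\<lambda>y. \<tau> (\<psi> y)", OF \<psi> _ _ _ F]) (metis, simp, simp)
    then have "?F (\<phi> x) = inner_on T' ?F (K' (\<phi> x))"
      using reproducingD(2)[OF K' _ \<phi>T[OF x]] by blast
    also have "\<dots> = (\<Sum>y\<in>T. ?F (\<phi> y) * K' (\<phi> x) (\<phi> y))"
      unfolding inner_on_def by (rule sum.reindex_bij_betw[OF \<phi>, symmetric])
    also have "\<dots> = (\<Sum>y\<in>T. \<tau> y * F y * K' (\<phi> x) (\<phi> y))"
      by (rule sum.cong[OF HOL.refl]) (simp add: \<phi>T \<psi>\<phi>)
    finally have "\<tau> x * (\<tau> x * F x) = \<tau> x * (\<Sum>y\<in>T. \<tau> y * F y * K' (\<phi> x) (\<phi> y))"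
      using \<phi>T[OF x] \<psi>\<phi>[OF x] by simp
    moreover have "\<tau> x * (\<tau> x * F x) = F x"
      using \<tau>[OF x] by (simp add: mult.assoc[symmetric])
    moreover have "inner_on T F (K x) = \<tau> x * (\<Sum>y\<in>T. \<tau> y * F y * K' (\<phi> x) (\<phi> y))"
      by (simp add: inner_on_def K_def sum_distrib_left mult_ac)
    ultimately show "F x = inner_on T F (K x)" by simp
  qed
  then have "trace_dim T (harmonic T deg D p) = (\<Sum>x\<in>T. K x x)" by (rule trace_dim_eq)
  also have "\<dots> = (\<Sum>x\<in>T. K' (\<phi> x) (\<phi> x))"
    by (rule sum.cong[OF HOL.refl]) (simp add: K_def mult.assoc[symmetric] \<tau>)
  also have "\<dots> = (\<Sum>x\<in>T'. K' x x)" by (rule sum.reindex_bij_betw[OF \<phi>])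
  also have "\<dots> = trace_dim T' (harmonic T' deg' D' p)" by (rule trace_dim_eq[OF K', symmetric])
  finally show ?thesis ..
qed



text \<open>The derivative is block diagonal, so a harmonic cochain restricts to each block and the kernels of
  the blocks form a block diagonal kernel.\<close>

theorem trace_dim_disjoint_union:
  assumes I: "finite I" and T: "\<And>i. i \<in> I \<Longrightarrow> finite (T i)"
    and disj: "\<And>i j. i \<in> I \<Longrightarrow> j \<in> I \<Longrightarrow> i \<noteq> j \<Longrightarrow> T i \<inter> T j = {}"
    and D: "\<And>i j x y. i \<in> I \<Longrightarrow> j \<in> I \<Longrightarrow> i \<noteq> j \<Longrightarrow> x \<in> T i \<Longrightarrow> y \<in> T j \<Longrightarrow> D x y = 0"
  shows "trace_dim (\<Union>(T ` I)) (harmonic (\<Union>(T ` I)) deg D p) = (\<Sum>i\<in>I. trace_dim (T i) (harmonic (T i) deg D p))"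
proof -
  let ?T = "\<Union>(T ` I)"
  have split: "(\<Sum>x\<in>?T. f x) = (\<Sum>i\<in>I. \<Sum>x\<in>T i. f x)" for f :: "'b \<Rightarrow> real"
    using I T disj by (intro sum.UNION_disjoint) auto
  have local: "(\<Sum>x\<in>?T. f x) = (\<Sum>x\<in>T i. f x)" if "i \<in> I" "\<And>j x. j \<in> I \<Longrightarrow> j \<noteq> i \<Longrightarrow> x \<in> T j \<Longrightarrow> f x = 0" for i and f :: "'b \<Rightarrow> real"
  proof -
    have "(\<Sum>j\<in>I. \<Sum>x\<in>T j. f x) = (\<Sum>j\<in>I. if j = i then \<Sum>x\<in>T i. f x else 0)"
      using that(2) by (intro sum.cong) (auto intro!: sum.neutral)
    then show ?thesis using split I that(1) by simp
  qed
  have restrict: "(\<lambda>x. if x \<in> T i then F x else 0) \<in> harmonic (T i) deg D p"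
    if i: "i \<in> I" and F: "F \<in> harmonic ?T deg D p" for i F
  proof (rule harmonicI)
    show "x \<in> T i \<and> deg x = p" if "(if x \<in> T i then F x else 0) \<noteq> 0" for x
      using that harmonicD(2)[OF F] by (auto split: if_splits)
    show "(\<Sum>y\<in>T i. D x y * (if y \<in> T i then F y else 0)) = 0" if x: "x \<in> T i" for x
    proof -
      have "(\<Sum>y\<in>T i. D x y * (if y \<in> T i then F y else 0)) = (\<Sum>y\<in>T i. D x y * F y)"
        by (rule sum.cong) simp_all
      also have "\<dots> = (\<Sum>y\<in>?T. D x y * F y)"
        using D[OF i _ _ x] by (intro local[symmetric] i) simp
      also have "\<dots> = 0" using harmonicD(3)[OF F] i x by blast
      finally show ?thesis .
    qed
    show "(\<Sum>x\<in>T i. D x y * (if x \<in> T i then F x else 0)) = 0" if y: "y \<in> T i" for y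
    proof -
      have "(\<Sum>x\<in>T i. D x y * (if x \<in> T i then F x else 0)) = (\<Sum>x\<in>T i. D x y * F x)"
        by (rule sum.cong) simp_all
      also have "\<dots> = (\<Sum>x\<in>?T. D x y * F x)"
        using D[OF _ i _ _ y] by (intro local[symmetric] i) simp
      also have "\<dots> = 0" using harmonicD(4)[OF F] i y by blast
      finally show ?thesis .
    qed
  qed
  have extend: "F \<in> harmonic ?T deg D p" if i: "i \<in> I" and F: "F \<in> harmonic (T i) deg D p" for i F
  proof -
    have F0: "F x = 0" if "j \<in> I" "j \<noteq> i" "x \<in> T j" for j x
      using disj[OF i that(1)] that harmonicD(1)[OF F, of x] by auto
    show ?thesis
    proof (rule harmonicI)
      show "x \<in> ?T \<and> deg x = p" if "F x \<noteq> 0" for x using that harmonicD(1,2)[OF F] i by blast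
      show "(\<Sum>y\<in>?T. D x y * F y) = 0" if "x \<in> ?T" for x
      proof -
        have *: "(\<Sum>y\<in>?T. D x y * F y) = (\<Sum>y\<in>T i. D x y * F y)" using F0 by (intro local i) simp
        show ?thesis
        proof (cases "x \<in> T i")
          case True
          then show ?thesis using * harmonicD(3)[OF F] by simp
        next
          case False
          then have "D x y = 0" if "y \<in> T i" for y using \<open>x \<in> ?T\<close> D[of _ i x y] i that by blast
          then show ?thesis using * by simp
        qed
      qed
      show "(\<Sum>x\<in>?T. D x y * F x) = 0" if "y \<in> ?T" for y
      proof -
        have *: "(\<Sum>x\<in>?T. D x y * F x) = (\<Sum>x\<in>T i. D x y * F x)" using F0 by (intro local i) simp
        show ?thesis
        proof (cases "y \<in> T i")
          case True
          then show ?thesis using * harmonicD(4)[OF F] by simp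
        next
          case False
          then have "D x y = 0" if "x \<in> T i" for x using \<open>y \<in> ?T\<close> D[of i _ x y] i that by blast
          then show ?thesis using * by simp
        qed
      qed
    qed
  qed
  have "\<forall>i\<in>I. \<exists>K. reproducing (T i) (harmonic (T i) deg D p) K"
    using T harmonic_reproducing_exists by metis
  then obtain K where K: "\<And>i. i \<in> I \<Longrightarrow> reproducing (T i) (harmonic (T i) deg D p) (K i)"
    by metis
  define L where "L x = K (THE i. i \<in> I \<and> x \<in> T i) x" for x
  have L: "L x = K i x" if "i \<in> I" "x \<in> T i" for i x
  proof -
    have "(THE j. j \<in> I \<and> x \<in> T j) = i" using that disj by (intro the_equality) auto
    then show ?thesis by (simp add: L_def)
  qed
  have "reproducing ?T (harmonic ?T deg D p) L"
    unfolding reproducing_def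
  proof (intro conjI ballI)
    show "L x \<in> harmonic ?T deg D p" if "x \<in> ?T" for x
      using that extend reproducingD(1)[OF K] L by fastforce
    fix F x assume F: "F \<in> harmonic ?T deg D p" and "x \<in> ?T"
    then obtain i where i: "i \<in> I" "x \<in> T i" by blast
    have Kx: "K i x \<in> harmonic (T i) deg D p" using reproducingD(1)[OF K] i by blast
    have "inner_on ?T F (L x) = inner_on (T i) F (K i x)"
      unfolding inner_on_def L[OF i]
    proof (rule local[OF i(1)])
      show "F y * K i x y = 0" if "j \<in> I" "j \<noteq> i" "y \<in> T j" for j y
        using disj[OF i(1) that(1)] that harmonicD(1)[OF Kx, of y] by auto
    qed
    also have "\<dots> = inner_on (T i) (\<lambda>x. if x \<in> T i then F x else 0) (K i x)"
      by (simp add: inner_on_def)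
    also have "\<dots> = F x"
      using reproducingD(2)[OF K restrict] i F by (metis (no_types, lifting))
    finally show "F x = inner_on ?T F (L x)" ..
  qed
  then have "trace_dim ?T (harmonic ?T deg D p) = (\<Sum>x\<in>?T. L x x)" by (rule trace_dim_eq)
  also have "\<dots> = (\<Sum>i\<in>I. \<Sum>x\<in>T i. K i x x)"
    unfolding split using L by (intro sum.cong) auto
  also have "\<dots> = (\<Sum>i\<in>I. trace_dim (T i) (harmonic (T i) deg D p))"
    using trace_dim_eq[OF K] by (intro sum.cong) auto
  finally show ?thesis .
qed


text \<open>The matrix of \<open>d\<^sub>1 + (-1)\<^bsup>deg x\<^esup> d\<^sub>2\<close> on functions of two variables.\<close>

definition tensor_kernel :: "('b \<Rightarrow> nat) \<Rightarrow> ('b \<Rightarrow> 'b \<Rightarrow> real) \<Rightarrow> ('c \<Rightarrow> 'c \<Rightarrow> real) \<Rightarrow>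
    'b \<times> 'c \<Rightarrow> 'b \<times> 'c \<Rightarrow> real" where
  "tensor_kernel deg D D' = (\<lambda>(x, y) (x', y').
     of_bool (y = y') * D x x' + (- 1) ^ deg x * (of_bool (x = x') * D' y y'))"

lemma sum_tensor_kernel:
  assumes T: "finite T" "finite T'" and x: "x \<in> T" and y: "y \<in> T'"
  shows "(\<Sum>z\<in>T \<times> T'. tensor_kernel deg D D' (x, y) z * F z)
      = (\<Sum>x'\<in>T. D x x' * F (x', y)) + (- 1) ^ deg x * (\<Sum>y'\<in>T'. D' y y' * F (x, y'))" (is ?A)
    and "(\<Sum>z\<in>T \<times> T'. tensor_kernel deg D D' z (x, y) * F z)
      = (\<Sum>x'\<in>T. D x' x * F (x', y)) + (- 1) ^ deg x * (\<Sum>y'\<in>T'. D' y' y * F (x, y'))" (is ?B)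
proof -
  have "(\<Sum>z\<in>T \<times> T'. tensor_kernel deg D D' (x, y) z * F z) =
      (\<Sum>x'\<in>T. \<Sum>y'\<in>T'. tensor_kernel deg D D' (x, y) (x', y') * F (x', y'))"
    by (simp add: sum.cartesian_product case_prod_unfold)
  also have "\<dots> = (\<Sum>x'\<in>T. (\<Sum>y'\<in>T'. if y = y' then D x x' * F (x', y') else 0) +
      (if x = x' then \<Sum>y'\<in>T'. (- 1) ^ deg x * (D' y y' * F (x', y')) else 0))"
    by (rule sum.cong[OF HOL.refl], simp only: sum.distrib[symmetric] if_distrib[of "\<lambda>a. _ + a"] add_0_right split: if_split)
      (auto intro!: sum.cong simp: tensor_kernel_def distrib_right sum.distrib[symmetric])
  also have "\<dots> = (\<Sum>x'\<in>T. D x x' * F (x', y)) + (\<Sum>y'\<in>T'. (- 1) ^ deg x * (D' y y' * F (x, y')))"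
    using T x y by (simp add: sum.distrib)
  finally show ?A by (simp only: sum_distrib_left)
  have "(\<Sum>z\<in>T \<times> T'. tensor_kernel deg D D' z (x, y) * F z) =
      (\<Sum>x'\<in>T. \<Sum>y'\<in>T'. tensor_kernel deg D D' (x', y') (x, y) * F (x', y'))"
    by (simp add: sum.cartesian_product case_prod_unfold)
  also have "\<dots> = (\<Sum>x'\<in>T. (\<Sum>y'\<in>T'. if y = y' then D x' x * F (x', y') else 0) +
      (if x = x' then \<Sum>y'\<in>T'. (- 1) ^ deg x * (D' y' y * F (x', y')) else 0))"
    by (rule sum.cong[OF HOL.refl], simp only: sum.distrib[symmetric] if_distrib[of "\<lambda>a. _ + a"] add_0_right split: if_split)
      (auto intro!: sum.cong simp: tensor_kernel_def distrib_right sum.distrib[symmetric])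
  also have "\<dots> = (\<Sum>x'\<in>T. D x' x * F (x', y)) + (\<Sum>y'\<in>T'. (- 1) ^ deg x * (D' y' y * F (x, y')))"
    using T x y by (simp add: sum.distrib)
  finally show ?B by (simp only: sum_distrib_left)
qed

text \<open>Write the derivative as \<open>A + \<sigma>B\<close> and its adjoint as \<open>A' + \<sigma>B'\<close>, where \<open>A, A'\<close> act on the first
  variable, \<open>B, B'\<close> on the second, and \<open>\<sigma> = (-1)\<^bsup>deg x\<^esup>\<close>. Both vanish on \<open>F\<close>, and in the sum of the squares
  of their norms the two mixed terms \<open>\<langle>A, \<sigma>B\<rangle>\<close> and \<open>\<langle>A', \<sigma>B'\<rangle>\<close> are opposite: exchanging the roles of
  source and target turns one into the other, except that \<open>\<sigma>\<close> is now taken in the neighbouring degree.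
  Hence all four terms vanish.\<close>

lemma harmonic_tensor_slices:
  assumes T: "finite T" "finite T'" and D: "raises_degree T deg D"
    and F: "F \<in> harmonic (T \<times> T') degs (tensor_kernel deg D D') p"
    and x: "x \<in> T" and y: "y \<in> T'"
  shows "(\<Sum>x'\<in>T. D x x' * F (x', y)) = 0" "(\<Sum>x'\<in>T. D x' x * F (x', y)) = 0"
    "(\<Sum>y'\<in>T'. D' y y' * F (x, y')) = 0" "(\<Sum>y'\<in>T'. D' y' y * F (x, y')) = 0"
proof -
  let ?P = "T \<times> T'"
  define \<sigma> :: "'a \<times> 'b \<Rightarrow> real" where "\<sigma> z = (- 1) ^ deg (fst z)" for z
  define A where "A z = (\<Sum>x'\<in>T. D (fst z) x' * F (x', snd z))" for z
  define A' where "A' z = (\<Sum>x'\<in>T. D x' (fst z) * F (x', snd z))" for z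
  define B where "B z = (\<Sum>y'\<in>T'. D' (snd z) y' * F (fst z, y'))" for z
  define B' where "B' z = (\<Sum>y'\<in>T'. D' y' (snd z) * F (fst z, y'))" for z
  \<comment> \<open>The integrand of the mixed terms, as a function of a pair of corners of a rectangle.\<close>
  define h where "h z w = \<sigma> z * D (fst z) (fst w) * D' (snd z) (snd w) * F (fst w, snd z) * F (fst z, snd w)" for z w
  have \<sigma>2: "\<sigma> z * \<sigma> z = 1" for z by (simp add: \<sigma>_def flip: power_add)
  have square: "(u + \<sigma> z * v)\<^sup>2 = u\<^sup>2 + v\<^sup>2 + 2 * (\<sigma> z * (u * v))" for u v z
  proof -
    have "(u + \<sigma> z * v)\<^sup>2 = u\<^sup>2 + (\<sigma> z * \<sigma> z) * v\<^sup>2 + 2 * (\<sigma> z * (u * v))"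
      by (simp add: power2_eq_square algebra_simps)
    then show ?thesis by (simp add: \<sigma>2)
  qed
  have AB: "A z + \<sigma> z * B z = 0" "A' z + \<sigma> z * B' z = 0" if "z \<in> ?P" for z
    using harmonicD(3,4)[OF F that] sum_tensor_kernel[OF T, of "fst z" "snd z"] that
    by (auto simp: A_def A'_def B_def B'_def \<sigma>_def)
  have prod: "(\<Sum>x'\<in>T. a x') * (\<Sum>y'\<in>T'. b y') = (\<Sum>w\<in>?P. a (fst w) * b (snd w))" for a :: "'a \<Rightarrow> real" and b :: "'b \<Rightarrow> real"
    by (simp add: sum_product sum.cartesian_product case_prod_unfold)
  have 1: "\<sigma> z * (A z * B z) = (\<Sum>w\<in>?P. h z w)" for z
    unfolding A_def B_def prod unfolding sum_distrib_left h_def by (simp add: mult_ac)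
  have 2: "\<sigma> z * (A' z * B' z) = (\<Sum>w\<in>?P. - h w z)" if z: "z \<in> ?P" for z
    unfolding A'_def B'_def prod unfolding sum_distrib_left
  proof (rule sum.cong[OF HOL.refl])
    fix w assume w: "w \<in> ?P"
    show "\<sigma> z * (D (fst w) (fst z) * F (fst w, snd z) * (D' (snd w) (snd z) * F (fst z, snd w))) = - h w z"
    proof (cases "D (fst w) (fst z) = 0")
      case False
      then have "deg (fst w) = Suc (deg (fst z))" using D w z by (auto simp: raises_degree_def)
      then show ?thesis by (simp add: h_def \<sigma>_def mult_ac)
    qed (simp add: h_def)
  qed
  have "(\<Sum>z\<in>?P. \<sigma> z * (A' z * B' z)) = - (\<Sum>z\<in>?P. \<Sum>w\<in>?P. h w z)"
    using 2 by (simp add: sum_negf)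
  also have "(\<Sum>z\<in>?P. \<Sum>w\<in>?P. h w z) = (\<Sum>z\<in>?P. \<sigma> z * (A z * B z))"
    unfolding 1 by (rule sum.swap)
  finally have cross: "(\<Sum>z\<in>?P. \<sigma> z * (A z * B z)) + (\<Sum>z\<in>?P. \<sigma> z * (A' z * B' z)) = 0" by simp
  have "(\<Sum>z\<in>?P. (A z + \<sigma> z * B z)\<^sup>2 + (A' z + \<sigma> z * B' z)\<^sup>2) = 0"
    using AB by simp
  also have "(\<Sum>z\<in>?P. (A z + \<sigma> z * B z)\<^sup>2 + (A' z + \<sigma> z * B' z)\<^sup>2) =
    (\<Sum>z\<in>?P. (A z)\<^sup>2 + (B z)\<^sup>2 + (A' z)\<^sup>2 + (B' z)\<^sup>2 + 2 * (\<sigma> z * (A z * B z)) + 2 * (\<sigma> z * (A' z * B' z)))"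
    by (simp only: square add_ac)
  also have "\<dots> = (\<Sum>z\<in>?P. (A z)\<^sup>2 + (B z)\<^sup>2 + (A' z)\<^sup>2 + (B' z)\<^sup>2) +
     2 * ((\<Sum>z\<in>?P. \<sigma> z * (A z * B z)) + (\<Sum>z\<in>?P. \<sigma> z * (A' z * B' z)))"
    by (simp only: sum.distrib sum_distrib_left[symmetric] distrib_left add.assoc)
  finally have "(\<Sum>z\<in>?P. (A z)\<^sup>2 + (B z)\<^sup>2 + (A' z)\<^sup>2 + (B' z)\<^sup>2) = 0"
    unfolding cross by simp
  then have "\<forall>z\<in>?P. (A z)\<^sup>2 + (B z)\<^sup>2 + (A' z)\<^sup>2 + (B' z)\<^sup>2 = 0"
    using T by (subst (asm) sum_nonneg_eq_0_iff) auto
  then have "(A (x, y))\<^sup>2 + (B (x, y))\<^sup>2 + (A' (x, y))\<^sup>2 + (B' (x, y))\<^sup>2 = 0"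
    using x y by blast
  then have "A (x, y) = 0 \<and> B (x, y) = 0 \<and> A' (x, y) = 0 \<and> B' (x, y) = 0"
    by (simp add: add_nonneg_eq_0_iff)
  then show "(\<Sum>x'\<in>T. D x x' * F (x', y)) = 0" "(\<Sum>x'\<in>T. D x' x * F (x', y)) = 0"
    "(\<Sum>y'\<in>T'. D' y y' * F (x, y')) = 0" "(\<Sum>y'\<in>T'. D' y' y * F (x, y')) = 0"
    by (simp_all add: A_def A'_def B_def B'_def)
qed

text \<open>The kernel of the harmonic cochains of degree \<open>p\<close> is the sum of the products of the kernels in
  degrees \<open>a\<close> and \<open>p - a\<close>: a harmonic cochain is harmonic in each variable, and the degree of one variable
  fixes the degree of the other, so the two reproducing properties can be applied in turn.\<close>

theorem trace_dim_tensor: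
  assumes T: "finite T" "finite T'" and D: "raises_degree T deg D"
  shows "trace_dim (T \<times> T') (harmonic (T \<times> T') (\<lambda>(x, y). deg x + deg' y) (tensor_kernel deg D D') p) =
    (\<Sum>a\<le>p. trace_dim T (harmonic T deg D a) * trace_dim T' (harmonic T' deg' D' (p - a)))"
proof -
  let ?P = "T \<times> T'" and ?deg = "\<lambda>(x, y). deg x + deg' y"
  let ?H = "harmonic ?P ?deg (tensor_kernel deg D D') p"
  obtain K where K: "\<And>a. reproducing T (harmonic T deg D a) (K a)"
    using harmonic_reproducing_exists[OF T(1)] by metis
  obtain K' where K': "\<And>a. reproducing T' (harmonic T' deg' D' a) (K' a)"
    using harmonic_reproducing_exists[OF T(2)] by metis
  define L where "L z w = (\<Sum>a\<le>p. K a (fst z) (fst w) * K' (p - a) (snd z) (snd w))" for z w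
  have "reproducing ?P ?H L"
    unfolding reproducing_def
  proof (intro conjI ballI)
    fix z assume z: "z \<in> ?P"
    then obtain x y where xy: "z = (x, y)" "x \<in> T" "y \<in> T'" by auto
    have "(\<lambda>w. K a x (fst w) * K' (p - a) y (snd w)) \<in> ?H" if a: "a \<le> p" for a
    proof (rule harmonicI)
      note H = reproducingD(1)[OF K xy(2), of a] and H' = reproducingD(1)[OF K' xy(3), of "p - a"]
      show "w \<in> ?P \<and> ?deg w = p" if "K a x (fst w) * K' (p - a) y (snd w) \<noteq> 0" for w
        using that a harmonicD(1,2)[OF H, of "fst w"] harmonicD(1,2)[OF H', of "snd w"] by (cases w) auto
      fix w assume "w \<in> ?P"
      then obtain u v where w: "w = (u, v)" "u \<in> T" "v \<in> T'" by auto
      have "(\<Sum>x'\<in>T. D u x' * (K a x x' * K' (p - a) y v)) = 0"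
        "(\<Sum>x'\<in>T. D x' u * (K a x x' * K' (p - a) y v)) = 0"
        using harmonicD(3,4)[OF H w(2)] by (simp_all add: mult.assoc[symmetric] sum_distrib_right[symmetric])
      moreover have "(\<Sum>y'\<in>T'. D' v y' * (K a x u * K' (p - a) y y')) = 0"
        "(\<Sum>y'\<in>T'. D' y' v * (K a x u * K' (p - a) y y')) = 0"
        using harmonicD(3,4)[OF H' w(3)] by (simp_all add: mult.left_commute[of _ "K a x u"] sum_distrib_left[symmetric])
      ultimately show "(\<Sum>w'\<in>?P. tensor_kernel deg D D' w w' * (K a x (fst w') * K' (p - a) y (snd w'))) = 0"
        "(\<Sum>w'\<in>?P. tensor_kernel deg D D' w' w * (K a x (fst w') * K' (p - a) y (snd w'))) = 0"
        unfolding w(1) sum_tensor_kernel[OF T w(2,3)] by simp_all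
    qed
    then have "(\<lambda>w. \<Sum>a\<in>{..p}. 1 * (K a x (fst w) * K' (p - a) y (snd w))) \<in> ?H"
      by (intro linear_closed_sum[OF harmonic_linear_closed]) auto
    then show "L z \<in> ?H" by (simp add: L_def[abs_def] xy)
  next
    fix F z assume F: "F \<in> ?H" and z: "z \<in> ?P"
    then obtain x y where xy: "z = (x, y)" "x \<in> T" "y \<in> T'" by auto
    have F0: "F (u, v) = 0" if "u \<notin> T \<or> v \<notin> T' \<or> deg u + deg' v \<noteq> p" for u v
      using harmonicD(1,2)[OF F, of "(u, v)"] that by auto
    have row: "(\<lambda>u. F (u, v)) \<in> harmonic T deg D (p - deg' v)" if v: "v \<in> T'" for v
      using harmonic_tensor_slices(1,2)[OF T D F _ v] F0 by (intro harmonicI) (force, auto)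
    have column: "(\<lambda>v. F (u, v)) \<in> harmonic T' deg' D' (p - deg u)" if u: "u \<in> T" for u
      using harmonic_tensor_slices(3,4)[OF T D F u] F0 by (intro harmonicI) (force, auto)
    have inner: "(\<Sum>u\<in>T. F (u, v) * K a x u) = (if a = deg x then F (x, v) else 0)"
      if v: "v \<in> T'" and pv: "a + deg' v = p" for a v
    proof -
      have "p - deg' v = a" using pv by simp
      then have "F (x, v) = (\<Sum>u\<in>T. F (u, v) * K a x u)"
        using reproducingD(2)[OF K row[OF v] xy(2)] by (simp add: inner_on_def)
      moreover have "F (x, v) = 0" if "a \<noteq> deg x" using F0[of x v] that pv by auto
      ultimately show ?thesis by simp
    qed
    have contribution: "(\<Sum>w\<in>?P. F w * (K a x (fst w) * K' (p - a) y (snd w))) = (if a = deg x then F (x, y) else 0)"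
      if a: "a \<le> p" for a
    proof -
      have K0: "K' (p - a) y v = 0" if "a + deg' v \<noteq> p" for v
        using harmonicD(2)[OF reproducingD(1)[OF K' xy(3), of "p - a"], of v] that a by (cases "K' (p - a) y v = 0") simp_all
      have "(\<Sum>w\<in>?P. F w * (K a x (fst w) * K' (p - a) y (snd w))) =
          (\<Sum>v\<in>T'. \<Sum>u\<in>T. F (u, v) * (K a x u * K' (p - a) y v))"
        by (subst sum.swap) (simp add: sum.cartesian_product case_prod_unfold)
      also have "\<dots> = (\<Sum>v\<in>T'. (\<Sum>u\<in>T. F (u, v) * K a x u) * K' (p - a) y v)"
        by (simp add: sum_distrib_right mult.assoc)
      also have "\<dots> = (\<Sum>v\<in>T'. (if a = deg x then F (x, v) else 0) * K' (p - a) y v)"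
      proof (rule sum.cong[OF HOL.refl])
        fix v assume v: "v \<in> T'"
        show "(\<Sum>u\<in>T. F (u, v) * K a x u) * K' (p - a) y v = (if a = deg x then F (x, v) else 0) * K' (p - a) y v"
          using inner[OF v, of a] K0[of v] by (cases "a + deg' v = p") simp_all
      qed
      also have "\<dots> = (if a = deg x then inner_on T' (\<lambda>v. F (x, v)) (K' (p - a) y) else 0)"
        by (simp add: inner_on_def)
      also have "\<dots> = (if a = deg x then F (x, y) else 0)"
        using reproducingD(2)[OF K' column[OF xy(2)] xy(3)] by simp
      finally show ?thesis .
    qed
    have "inner_on ?P F (L z) = (\<Sum>w\<in>?P. \<Sum>a\<le>p. F w * (K a x (fst w) * K' (p - a) y (snd w)))"
      by (simp add: inner_on_def L_def xy sum_distrib_left)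
    also have "\<dots> = (\<Sum>a\<le>p. if a = deg x then F (x, y) else 0)"
      by (subst sum.swap) (simp add: contribution)
    also have "\<dots> = F (x, y)"
      using F0[of x y] by auto
    finally show "F z = inner_on ?P F (L z)" by (simp add: xy)
  qed
  then have "trace_dim ?P ?H = (\<Sum>z\<in>?P. L z z)" by (rule trace_dim_eq)
  also have "\<dots> = (\<Sum>a\<le>p. \<Sum>z\<in>?P. K a (fst z) (fst z) * K' (p - a) (snd z) (snd z))"
    unfolding L_def by (rule sum.swap)
  also have "\<dots> = (\<Sum>a\<le>p. (\<Sum>x\<in>T. K a x x) * (\<Sum>y\<in>T'. K' (p - a) y y))"
    by (simp add: sum_product sum.cartesian_product case_prod_unfold)
  also have "\<dots> = (\<Sum>a\<le>p. trace_dim T (harmonic T deg D a) * trace_dim T' (harmonic T' deg' D' (p - a)))"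
    using trace_dim_eq[OF K] trace_dim_eq[OF K'] by simp
  finally show ?thesis .
qed



section \<open>The exterior derivative\<close>

text \<open>A face is given by a position and a vertex to be removed there. A simplex with a single vertex has
  none, in accordance with \<open>\<delta> {v} = 0\<close>.\<close>

definition faces :: "'a set list \<Rightarrow> (nat \<times> 'a) set" where
  "faces c = {(i, v). i < length c \<and> v \<in> c ! i \<and> c ! i \<noteq> {v}}"

definition del :: "'a set list \<Rightarrow> nat \<times> 'a \<Rightarrow> 'a set list" where
  "del c e = c[fst e := c ! fst e - {snd e}]"

definition face_sign :: "('a::linorder set \<Rightarrow> real) \<Rightarrow> 'a set list \<Rightarrow> nat \<times> 'a \<Rightarrow> real" where
  "face_sign s c e = (- 1) ^ tuple_dim (take (fst e) c) * incidence s (c ! fst e) (snd e)"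

definition simplices :: "'a set list \<Rightarrow> bool" where
  "simplices c \<longleftrightarrow> (\<forall>x\<in>set c. finite x \<and> x \<noteq> {})"

lemma simplices_nth: "simplices c \<Longrightarrow> i < length c \<Longrightarrow> finite (c ! i) \<and> c ! i \<noteq> {}"
  by (simp add: simplices_def)

lemma facesD:
  assumes "(i, v) \<in> faces c"
  shows "i < length c" "v \<in> c ! i" "c ! i \<noteq> {v}"
  using assms by (simp_all add: faces_def)

lemma length_del [simp]: "length (del c e) = length c"
  by (simp add: del_def)

lemma nth_del: "j < length c \<Longrightarrow> del c (i, v) ! j = (if j = i then c ! i - {v} else c ! j)"
  by (simp add: del_def nth_list_update)

lemma faces_finite:
  assumes "simplices c"
  shows "finite (faces c)"
proof (rule finite_subset)
  show "faces c \<subseteq> (SIGMA i : {..<length c}. c ! i)" by (auto simp: faces_def)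
  show "finite (SIGMA i : {..<length c}. c ! i)" using simplices_nth[OF assms] by auto
qed

lemma simplices_del:
  assumes "simplices c" "e \<in> faces c"
  shows "simplices (del c e)"
proof -
  obtain i v where e: "e = (i, v)" by (cases e)
  note f = facesD[OF assms(2)[unfolded e]]
  have "finite (del c e ! j) \<and> del c e ! j \<noteq> {}" if "j < length c" for j
    using that f simplices_nth[OF assms(1) that] by (auto simp: nth_del e)
  then show ?thesis by (auto simp: simplices_def in_set_conv_nth)
qed

lemma card_face:
  assumes "finite x" "v \<in> x" "x \<noteq> {v}"
  shows "card x - 1 = Suc (card (x - {v}) - 1)"
proof -
  have "x - {v} \<noteq> {}" using assms by blast
  then have "card (x - {v}) > 0" using assms(1) card_gt_0_iff by blast
  then show ?thesis using assms by (simp add: card_Diff_singleton)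
qed

lemma tuple_dim_Nil [simp]: "tuple_dim [] = 0"
  and tuple_dim_Cons [simp]: "tuple_dim (x # X) = card x - 1 + tuple_dim X"
  by (simp_all add: tuple_dim_def)

lemma tuple_dim_sum: "tuple_dim X = (\<Sum>i<length X. card (X ! i) - 1)"
  by (simp add: tuple_dim_def sum_list_sum_nth atLeast0LessThan)

lemma tuple_dim_del:
  assumes "simplices c" "e \<in> faces c"
  shows "tuple_dim c = Suc (tuple_dim (del c e))"
proof -
  obtain i v where e: "e = (i, v)" by (cases e)
  note f = facesD[OF assms(2)[unfolded e]]
  have "(\<Sum>j\<in>{..<length c} - {i}. card (del c e ! j) - 1) = (\<Sum>j\<in>{..<length c} - {i}. card (c ! j) - 1)"
    by (rule sum.cong) (auto simp: e nth_del)
  then show ?thesis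
    using f card_face[OF _ f(2,3)] simplices_nth[OF assms(1) f(1)]
    by (simp add: tuple_dim_sum sum.remove[of "{..<length c}" i] e nth_del)
qed

lemma take_del: "take j (del c (i, v)) = (if i < j then del (take j c) (i, v) else take j c)"
  by (simp add: del_def take_update_swap list_update_beyond)

lemma interaction_deriv_faces:
  assumes "simplices c"
  shows "interaction_deriv s F c = (\<Sum>e\<in>faces c. face_sign s c e * F (del c e))"
proof -
  have "interaction_deriv s F c = (\<Sum>j<length c. \<Sum>v | v \<in> c ! j \<and> c ! j \<noteq> {v}. face_sign s c (j, v) * F (del c (j, v)))"
    by (simp add: interaction_deriv_def face_sign_def del_def sum_distrib_left mult.assoc)
  also have "\<dots> = (\<Sum>(j, v)\<in>(SIGMA j : {..<length c}. {v. v \<in> c ! j \<and> c ! j \<noteq> {v}}). face_sign s c (j, v) * F (del c (j, v)))"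
    using simplices_nth[OF assms] by (intro sum.Sigma) auto
  also have "(SIGMA j : {..<length c}. {v. v \<in> c ! j \<and> c ! j \<noteq> {v}}) = faces c"
    by (auto simp: faces_def)
  finally show ?thesis by (simp add: case_prod_unfold)
qed

lemma orientation_square: "orientation s \<Longrightarrow> s x * s x = 1"
  by (auto simp: orientation_def dest!: spec[of _ x])

text \<open>The smaller vertex \<open>v\<close> is counted in the sign of \<open>w\<close>, but \<open>w\<close> is not counted in the sign of \<open>v\<close>. Every
  value of \<open>s\<close> on an intermediate simplex occurs twice and squares to one.\<close>

lemma incidence_anticommute:
  assumes s: "orientation s" and x: "finite x" "v \<in> x" "w \<in> x" and vw: "v < w"
  shows "incidence s x v * incidence s (x - {v}) w = - (incidence s x w * incidence s (x - {w}) v)"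
proof -
  have w: "{u \<in> x. u < w} = insert v {u \<in> x - {v}. u < w}" using x vw by auto
  have "card {u \<in> x. u < w} = Suc (card {u \<in> x - {v}. u < w})"
    unfolding w using x by (subst card_insert_disjoint) auto
  moreover have "{u \<in> x - {w}. u < v} = {u \<in> x. u < v}" using vw by auto
  moreover have "x - {v} - {w} = x - {w} - {v}" by auto
  ultimately show ?thesis
    using orientation_square[OF s, of "x - {v}"] orientation_square[OF s, of "x - {w}"]
    by (simp add: incidence_def)
qed

text \<open>If the vertices are removed from different simplices, removing the earlier one lowers the dimension
  in front of the later one by one; within one simplex this is \<open>incidence_anticommute\<close>.\<close>

lemma diamond_ordered:
  assumes s: "orientation s" and c: "simplices c"
    and e: "(i, v) \<in> faces c" "(j, w) \<in> faces (del c (i, v))"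
    and less: "i < j \<or> i = j \<and> v < w"
  shows "(j, w) \<in> faces c" "(i, v) \<in> faces (del c (j, w))"
    and "del (del c (i, v)) (j, w) = del (del c (j, w)) (i, v)"
    and "face_sign s c (i, v) * face_sign s (del c (i, v)) (j, w)
      = - (face_sign s c (j, w) * face_sign s (del c (j, w)) (i, v))"
proof -
  note f = facesD[OF e(1)] and g = facesD[OF e(2)]
  have fin: "finite (c ! i)" "finite (c ! j)" using simplices_nth[OF c] f(1) g(1) by auto
  show "(j, w) \<in> faces c" "(i, v) \<in> faces (del c (j, w))"
    using f g less by (auto simp: faces_def nth_del split: if_splits)
  show "del (del c (i, v)) (j, w) = del (del c (j, w)) (i, v)"
    using f(1) g(1) by (intro nth_equalityI) (auto simp: nth_del)
  show "face_sign s c (i, v) * face_sign s (del c (i, v)) (j, w)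
      = - (face_sign s c (j, w) * face_sign s (del c (j, w)) (i, v))"
  proof (cases "i = j")
    case True
    then have "v < w" "w \<in> c ! i" using less f g by (auto simp: nth_del)
    from incidence_anticommute[OF s fin(1) f(2) this(2,1)] show ?thesis
      using True f(1) by (simp add: face_sign_def nth_del take_del mult.assoc mult.left_commute[of "incidence s _ _"])
  next
    case False
    then have ij: "i < j" using less by simp
    have "simplices (take j c)" using c by (auto simp: simplices_def dest: in_set_takeD)
    moreover have "(i, v) \<in> faces (take j c)" using f ij by (simp add: faces_def)
    ultimately have "tuple_dim (take j c) = Suc (tuple_dim (del (take j c) (i, v)))"
      by (rule tuple_dim_del)
    then show ?thesis using ij f(1) g(1) by (simp add: face_sign_def nth_del take_del)
  qed
qed

text \<open>The basic cancellation behind \<open>d \<circ> d = 0\<close>, with the fact that two vertices which can be removed one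
  after the other can be removed in either order.\<close>

lemma diamond:
  assumes s: "orientation s" and c: "simplices c"
    and e: "e \<in> faces c" "e' \<in> faces (del c e)"
  shows "e' \<in> faces c" "e \<in> faces (del c e')" "del (del c e) e' = del (del c e') e"
    and "face_sign s c e * face_sign s (del c e) e' = - (face_sign s c e' * face_sign s (del c e') e)"
proof -
  obtain i v j w where ee: "e = (i, v)" "e' = (j, w)" by (cases e; cases e')
  note f = facesD[OF e(1)[unfolded ee]] and g = facesD[OF e(2)[unfolded ee]]
  have "e' \<in> faces c \<and> e \<in> faces (del c e') \<and> del (del c e) e' = del (del c e') e \<and>
    face_sign s c e * face_sign s (del c e) e' = - (face_sign s c e' * face_sign s (del c e') e)"
  proof (cases "i < j \<or> i = j \<and> v < w")
    case True
    show ?thesis using diamond_ordered[OF s c e[unfolded ee] True] unfolding ee by blast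
  next
    case False
    have "v \<noteq> w" if "i = j" using that g(1,2) f(1) by (auto simp: nth_del)
    then have less: "j < i \<or> j = i \<and> w < v" using False by auto
    have e': "(j, w) \<in> faces c" "(i, v) \<in> faces (del c (j, w))"
      using f g less by (auto simp: faces_def nth_del split: if_splits)
    show ?thesis using diamond_ordered[OF s c e' less] e' unfolding ee by simp
  qed
  then show "e' \<in> faces c" "e \<in> faces (del c e')" "del (del c e) e' = del (del c e') e"
    and "face_sign s c e * face_sign s (del c e) e' = - (face_sign s c e' * face_sign s (del c e') e)"
    by blast+
qed

text \<open>The second derivative is a sum over pairs of successive faces, and exchanging the two faces changes
  the sign of a summand while keeping the tuple it is evaluated at.\<close>

lemma interaction_deriv_square:
  assumes s: "orientation s" and c: "simplices c"
  shows "interaction_deriv s (interaction_deriv s F) c = 0"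
proof -
  define R where "R = (SIGMA e : faces c. faces (del c e))"
  define g where "g e e' = face_sign s c e * face_sign s (del c e) e' * F (del (del c e) e')" for e e'
  have R: "(e', e) \<in> R" and anti: "g e e' = - g e' e" if "(e, e') \<in> R" for e e'
    using diamond[OF s c, of e e'] that by (simp_all add: g_def R_def)
  have "interaction_deriv s (interaction_deriv s F) c = (\<Sum>e\<in>faces c. \<Sum>e'\<in>faces (del c e). g e e')"
    using simplices_del[OF c] by (simp add: interaction_deriv_faces[OF c] interaction_deriv_faces sum_distrib_left g_def mult.assoc)
  also have "\<dots> = (\<Sum>(e, e')\<in>R. g e e')"
    using faces_finite c simplices_del unfolding R_def by (intro sum.Sigma) blast+
  also have "\<dots> = (\<Sum>z\<in>R. g (fst z) (snd z))" by (simp add: case_prod_unfold)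
  finally have 1: "interaction_deriv s (interaction_deriv s F) c = (\<Sum>z\<in>R. g (fst z) (snd z))" .
  have "bij_betw prod.swap R R"
    by (rule bij_betw_byWitness[where f' = prod.swap]) (use R in force)+
  from sum.reindex_bij_betw[OF this, of "\<lambda>z. g (fst z) (snd z)"]
  have "(\<Sum>z\<in>R. g (fst z) (snd z)) = (\<Sum>z\<in>R. g (snd z) (fst z))" by simp
  also have "\<dots> = (\<Sum>z\<in>R. - g (fst z) (snd z))"
  proof (rule sum.cong[OF HOL.refl])
    fix z assume "z \<in> R"
    then show "g (snd z) (fst z) = - g (fst z) (snd z)" using anti[of "fst z" "snd z"] by simp
  qed
  also have "\<dots> = - (\<Sum>z\<in>R. g (fst z) (snd z))" by (rule sum_negf)
  finally show ?thesis using 1 by simp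
qed

lemma sum_linear:
  "(\<Sum>v\<in>A. b v * (\<Sum>i\<in>I. a i * F i v)) = (\<Sum>i\<in>I. a i * (\<Sum>v\<in>A. b v * (F i v :: real)))"
  unfolding sum_distrib_left by (subst sum.swap) (simp add: mult.left_commute)

lemma interaction_deriv_sum:
  "interaction_deriv s (\<lambda>Y. \<Sum>i\<in>I. a i * F i Y) X = (\<Sum>i\<in>I. a i * interaction_deriv s (F i) X)"
proof -
  have "(\<Sum>v | v \<in> X ! j \<and> X ! j \<noteq> {v}. incidence s (X ! j) v * (\<Sum>i\<in>I. a i * F i (X[j := X ! j - {v}]))) =
    (\<Sum>i\<in>I. a i * (\<Sum>v | v \<in> X ! j \<and> X ! j \<noteq> {v}. incidence s (X ! j) v * F i (X[j := X ! j - {v}])))" for j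
    by (rule sum_linear)
  then show ?thesis unfolding interaction_deriv_def by (simp only:) (rule sum_linear)
qed



definition total_dim :: "'a set list list \<Rightarrow> nat" where
  "total_dim Xs = (\<Sum>X\<leftarrow>Xs. tuple_dim X)"

definition product_faces :: "'a set list list \<Rightarrow> 'a set list list set" where
  "product_faces Xs = {Xs[i := del (Xs ! i) e] |i e. i < length Xs \<and> e \<in> faces (Xs ! i)}"

definition all_simplices :: "'a set list list \<Rightarrow> bool" where
  "all_simplices Xs \<longleftrightarrow> (\<forall>X\<in>set Xs. simplices X)"

definition nested_le :: "'a set list list \<Rightarrow> 'a set list list \<Rightarrow> bool" where
  "nested_le = list_all2 cell_le"

lemma total_dim_Nil [simp]: "total_dim [] = 0"
  and total_dim_Cons [simp]: "total_dim (X # Xs) = tuple_dim X + total_dim Xs"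
  and total_dim_append [simp]: "total_dim (Xs @ Ys) = total_dim Xs + total_dim Ys"
  by (simp_all add: total_dim_def)

lemma total_dim_sum: "total_dim Xs = (\<Sum>i<length Xs. tuple_dim (Xs ! i))"
  by (simp add: total_dim_def sum_list_sum_nth atLeast0LessThan)

lemma all_simplices_nth: "all_simplices Xs \<Longrightarrow> i < length Xs \<Longrightarrow> simplices (Xs ! i)"
  by (simp add: all_simplices_def)

lemma cell_le_del: "cell_le (del c e) c"
  by (cases e) (auto simp: list_all2_conv_all_nth nth_del)

lemma product_facesD:
  assumes Xs: "all_simplices Xs" and Ys: "Ys \<in> product_faces Xs"
  shows "all_simplices Ys" "total_dim Xs = Suc (total_dim Ys)" "nested_le Ys Xs"
proof -
  obtain i e where i: "i < length Xs" and e: "e \<in> faces (Xs ! i)" and Y: "Ys = Xs[i := del (Xs ! i) e]"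
    using Ys by (auto simp: product_faces_def)
  note s = all_simplices_nth[OF Xs]
  have "simplices (Ys ! j)" if "j < length Xs" for j
    using that s[OF that] simplices_del[OF s[OF i] e] i by (auto simp: Y nth_list_update)
  then show "all_simplices Ys" by (auto simp: all_simplices_def in_set_conv_nth Y)
  have "(\<Sum>j\<in>{..<length Xs} - {i}. tuple_dim (Ys ! j)) = (\<Sum>j\<in>{..<length Xs} - {i}. tuple_dim (Xs ! j))"
    by (rule sum.cong) (auto simp: Y)
  then show "total_dim Xs = Suc (total_dim Ys)"
    using i tuple_dim_del[OF s[OF i] e] by (simp add: total_dim_sum sum.remove[of "{..<length Xs}" i] Y)
  have "cell_le (Ys ! j) (Xs ! j)" if "j < length Xs" for j
    using that i by (simp add: Y nth_list_update cell_le_del list_all2_refl)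
  then show "nested_le Ys Xs" by (simp add: nested_le_def list_all2_conv_all_nth Y)
qed

lemma product_deriv_flat:
  "product_deriv s F Xs =
    (\<Sum>i<length Xs. (- 1) ^ total_dim (take i Xs) * interaction_deriv s (\<lambda>Y. F (Xs[i := Y])) (Xs ! i))"
proof (induction Xs arbitrary: F)
  case (Cons X Xs)
  then show ?case
    by (simp add: sum.lessThan_Suc_shift sum_distrib_left power_add mult.assoc del: sum.lessThan_Suc)
qed simp

lemma interaction_deriv_cong:
  assumes "simplices c" "\<And>e. e \<in> faces c \<Longrightarrow> F (del c e) = G (del c e)"
  shows "interaction_deriv s F c = interaction_deriv s G c"
  using assms by (simp add: interaction_deriv_faces)

lemma product_deriv_cong:
  assumes "all_simplices Xs" "\<And>Ys. Ys \<in> product_faces Xs \<Longrightarrow> F Ys = G Ys"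
  shows "product_deriv s F Xs = product_deriv s G Xs"
  unfolding product_deriv_flat
proof (rule sum.cong[OF HOL.refl])
  fix i assume i: "i \<in> {..<length Xs}"
  have "interaction_deriv s (\<lambda>Y. F (Xs[i := Y])) (Xs ! i) = interaction_deriv s (\<lambda>Y. G (Xs[i := Y])) (Xs ! i)"
    using i all_simplices_nth[OF assms(1)] by (intro interaction_deriv_cong assms(2)) (auto simp: product_faces_def)
  then show "(- 1) ^ total_dim (take i Xs) * interaction_deriv s (\<lambda>Y. F (Xs[i := Y])) (Xs ! i) =
      (- 1) ^ total_dim (take i Xs) * interaction_deriv s (\<lambda>Y. G (Xs[i := Y])) (Xs ! i)" by simp
qed

lemma product_deriv_sum:
  "product_deriv s (\<lambda>Ys. \<Sum>i\<in>I. a i * F i Ys) Xs = (\<Sum>i\<in>I. a i * product_deriv s (F i) Xs)"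
  unfolding product_deriv_flat interaction_deriv_sum by (rule sum_linear)

lemma product_deriv_add:
  "product_deriv s (\<lambda>Ys. F Ys + a * G Ys) Xs = product_deriv s F Xs + a * product_deriv s G Xs"
  using product_deriv_sum[where I = "{False, True}" and a = "\<lambda>b. if b then a else 1"
      and F = "\<lambda>b. if b then G else F" and s = s and Xs = Xs]
  by simp

lemma product_deriv_nonzero:
  assumes "all_simplices Xs" "product_deriv s F Xs \<noteq> 0"
  obtains Ys where "Ys \<in> product_faces Xs" "F Ys \<noteq> 0"
  using product_deriv_cong[OF assms(1), of F "\<lambda>_. 0" s] assms(2) product_deriv_zero[of s Xs] by metis

text \<open>By induction on the number of factors. In the mixed terms the derivative in the first factor
  commutes with the derivative in the remaining ones, but it lowers the exponent of the sign in front of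
  the latter.\<close>

lemma product_deriv_square:
  assumes s: "orientation s" and Xs: "all_simplices Xs"
  shows "product_deriv s (product_deriv s F) Xs = 0"
  using Xs
proof (induction Xs arbitrary: F)
  case (Cons X Xs)
  have X: "simplices X" and Xs: "all_simplices Xs" using Cons.prems by (auto simp: all_simplices_def)
  let ?G = "\<lambda>Y. product_deriv s (\<lambda>Ys. F (Y # Ys)) Xs"
  have 1: "interaction_deriv s (\<lambda>Y. interaction_deriv s (\<lambda>Z. F (Z # Xs)) Y + (- 1) ^ tuple_dim Y * ?G Y) X
      = - ((- 1) ^ tuple_dim X * interaction_deriv s ?G X)"
  proof -
    have "interaction_deriv s (\<lambda>Y. interaction_deriv s (\<lambda>Z. F (Z # Xs)) Y + (- 1) ^ tuple_dim Y * ?G Y) X =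
      interaction_deriv s (interaction_deriv s (\<lambda>Z. F (Z # Xs))) X +
        (\<Sum>e\<in>faces X. face_sign s X e * ((- 1) ^ tuple_dim (del X e) * ?G (del X e)))"
      using X by (simp add: interaction_deriv_faces distrib_left sum.distrib)
    also have "\<dots> = (\<Sum>e\<in>faces X. - ((- 1) ^ tuple_dim X * (face_sign s X e * ?G (del X e))))"
      unfolding interaction_deriv_square[OF s X] add_0
      by (rule sum.cong[OF HOL.refl]) (simp add: tuple_dim_del[OF X] mult.left_commute)
    also have "\<dots> = - ((- 1) ^ tuple_dim X * interaction_deriv s ?G X)"
      using X by (simp add: sum_negf sum_distrib_left interaction_deriv_faces)
    finally show ?thesis .
  qed
  have 2: "product_deriv s (\<lambda>Ys. interaction_deriv s (\<lambda>Y. F (Y # Ys)) X) Xs = interaction_deriv s ?G X"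
    using X by (simp add: interaction_deriv_faces product_deriv_sum)
  have 3: "product_deriv s (product_deriv s (\<lambda>Ys. F (X # Ys))) Xs = 0"
    using Cons.IH[OF Xs] .
  show ?case
    by (simp add: 1 product_deriv_add 2 3)
qed simp


section \<open>Betti numbers as dimensions of harmonic spaces\<close>

text \<open>The matrix entry of the exterior derivative: the derivative of the delta function at \<open>Ys\<close>.\<close>

definition deriv_kernel :: "('a::linorder set \<Rightarrow> real) \<Rightarrow> 'a set list list \<Rightarrow> 'a set list list \<Rightarrow> real" where
  "deriv_kernel s Xs Ys = product_deriv s (\<lambda>Zs. of_bool (Zs = Ys)) Xs"

lemma deriv_kernel_nonzero:
  assumes "all_simplices Xs" "deriv_kernel s Xs Ys \<noteq> 0"
  shows "Ys \<in> product_faces Xs"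
proof -
  obtain Zs where Zs: "Zs \<in> product_faces Xs" "of_bool (Zs = Ys) \<noteq> (0::real)"
    by (rule product_deriv_nonzero[OF assms(1) assms(2)[unfolded deriv_kernel_def]])
  then show ?thesis by (cases "Zs = Ys") simp_all
qed

lemma deriv_kernel_raises:
  assumes "\<And>Xs. Xs \<in> T \<Longrightarrow> all_simplices Xs"
  shows "raises_degree T total_dim (deriv_kernel s)"
  unfolding raises_degree_def using assms deriv_kernel_nonzero product_facesD(2) by blast

text \<open>The derivative at \<open>Xs\<close> sees only the faces of \<open>Xs\<close>, where a cochain that vanishes off \<open>T\<close> is a
  combination of delta functions.\<close>

lemma product_deriv_kernel:
  assumes T: "finite T" and F: "\<And>Ys. Ys \<in> product_faces Xs \<Longrightarrow> F Ys \<noteq> 0 \<Longrightarrow> Ys \<in> T"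
    and Xs: "all_simplices Xs"
  shows "product_deriv s F Xs = (\<Sum>Ys\<in>T. deriv_kernel s Xs Ys * F Ys)"
proof -
  have "product_deriv s F Xs = product_deriv s (\<lambda>Zs. \<Sum>Ys\<in>T. F Ys * of_bool (Zs = Ys)) Xs"
  proof (rule product_deriv_cong[OF Xs])
    fix Zs assume "Zs \<in> product_faces Xs"
    then show "F Zs = (\<Sum>Ys\<in>T. F Ys * of_bool (Zs = Ys))"
      using F[of Zs] T by (cases "F Zs = 0") (auto simp: of_bool_def if_distrib[where f="\<lambda>a. _ * a"] cong: if_cong)
  qed
  also have "\<dots> = (\<Sum>Ys\<in>T. F Ys * deriv_kernel s Xs Ys)"
    unfolding product_deriv_sum deriv_kernel_def ..
  finally show ?thesis by (simp add: mult.commute)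
qed

lemma product_tuples_nth:
  "Xs \<in> product_tuples k Gs \<longleftrightarrow> length Xs = length Gs \<and> (\<forall>i<length Gs. Xs ! i \<in> tuples k (Gs ! i))"
  by (auto simp: product_tuples_def listset_iff list_all2_conv_all_nth)

lemma tuples_simplices:
  "simplicial_complex G \<Longrightarrow> X \<in> tuples k G \<Longrightarrow> simplices X"
  by (auto simp: tuples_def simplicial_complex_def simplices_def)

lemma product_tuples_simplices:
  assumes "product_complex Gs" "Xs \<in> product_tuples k Gs"
  shows "all_simplices Xs"
proof -
  have "simplices (Xs ! i)" if "i < length Gs" for i
    using tuples_simplices[of "Gs ! i" "Xs ! i" k] assms that
    by (simp add: product_complex_def product_tuples_nth)
  then show ?thesis
    using assms(2) by (auto simp: all_simplices_def in_set_conv_nth product_tuples_nth)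
qed

text \<open>The restriction to intersecting tuples does not destroy \<open>d \<circ> d = 0\<close>, because a tuple lying between
  two intersecting tuples intersects as well.\<close>

lemma tuples_convex:
  assumes G: "simplicial_complex G" and X: "X \<in> tuples k G" and Z: "Z \<in> tuples k G"
    and ZY: "cell_le Z Y" and YX: "cell_le Y X"
  shows "Y \<in> tuples k G"
proof -
  have len: "length X = k" "length Y = k" "length Z = k"
    using X Z ZY by (auto simp: tuples_def dest: list_all2_lengthD)
  have "Y ! i \<in> G \<and> Z ! i \<subseteq> Y ! i" if i: "i < k" for i
  proof -
    have "set X \<subseteq> G" "set Z \<subseteq> G" using X Z by (simp_all add: tuples_def)
    then have "X ! i \<in> G" "Z ! i \<in> G" using i len by (simp_all add: subset_code(1))
    moreover have "Z ! i \<subseteq> Y ! i" "Y ! i \<subseteq> X ! i"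
      using ZY YX i len by (auto simp: list_all2_conv_all_nth)
    moreover have "Z ! i \<noteq> {}" using \<open>Z ! i \<in> G\<close> G by (auto simp: simplicial_complex_def)
    ultimately show ?thesis using simplicial_complex_face[OF G, of "X ! i" "Y ! i"] by blast
  qed
  moreover obtain v where "v \<in> \<Inter>(set Z)" using Z by (auto simp: tuples_def)
  then have "v \<in> Z ! i" if "i < k" for i using that len by simp
  ultimately have "set Y \<subseteq> G" "v \<in> \<Inter>(set Y)"
    using len by (auto simp: in_set_conv_nth subset_iff)
  then show ?thesis using len by (auto simp: tuples_def)
qed

lemma product_tuples_convex:
  assumes Gs: "product_complex Gs" and Xs: "Xs \<in> product_tuples k Gs" and Zs: "Zs \<in> product_tuples k Gs"
    and "nested_le Zs Ys" "nested_le Ys Xs"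
  shows "Ys \<in> product_tuples k Gs"
  unfolding product_tuples_nth
proof (intro conjI allI impI)
  show len: "length Ys = length Gs"
    using Xs assms(5) by (simp add: product_tuples_nth nested_le_def list_all2_lengthD)
  fix i assume i: "i < length Gs"
  show "Ys ! i \<in> tuples k (Gs ! i)"
  proof (rule tuples_convex)
    show "simplicial_complex (Gs ! i)" using Gs i by (simp add: product_complex_def)
    show "Xs ! i \<in> tuples k (Gs ! i)" "Zs ! i \<in> tuples k (Gs ! i)"
      using Xs Zs i by (auto simp: product_tuples_nth)
    show "cell_le (Zs ! i) (Ys ! i)" "cell_le (Ys ! i) (Xs ! i)"
      using assms(4,5) len i by (auto simp: nested_le_def list_all2_conv_all_nth)
  qed
qed

theorem betti_harmonic:
  assumes s: "orientation s" and Gs: "product_complex Gs"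
  shows "real (betti s k Gs p) =
    trace_dim (product_tuples k Gs) (harmonic (product_tuples k Gs) total_dim (deriv_kernel s) p)"
proof -
  let ?T = "product_tuples k Gs" and ?D = "deriv_kernel s"
  note T = finite_product_tuples[OF Gs, of k] and smp = product_tuples_simplices[OF Gs]
  have deriv: "derivative ?T ?D F = exterior_deriv s k Gs F" if "F \<in> supported ?T" for F
  proof
    fix Xs
    have "product_deriv s F Xs = (\<Sum>Ys\<in>?T. ?D Xs Ys * F Ys)" if "Xs \<in> ?T"
      using \<open>F \<in> supported ?T\<close> smp[OF that] by (intro product_deriv_kernel T) (auto simp: supported_def)
    then show "derivative ?T ?D F Xs = exterior_deriv s k Gs F Xs"
      by (simp add: derivative_def exterior_deriv_def)
  qed
  have chains: "cochains k Gs q = chains ?T total_dim q" for q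
    by (simp add: cochains_def chains_def total_dim_def)
  have supp: "cochains k Gs q \<subseteq> supported ?T" for q
    by (auto simp: cochains_def supported_def)
  have Z: "cocycles s k Gs p = {F \<in> chains ?T total_dim p. derivative ?T ?D F = (\<lambda>_. 0)}"
    using deriv supp[of p] unfolding cocycles_def chains[symmetric] by auto
  have B: "coboundaries s k Gs p = derivative ?T ?D ` {F. \<forall>x. F x \<noteq> 0 \<longrightarrow> x \<in> ?T \<and> Suc (total_dim x) = p}"
  proof (cases p)
    case 0
    then have "{F :: _ \<Rightarrow> real. \<forall>x. F x \<noteq> 0 \<longrightarrow> x \<in> ?T \<and> Suc (total_dim x) = p} = {\<lambda>_. 0}" by auto
    moreover have "derivative ?T ?D (\<lambda>_. 0) = (\<lambda>_. 0)" by (auto simp: derivative_def)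
    ultimately show ?thesis using 0 by (simp add: coboundaries_def)
  next
    case (Suc q)
    then have "{F :: _ \<Rightarrow> real. \<forall>x. F x \<noteq> 0 \<longrightarrow> x \<in> ?T \<and> Suc (total_dim x) = p} = cochains k Gs q"
      unfolding chains by (simp add: chains_def)
    moreover have "derivative ?T ?D ` cochains k Gs q = exterior_deriv s k Gs ` cochains k Gs q"
      using deriv supp[of q] by (intro image_cong) auto
    ultimately show ?thesis using Suc by (simp add: coboundaries_def)
  qed
  show ?thesis
    unfolding betti_def Z B
  proof (rule quotient_dim_harmonic[OF T])
    show "raises_degree ?T total_dim ?D" using smp by (rule deriv_kernel_raises)
    fix Xs Zs assume X: "Xs \<in> ?T" and Z: "Zs \<in> ?T"
    have "(\<Sum>Ys\<in>?T. ?D Xs Ys * ?D Ys Zs) = product_deriv s (\<lambda>Ys. ?D Ys Zs) Xs"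
    proof (rule product_deriv_kernel[OF T _ smp[OF X], symmetric])
      fix Ys assume Y: "Ys \<in> product_faces Xs" "?D Ys Zs \<noteq> 0"
      note YX = product_facesD[OF smp[OF X] Y(1)]
      have "nested_le Zs Ys"
        using product_facesD(3)[OF YX(1) deriv_kernel_nonzero[OF YX(1) Y(2)]] .
      then show "Ys \<in> ?T" using product_tuples_convex[OF Gs X Z _ YX(3)] by blast
    qed
    also have "\<dots> = 0"
      unfolding deriv_kernel_def by (rule product_deriv_square[OF s smp[OF X]])
    finally show "(\<Sum>Ys\<in>?T. ?D Xs Ys * ?D Ys Zs) = 0" .
  qed
qed



section \<open>Independence of the orientation\<close>

text \<open>Multiplying a cochain by this sign exchanges the orientation \<open>s\<close> for the orientation by increasing
  vertices. As the Betti numbers do not notice it, all later sections use the constant orientation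
  \<open>\<lambda>_. 1\<close>.\<close>

definition orientation_product :: "('a set \<Rightarrow> real) \<Rightarrow> 'a set list \<Rightarrow> real" where
  "orientation_product s c = (\<Prod>j<length c. s (c ! j))"

lemma orientation_product_square:
  "orientation s \<Longrightarrow> orientation_product s c * orientation_product s c = 1"
  by (simp add: orientation_product_def orientation_square flip: prod.distrib)

lemma orientation_one: "orientation (\<lambda>_. 1)"
  by (simp add: orientation_def)

text \<open>In the product of the two signs all positions but the one of the removed vertex contribute a square,
  and what remains is the factor of \<open>s\<close> in the incidence number.\<close>

lemma face_sign_orientation:
  assumes s: "orientation s" and e: "e \<in> faces c"
  shows "face_sign s c e = orientation_product s c * (orientation_product s (del c e) * face_sign (\<lambda>_. 1) c e)"
proof -
  obtain i v where iv: "e = (i, v)" by (cases e)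
  have i: "i < length c" using e by (simp add: iv faces_def)
  have "orientation_product s c * orientation_product s (del c e) = (\<Prod>j<length c. s (c ! j) * s (del c e ! j))"
    by (simp add: orientation_product_def prod.distrib)
  also have "\<dots> = s (c ! i) * s (c ! i - {v}) * (\<Prod>j\<in>{..<length c} - {i}. s (c ! j) * s (del c e ! j))"
    using i by (subst prod.remove[of _ i]) (simp_all add: iv nth_del)
  also have "(\<Prod>j\<in>{..<length c} - {i}. s (c ! j) * s (del c e ! j)) = 1"
    by (rule prod.neutral) (auto simp: iv nth_del orientation_square[OF s])
  finally show ?thesis by (simp add: mult.assoc[symmetric]) (simp add: face_sign_def incidence_def iv)
qed

lemma interaction_deriv_scale:
  "interaction_deriv s (\<lambda>Y. a * F Y) X = a * interaction_deriv s F X"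
  using interaction_deriv_sum[where I = "{()}" and a = "\<lambda>_. a" and F = "\<lambda>_. F"] by simp

lemma product_deriv_scale:
  "product_deriv s (\<lambda>Y. a * F Y) X = a * product_deriv s F X"
  using product_deriv_sum[where I = "{()}" and a = "\<lambda>_. a" and F = "\<lambda>_. F"] by simp

lemma product_deriv_orientation:
  assumes s: "orientation s" and "all_simplices Xs"
  shows "product_deriv s F Xs = (\<Prod>X\<leftarrow>Xs. orientation_product s X) *
    product_deriv (\<lambda>_. 1) (\<lambda>Ys. (\<Prod>X\<leftarrow>Ys. orientation_product s X) * F Ys) Xs"
  using assms(2)
proof (induction Xs arbitrary: F)
  case (Cons X Xs)
  have X: "simplices X" and Xs: "all_simplices Xs" using Cons.prems by (auto simp: all_simplices_def)
  let ?\<sigma> = "orientation_product s" and ?\<Sigma> = "\<lambda>Ys. \<Prod>X\<leftarrow>Ys. orientation_product s X"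
  have \<Sigma>: "?\<Sigma> Ys * ?\<Sigma> Ys = 1" for Ys
    by (induction Ys) (simp_all add: orientation_product_square[OF s] mult.left_commute mult.assoc[symmetric])
  have \<sigma>: "?\<sigma> X * ?\<sigma> X = 1" by (rule orientation_product_square[OF s])
  have "interaction_deriv s (\<lambda>Y. F (Y # Xs)) X =
      (\<Sum>e\<in>faces X. ?\<sigma> X * (?\<sigma> (del X e) * face_sign (\<lambda>_. 1) X e) * F (del X e # Xs))"
    using face_sign_orientation[OF s] by (simp add: interaction_deriv_faces[OF X])
  then have 1: "interaction_deriv s (\<lambda>Y. F (Y # Xs)) X = ?\<sigma> X * interaction_deriv (\<lambda>_. 1) (\<lambda>Y. ?\<sigma> Y * F (Y # Xs)) X"
    by (simp add: interaction_deriv_faces[OF X] sum_distrib_left mult_ac)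
  have 2: "interaction_deriv (\<lambda>_. 1) (\<lambda>Y. ?\<Sigma> (Y # Xs) * F (Y # Xs)) X =
      ?\<Sigma> Xs * interaction_deriv (\<lambda>_. 1) (\<lambda>Y. ?\<sigma> Y * F (Y # Xs)) X"
    by (simp add: interaction_deriv_scale[symmetric] mult_ac)
  have 3: "product_deriv (\<lambda>_. 1) (\<lambda>Ys. ?\<Sigma> (X # Ys) * F (X # Ys)) Xs =
      ?\<sigma> X * product_deriv (\<lambda>_. 1) (\<lambda>Ys. ?\<Sigma> Ys * F (X # Ys)) Xs"
    by (simp add: product_deriv_scale[symmetric] mult_ac)
  have "?\<Sigma> (X # Xs) * product_deriv (\<lambda>_. 1) (\<lambda>Ys. ?\<Sigma> Ys * F Ys) (X # Xs) =
    (?\<Sigma> Xs * ?\<Sigma> Xs) * (?\<sigma> X * interaction_deriv (\<lambda>_. 1) (\<lambda>Y. ?\<sigma> Y * F (Y # Xs)) X) +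
    (?\<sigma> X * ?\<sigma> X) * ((- 1) ^ tuple_dim X * (?\<Sigma> Xs * product_deriv (\<lambda>_. 1) (\<lambda>Ys. ?\<Sigma> Ys * F (X # Ys)) Xs))"
    unfolding product_deriv.simps 2 3 by (simp add: algebra_simps)
  also have "\<dots> = product_deriv s F (X # Xs)"
    unfolding \<Sigma> \<sigma> product_deriv.simps 1 using Cons.IH[OF Xs, of "\<lambda>Ys. F (X # Ys)"] by simp
  finally show ?case ..
qed simp

theorem betti_orientation:
  assumes s: "orientation s" and Gs: "product_complex Gs"
  shows "betti s k Gs p = betti (\<lambda>_. 1) k Gs p"
proof -
  let ?T = "product_tuples k Gs" and ?\<Sigma> = "\<lambda>Ys. \<Prod>X\<leftarrow>Ys. orientation_product s X"
  have "trace_dim ?T (harmonic ?T total_dim (deriv_kernel s) p) = trace_dim ?T (harmonic ?T total_dim (deriv_kernel (\<lambda>_. 1)) p)"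
  proof (rule trace_dim_isomorphic[where \<phi> = "\<lambda>Xs. Xs" and \<tau> = ?\<Sigma>])
    show "finite ?T" by (rule finite_product_tuples[OF Gs])
    show "?\<Sigma> Ys * ?\<Sigma> Ys = 1" for Ys
      by (induction Ys) (simp_all add: orientation_product_square[OF s] mult.left_commute mult.assoc[symmetric])
    fix Xs Ys assume "Xs \<in> ?T"
    have "(\<lambda>Zs. ?\<Sigma> Zs * of_bool (Zs = Ys)) = (\<lambda>Zs. ?\<Sigma> Ys * of_bool (Zs = Ys))"
      by (auto simp: fun_eq_iff)
    then show "deriv_kernel s Xs Ys = ?\<Sigma> Xs * ?\<Sigma> Ys * deriv_kernel (\<lambda>_. 1) Xs Ys"
      unfolding deriv_kernel_def product_deriv_orientation[OF s product_tuples_simplices[OF Gs \<open>Xs \<in> ?T\<close>]]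
      by (simp add: product_deriv_scale)
  qed (simp_all add: bij_betw_def)
  then have "real (betti s k Gs p) = real (betti (\<lambda>_. 1) k Gs p)"
    unfolding betti_harmonic[OF s Gs] betti_harmonic[OF orientation_one Gs] .
  then show ?thesis by simp
qed


section \<open>The Kuenneth formula\<close>

text \<open>Both sides attach to a face the parity of all dimensions in front of it, so the recursion over single
  factors may be grouped into two blocks.\<close>

lemma product_deriv_append:
  "product_deriv s F (Xs @ Ys) =
    product_deriv s (\<lambda>Zs. F (Zs @ Ys)) Xs + (- 1) ^ total_dim Xs * product_deriv s (\<lambda>Zs. F (Xs @ Zs)) Ys"
  by (induction Xs arbitrary: F) (simp_all add: power_add algebra_simps)

lemma deriv_kernel_append:
  assumes "all_simplices Xs" "all_simplices Ys" "length Xs = length Xs'" "length Ys = length Ys'"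
  shows "deriv_kernel s (Xs @ Ys) (Xs' @ Ys') =
    tensor_kernel total_dim (deriv_kernel s) (deriv_kernel s) (Xs, Ys) (Xs', Ys')"
proof -
  have "product_deriv s (\<lambda>Zs. of_bool (Zs @ Ys = Xs' @ Ys')) Xs =
      product_deriv s (\<lambda>Zs. of_bool (Ys = Ys') * of_bool (Zs = Xs')) Xs"
    using assms by (intro product_deriv_cong) auto
  moreover have "product_deriv s (\<lambda>Zs. of_bool (Xs @ Zs = Xs' @ Ys')) Ys =
      product_deriv s (\<lambda>Zs. of_bool (Xs = Xs') * of_bool (Zs = Ys')) Ys"
    using assms by (intro product_deriv_cong) auto
  ultimately show ?thesis
    by (simp only: deriv_kernel_def product_deriv_append product_deriv_scale tensor_kernel_def prod.case)
qed

theorem betti_append: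
  assumes G: "product_complex G" and H: "product_complex H"
  shows "betti (\<lambda>_. 1) k (G @ H) p = (\<Sum>a\<le>p. betti (\<lambda>_. 1) k G a * betti (\<lambda>_. 1) k H (p - a))"
proof -
  let ?T = "product_tuples k"
  let ?D = "deriv_kernel (\<lambda>_. 1)"
  note o = orientation_one
  have len: "length Xs = length Gs" if "Xs \<in> ?T Gs" for Xs Gs using that by (simp add: product_tuples_nth)
  have bij: "bij_betw (\<lambda>(Xs, Ys). Xs @ Ys) (?T G \<times> ?T H) (?T (G @ H))"
  proof (rule bij_betw_byWitness[where f' = "\<lambda>Zs. (take (length G) Zs, drop (length G) Zs)"])
    show "\<forall>z\<in>?T G \<times> ?T H. (take (length G) (case z of (Xs, Ys) \<Rightarrow> Xs @ Ys), drop (length G) (case z of (Xs, Ys) \<Rightarrow> Xs @ Ys)) = z"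
      using len[of _ G] by auto
    show "(\<lambda>(Xs, Ys). Xs @ Ys) ` (?T G \<times> ?T H) \<subseteq> ?T (G @ H)"
      by (auto simp: product_tuples_def listset_appendI)
    show "(\<lambda>Zs. (take (length G) Zs, drop (length G) Zs)) ` ?T (G @ H) \<subseteq> ?T G \<times> ?T H"
      by (auto simp: product_tuples_def listset_append)
  qed simp
  have "trace_dim (?T (G @ H)) (harmonic (?T (G @ H)) total_dim ?D p) =
    trace_dim (?T G \<times> ?T H) (harmonic (?T G \<times> ?T H) (\<lambda>(Xs, Ys). total_dim Xs + total_dim Ys) (tensor_kernel total_dim ?D ?D) p)"
  proof (rule trace_dim_isomorphic[OF _ bij, where \<tau> = "\<lambda>_. 1"])
    fix z w assume z: "z \<in> ?T G \<times> ?T H" and w: "w \<in> ?T G \<times> ?T H"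
    obtain Xs Ys Xs' Ys' where zw: "z = (Xs, Ys)" "w = (Xs', Ys')" by (cases z; cases w)
    show "?D (case z of (Xs, Ys) \<Rightarrow> Xs @ Ys) (case w of (Xs, Ys) \<Rightarrow> Xs @ Ys) = 1 * 1 * tensor_kernel total_dim ?D ?D z w"
      unfolding zw prod.case mult_1
      by (rule deriv_kernel_append) (use z w zw len[of _ G] len[of _ H] product_tuples_simplices[OF G] product_tuples_simplices[OF H] in auto)
  qed (use finite_product_tuples[OF G] finite_product_tuples[OF H] in auto)
  also have "\<dots> = (\<Sum>a\<le>p. trace_dim (?T G) (harmonic (?T G) total_dim ?D a) * trace_dim (?T H) (harmonic (?T H) total_dim ?D (p - a)))"
    by (intro trace_dim_tensor finite_product_tuples G H deriv_kernel_raises product_tuples_simplices[OF G])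
  finally have "real (betti (\<lambda>_. 1) k (G @ H) p) = real (\<Sum>a\<le>p. betti (\<lambda>_. 1) k G a * betti (\<lambda>_. 1) k H (p - a))"
    by (simp add: betti_harmonic[OF o product_complex_append[OF G H]] betti_harmonic[OF o G] betti_harmonic[OF o H])
  then show ?thesis by (simp only: of_nat_eq_iff)
qed

theorem betti_point: "betti (\<lambda>_. 1) k [{{v}}] p = of_bool (p = 0)"
proof -
  let ?G = "[{{v}}]" and ?X = "[replicate k {v}]"
  have G: "product_complex ?G" by (auto simp: product_complex_def simplicial_complex_def)
  have "X = replicate k {v}" if "X \<in> tuples k {{v}}" for X
    using that by (intro replicate_eqI[of X]) (auto simp: tuples_def)
  moreover have "replicate k {v} \<in> tuples k {{v}}" by (cases "k = 0") (auto simp: tuples_def)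
  ultimately have "tuples k {{v}} = {replicate k {v}}" by blast
  then have T: "product_tuples k ?G = {?X}" by (auto simp: product_tuples_def set_Cons_def)
  have deg: "total_dim ?X = 0" by (simp add: total_dim_def tuple_dim_def sum_list_replicate)
  have X: "all_simplices ?X" using product_tuples_simplices[OF G, of ?X k] T by blast
  have D: "deriv_kernel (\<lambda>_. 1) ?X ?X = 0"
  proof (rule ccontr)
    assume "deriv_kernel (\<lambda>_. 1) ?X ?X \<noteq> 0"
    from product_facesD(2)[OF X deriv_kernel_nonzero[OF X this]] show False by simp
  qed
  let ?H = "harmonic {?X} total_dim (deriv_kernel (\<lambda>_. 1)) p"
  let ?K = "\<lambda>x y. of_bool (p = 0 \<and> x = ?X \<and> y = ?X) :: real"
  have "reproducing {?X} ?H ?K"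
    unfolding reproducing_def
  proof (intro conjI ballI)
    show "?K x \<in> ?H" if "x \<in> {?X}" for x
      using D deg by (intro harmonicI) auto
    show "F x = inner_on {?X} F (?K x)" if "F \<in> ?H" "x \<in> {?X}" for F x
      using harmonicD(2)[OF that(1), of ?X] that(2) deg by (auto simp: inner_on_def)
  qed
  then have "real (betti (\<lambda>_. 1) k ?G p) = of_bool (p = 0)"
    by (simp add: betti_harmonic[OF orientation_one G] T trace_dim_eq)
  then show ?thesis by (cases "p = 0") simp_all
qed



section \<open>From tuples in the factors to tuples of cells\<close>

definition transposed :: "nat \<Rightarrow> 'b list list \<Rightarrow> 'b list list" where
  "transposed k Xs = map (\<lambda>j. map (\<lambda>X. X ! j) Xs) [0..<k]"

definition rectangular :: "nat \<Rightarrow> nat \<Rightarrow> 'b list list \<Rightarrow> bool" where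
  "rectangular n k Xs \<longleftrightarrow> length Xs = n \<and> (\<forall>i<n. length (Xs ! i) = k)"

lemma length_transposed [simp]: "length (transposed k Xs) = k"
  by (simp add: transposed_def)

lemma length_nth_transposed [simp]: "j < k \<Longrightarrow> length (transposed k Xs ! j) = length Xs"
  by (simp add: transposed_def)

lemma nth_transposed: "j < k \<Longrightarrow> i < length Xs \<Longrightarrow> transposed k Xs ! j ! i = Xs ! i ! j"
  by (simp add: transposed_def)

lemma rectangular_transposed: "rectangular n k Xs \<Longrightarrow> rectangular k n (transposed k Xs)"
  by (simp add: rectangular_def transposed_def)

lemma rectangular_eqI:
  assumes "rectangular n k Xs" "rectangular n k Ys"
    and "\<And>i j. i < n \<Longrightarrow> j < k \<Longrightarrow> Xs ! i ! j = Ys ! i ! j"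
  shows "Xs = Ys"
  using assms by (intro nth_equalityI) (auto simp: rectangular_def)

lemma transposed_transposed:
  assumes "rectangular n k Xs"
  shows "transposed n (transposed k Xs) = Xs"
proof (rule rectangular_eqI)
  show "rectangular n k (transposed n (transposed k Xs))" "rectangular n k Xs"
    using assms rectangular_transposed by blast+
qed (use assms in \<open>auto simp: nth_transposed rectangular_def\<close>)

lemma rectangular_update:
  "rectangular n k Xs \<Longrightarrow> rectangular n k (Xs[i := (Xs ! i)[j := y]])"
  by (cases "i < length Xs") (auto simp: rectangular_def nth_list_update list_update_beyond)

lemma transposed_update:
  assumes "rectangular n k Xs" "i < n" "j < k"
  shows "transposed k (Xs[i := (Xs ! i)[j := y]]) = (transposed k Xs)[j := (transposed k Xs ! j)[i := y]]"
proof (rule rectangular_eqI)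
  show "rectangular k n (transposed k (Xs[i := (Xs ! i)[j := y]]))"
    using assms by (intro rectangular_transposed rectangular_update)
  show "rectangular k n ((transposed k Xs)[j := (transposed k Xs ! j)[i := y]])"
    using assms by (intro rectangular_transposed rectangular_update)
qed (use assms in \<open>auto simp: nth_transposed rectangular_def nth_list_update\<close>)

text \<open>Listing a matrix by columns instead of rows exchanges the positions \<open>p\<close> and \<open>q\<close> if and only if \<open>q\<close> is
  in a later row and an earlier column. Each such exchange is weighted with the product of the degrees,
  as in the sign rule for graded objects.\<close>

definition inversions :: "nat \<Rightarrow> nat \<Rightarrow> (nat \<Rightarrow> nat \<Rightarrow> nat) \<Rightarrow> nat" where
  "inversions n k a = (\<Sum>p\<in>{..<n} \<times> {..<k}. \<Sum>q\<in>{..<n} \<times> {..<k}.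
     of_bool (fst p < fst q \<and> snd q < snd p) * (a (fst p) (snd p) * a (fst q) (snd q)))"

text \<open>Lowering one entry changes the weight by the total degree of all entries that exchange their place
  with it.\<close>

lemma inversions_decrease:
  assumes ij: "i < n" "j < k" and a: "a i j = Suc (a' i j)"
    and a': "\<And>p. p \<noteq> (i, j) \<Longrightarrow> a' (fst p) (snd p) = a (fst p) (snd p)"
  shows "inversions n k a = inversions n k a' +
    (\<Sum>q\<in>{..<n} \<times> {..<k}. (of_bool (i < fst q \<and> snd q < j) + of_bool (fst q < i \<and> j < snd q)) * a (fst q) (snd q))"
proof -
  let ?I = "{..<n} \<times> {..<k}"
  let ?r = "\<lambda>p q :: nat \<times> nat. of_bool (fst p < fst q \<and> snd q < snd p) :: nat"
  have "?r p q * (a (fst p) (snd p) * a (fst q) (snd q)) = ?r p q * (a' (fst p) (snd p) * a' (fst q) (snd q)) +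
      ((if p = (i, j) then ?r (i, j) q * a (fst q) (snd q) else 0) +
       (if q = (i, j) then ?r p (i, j) * a (fst p) (snd p) else 0))" for p q
    using a'[of p] a'[of q] a by (cases "p = (i, j)"; cases "q = (i, j)") auto
  then have "inversions n k a = inversions n k a' +
      ((\<Sum>p\<in>?I. \<Sum>q\<in>?I. if p = (i, j) then ?r (i, j) q * a (fst q) (snd q) else 0) +
       (\<Sum>p\<in>?I. \<Sum>q\<in>?I. if q = (i, j) then ?r p (i, j) * a (fst p) (snd p) else 0))"
    by (simp add: inversions_def sum.distrib)
  also have "(\<Sum>p\<in>?I. \<Sum>q\<in>?I. if p = (i, j) then ?r (i, j) q * a (fst q) (snd q) else 0) =
      (\<Sum>q\<in>?I. ?r (i, j) q * a (fst q) (snd q))"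
    using ij by (subst sum.swap) simp
  also have "(\<Sum>p\<in>?I. \<Sum>q\<in>?I. if q = (i, j) then ?r p (i, j) * a (fst p) (snd p) else 0) =
      (\<Sum>p\<in>?I. ?r p (i, j) * a (fst p) (snd p))"
    using ij by simp
  finally show ?thesis by (simp add: distrib_right sum.distrib)
qed

text \<open>The exponent of the sign of a face at \<open>(i, j)\<close>: the total degree of all positions in front of it when
  the matrix is read by rows.\<close>

lemma sum_below_lexicographic:
  fixes i j k n :: nat
  assumes "i < n" "j < k"
  shows "(\<Sum>i'<i. \<Sum>j'<k. b i' j') + (\<Sum>j'<j. b i j') =
    (\<Sum>q\<in>{..<n} \<times> {..<k}. of_bool (fst q < i \<or> fst q = i \<and> snd q < j) * (b (fst q) (snd q) :: nat))"
proof -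
  have row: "(\<Sum>j'<k. of_bool (i' < i \<or> i' = i \<and> j' < j) * b i' j') =
    (if i' < i then \<Sum>j'<k. b i' j' else 0) + (if i' = i then \<Sum>j'<j. b i j' else 0)" for i'
  proof -
    have "(\<Sum>j'<k. of_bool (j' < j) * b i j') = (\<Sum>j'<j. b i j')"
      using assms by (intro sum.mono_neutral_cong_right) auto
    then show ?thesis by (cases "i' = i") auto
  qed
  have "(\<Sum>i'<n. if i' < i then \<Sum>j'<k. b i' j' else 0) = (\<Sum>i'<i. \<Sum>j'<k. b i' j')"
    using assms by (intro sum.mono_neutral_cong_right) auto
  then have "(\<Sum>i'<n. \<Sum>j'<k. of_bool (i' < i \<or> i' = i \<and> j' < j) * b i' j') =
      (\<Sum>i'<i. \<Sum>j'<k. b i' j') + (\<Sum>j'<j. b i j')"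
    unfolding row using assms by (simp add: sum.distrib)
  then show ?thesis by (simp add: sum.cartesian_product case_prod_unfold)
qed

definition transposition_sign :: "nat \<Rightarrow> nat \<Rightarrow> 'a set list list \<Rightarrow> real" where
  "transposition_sign n k Xs = (- 1) ^ inversions n k (\<lambda>i j. card (Xs ! i ! j) - 1)"

text \<open>All exponents are sums of degrees over positions of the matrix. A position in front of \<open>(i, j)\<close> both by
  rows and by columns contributes twice, a position in front of it for one reading only is one that
  exchanges its place with \<open>(i, j)\<close>, and the remaining positions do not contribute, so the total exponent
  is even.\<close>

lemma transposition_sign_face:
  assumes Xs: "rectangular n k Xs" and ij: "i < n" "j < k"
    and y: "card (Xs ! i ! j) - 1 = Suc (card y - 1)"
  shows "(- 1) ^ (total_dim (take j (transposed k Xs)) + tuple_dim (take i (transposed k Xs ! j))) =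
    transposition_sign n k Xs * (transposition_sign n k (Xs[i := (Xs ! i)[j := y]]) *
      (- 1) ^ (total_dim (take i Xs) + tuple_dim (take j (Xs ! i))))"
proof -
  let ?I = "{..<n} \<times> {..<k}"
  define a where "a i j = card (Xs ! i ! j) - 1" for i j
  define a' where "a' i' j' = card (Xs[i := (Xs ! i)[j := y]] ! i' ! j') - 1" for i' j'
  have len: "length Xs = n" "\<And>i. i < n \<Longrightarrow> length (Xs ! i) = k" using Xs by (auto simp: rectangular_def)
  have "inversions n k a = inversions n k a' + (\<Sum>q\<in>?I. (of_bool (i < fst q \<and> snd q < j) + of_bool (fst q < i \<and> j < snd q)) * a (fst q) (snd q))"
  proof (rule inversions_decrease[OF ij])
    show "a i j = Suc (a' i j)" using y len ij by (simp add: a_def a'_def)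
    fix p assume "p \<noteq> (i, j)"
    then show "a' (fst p) (snd p) = a (fst p) (snd p)"
      using len ij by (cases "fst p = i") (auto simp: a_def a'_def prod_eq_iff)
  qed
  moreover have "total_dim (take i Xs) + tuple_dim (take j (Xs ! i)) =
      (\<Sum>q\<in>?I. of_bool (fst q < i \<or> fst q = i \<and> snd q < j) * a (fst q) (snd q))"
    using ij len by (subst sum_below_lexicographic[OF ij, symmetric]) (simp add: total_dim_sum tuple_dim_sum a_def)
  moreover have "total_dim (take j (transposed k Xs)) + tuple_dim (take i (transposed k Xs ! j)) =
      (\<Sum>q\<in>?I. of_bool (snd q < j \<or> snd q = j \<and> fst q < i) * a (fst q) (snd q))"
  proof -
    have "length (transposed k Xs ! j') = n" if "j' < k" for j' using that len by (simp add: transposed_def)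
    then have "total_dim (take j (transposed k Xs)) + tuple_dim (take i (transposed k Xs ! j)) =
      (\<Sum>j'<j. \<Sum>i'<n. a i' j') + (\<Sum>i'<i. a i' j)"
      using ij len by (simp add: total_dim_sum tuple_dim_sum a_def nth_transposed)
    also have "\<dots> = (\<Sum>q\<in>{..<k} \<times> {..<n}. of_bool (fst q < j \<or> fst q = j \<and> snd q < i) * a (snd q) (fst q))"
      by (rule sum_below_lexicographic[OF ij(2,1)])
    also have "\<dots> = (\<Sum>q\<in>?I. of_bool (snd q < j \<or> snd q = j \<and> fst q < i) * a (fst q) (snd q))"
      by (rule sum.reindex_bij_witness[of _ prod.swap prod.swap]) auto
    finally show ?thesis .
  qed
  ultimately have eq: "total_dim (take j (transposed k Xs)) + tuple_dim (take i (transposed k Xs ! j)) +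
      (inversions n k a + (inversions n k a' + (total_dim (take i Xs) + tuple_dim (take j (Xs ! i))))) =
    2 * inversions n k a' + (\<Sum>q\<in>?I. (of_bool (snd q < j \<or> snd q = j \<and> fst q < i) +
      (of_bool (i < fst q \<and> snd q < j) + of_bool (fst q < i \<and> j < snd q)) +
      of_bool (fst q < i \<or> fst q = i \<and> snd q < j)) * a (fst q) (snd q))"
    by (simp add: distrib_right sum.distrib)
  have even: "even (\<Sum>q\<in>?I. (of_bool (snd q < j \<or> snd q = j \<and> fst q < i) +
      (of_bool (i < fst q \<and> snd q < j) + of_bool (fst q < i \<and> j < snd q)) +
      of_bool (fst q < i \<or> fst q = i \<and> snd q < j)) * a (fst q) (snd q))"
    by (rule dvd_sum) (auto simp: of_bool_def)
  have "even (total_dim (take j (transposed k Xs)) + tuple_dim (take i (transposed k Xs ! j)) +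
      (inversions n k a + (inversions n k a' + (total_dim (take i Xs) + tuple_dim (take j (Xs ! i))))))"
    unfolding eq by (rule dvd_add[OF dvd_triv_left even])
  then have "(- 1 :: real) ^ (total_dim (take j (transposed k Xs)) + tuple_dim (take i (transposed k Xs ! j))) =
      (- 1) ^ (inversions n k a + (inversions n k a' + (total_dim (take i Xs) + tuple_dim (take j (Xs ! i)))))"
    by (metis even_add minus_one_power_iff)
  then show ?thesis unfolding transposition_sign_def power_add a_def[abs_def] a'_def[abs_def] .
qed

text \<open>The exterior derivative written out over the positions of the matrix; in this form transposition just
  exchanges the two outer sums.\<close>

lemma product_deriv_rectangular:
  assumes "rectangular n k Xs"
  shows "product_deriv s F Xs = (\<Sum>i<n. \<Sum>j<k. (- 1) ^ (total_dim (take i Xs) + tuple_dim (take j (Xs ! i))) *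
    (\<Sum>v | v \<in> Xs ! i ! j \<and> Xs ! i ! j \<noteq> {v}. incidence s (Xs ! i ! j) v *
      F (Xs[i := (Xs ! i)[j := Xs ! i ! j - {v}]])))"
  using assms by (simp add: product_deriv_flat interaction_deriv_def rectangular_def sum_distrib_left power_add mult.assoc)

lemma product_deriv_transposed:
  assumes Xs: "rectangular n k Xs" "all_simplices Xs"
  shows "product_deriv s F (transposed k Xs) =
    transposition_sign n k Xs * product_deriv s (\<lambda>Ys. transposition_sign n k Ys * F (transposed k Ys)) Xs"
proof -
  have len: "length Xs = n" using Xs by (simp add: rectangular_def)
  have "(- 1) ^ (total_dim (take j (transposed k Xs)) + tuple_dim (take i (transposed k Xs ! j))) *
      (\<Sum>v | v \<in> transposed k Xs ! j ! i \<and> transposed k Xs ! j ! i \<noteq> {v}. incidence s (transposed k Xs ! j ! i) v *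
        F ((transposed k Xs)[j := (transposed k Xs ! j)[i := transposed k Xs ! j ! i - {v}]])) =
      transposition_sign n k Xs * ((- 1) ^ (total_dim (take i Xs) + tuple_dim (take j (Xs ! i))) *
      (\<Sum>v | v \<in> Xs ! i ! j \<and> Xs ! i ! j \<noteq> {v}. incidence s (Xs ! i ! j) v *
      (transposition_sign n k (Xs[i := (Xs ! i)[j := Xs ! i ! j - {v}]]) *
       F (transposed k (Xs[i := (Xs ! i)[j := Xs ! i ! j - {v}]])))))" (is "?sg * ?lhs = ?rhs")
    if i: "i < n" and j: "j < k" for i j
  proof -
    have fin: "finite (Xs ! i ! j)"
      using i j Xs(1) len simplices_nth[OF all_simplices_nth[OF Xs(2)], of i j] by (simp add: rectangular_def)
    have sg: "?sg = transposition_sign n k Xs * (transposition_sign n k (Xs[i := (Xs ! i)[j := Xs ! i ! j - {v}]]) *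
        (- 1) ^ (total_dim (take i Xs) + tuple_dim (take j (Xs ! i))))" if "v \<in> Xs ! i ! j" "Xs ! i ! j \<noteq> {v}" for v
      using card_face[OF fin that] by (intro transposition_sign_face[OF Xs(1) i j])
    have "?sg * ?lhs = (\<Sum>v | v \<in> Xs ! i ! j \<and> Xs ! i ! j \<noteq> {v}. ?sg * (incidence s (Xs ! i ! j) v *
       F (transposed k (Xs[i := (Xs ! i)[j := Xs ! i ! j - {v}]]))))"
      using i j len by (simp add: sum_distrib_left nth_transposed transposed_update[OF Xs(1)])
    also have "\<dots> = ?rhs"
      unfolding sum_distrib_left
    proof (rule sum.cong[OF HOL.refl])
      fix v assume "v \<in> {v. v \<in> Xs ! i ! j \<and> Xs ! i ! j \<noteq> {v}}"
      then have v: "v \<in> Xs ! i ! j" "Xs ! i ! j \<noteq> {v}" by auto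
      show "?sg * (incidence s (Xs ! i ! j) v * F (transposed k (Xs[i := (Xs ! i)[j := Xs ! i ! j - {v}]]))) =
        transposition_sign n k Xs * ((- 1) ^ (total_dim (take i Xs) + tuple_dim (take j (Xs ! i))) *
         (incidence s (Xs ! i ! j) v * (transposition_sign n k (Xs[i := (Xs ! i)[j := Xs ! i ! j - {v}]]) *
            F (transposed k (Xs[i := (Xs ! i)[j := Xs ! i ! j - {v}]])))))"
        unfolding sg[OF v] by (simp only: mult_ac)
    qed
    finally show ?thesis .
  qed
  then show ?thesis
    unfolding product_deriv_rectangular[OF Xs(1)] product_deriv_rectangular[OF rectangular_transposed[OF Xs(1)]]
    by (subst sum.swap) (simp add: sum_distrib_left)
qed

text \<open>A nonempty intersection of cells contains a cell of the product, so intersecting tuples of cells are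
  those with a common lower bound. This description refers only to the order of the cells.\<close>

definition cell_tuples :: "nat \<Rightarrow> 'a set list set \<Rightarrow> 'a set list list set" where
  "cell_tuples k P = {cs. length cs = k \<and> set cs \<subseteq> P \<and> (\<exists>b\<in>P. \<forall>c\<in>set cs. cell_le b c)}"

lemma product_tuples_rectangular: "Xs \<in> product_tuples k Gs \<Longrightarrow> rectangular (length Gs) k Xs"
  by (simp add: product_tuples_nth rectangular_def tuples_def)

lemma listset_nth: "c \<in> listset Gs \<longleftrightarrow> length c = length Gs \<and> (\<forall>i<length Gs. c ! i \<in> Gs ! i)"
  by (auto simp: listset_iff list_all2_conv_all_nth)

text \<open>Vertices \<open>v i\<close> common to the tuples in the factors give a common lower bound, the product of the points \<open>{v i}\<close>,
  which is a cell since \<open>k \<ge> 1\<close> supplies simplices containing these vertices. Conversely the components of a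
  common lower bound lie in all simplices of the respective factor.\<close>

lemma bij_betw_transposed:
  assumes k: "k \<ge> 1" and Gs: "product_complex Gs"
  shows "bij_betw (transposed k) (product_tuples k Gs) (cell_tuples k (listset Gs))"
proof (rule bij_betw_byWitness[where f' = "transposed (length Gs)"])
  let ?n = "length Gs"
  have sc: "simplicial_complex (Gs ! i)" if "i < ?n" for i using Gs that by (simp add: product_complex_def)
  note mem = listset_nth
  have rect: "rectangular k ?n cs" if "cs \<in> cell_tuples k (listset Gs)" for cs
    using that nth_mem[of _ cs] by (auto simp: rectangular_def cell_tuples_def mem subset_iff)
  show "\<forall>Xs\<in>product_tuples k Gs. transposed ?n (transposed k Xs) = Xs"
    using product_tuples_rectangular transposed_transposed by blast
  show "\<forall>cs\<in>cell_tuples k (listset Gs). transposed k (transposed ?n cs) = cs"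
    using rect transposed_transposed by blast
  show "transposed k ` product_tuples k Gs \<subseteq> cell_tuples k (listset Gs)"
  proof (rule image_subsetI)
    fix Xs assume X: "Xs \<in> product_tuples k Gs"
    have len: "length Xs = ?n" "\<And>i. i < ?n \<Longrightarrow> length (Xs ! i) = k"
      using product_tuples_rectangular[OF X] by (auto simp: rectangular_def)
    have XG: "Xs ! i ! j \<in> Gs ! i" if "i < ?n" "j < k" for i j
      using X len that nth_mem[of j "Xs ! i"] by (auto simp: product_tuples_nth tuples_def simp del: nth_mem)
    have "\<Inter>(set (Xs ! i)) \<noteq> {}" if "i < ?n" for i
      using X that by (simp add: product_tuples_nth tuples_def)
    then have "\<forall>i<?n. \<exists>v. v \<in> \<Inter>(set (Xs ! i))" by blast
    then obtain v where v: "\<And>i. i < ?n \<Longrightarrow> v i \<in> \<Inter>(set (Xs ! i))" by metis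
    then have v: "v i \<in> Xs ! i ! j" if "i < ?n" "j < k" for i j using that len by auto
    let ?b = "map (\<lambda>i. {v i}) [0..<?n]"
    have "{v i} \<in> Gs ! i" if "i < ?n" for i
      using simplicial_complex_face[OF sc[OF that] XG[OF that, of 0], of "{v i}"] v[OF that, of 0] k by simp
    then have "?b \<in> listset Gs" by (simp add: mem)
    moreover have "set (transposed k Xs) \<subseteq> listset Gs"
      using XG len by (auto simp: transposed_def mem)
    moreover have "\<forall>c\<in>set (transposed k Xs). cell_le ?b c"
      using v len by (auto simp: transposed_def list_all2_conv_all_nth)
    ultimately show "transposed k Xs \<in> cell_tuples k (listset Gs)"
      by (auto simp: cell_tuples_def)
  qed
  show "transposed ?n ` cell_tuples k (listset Gs) \<subseteq> product_tuples k Gs"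
  proof (rule image_subsetI)
    fix cs assume C: "cs \<in> cell_tuples k (listset Gs)"
    then obtain b where len: "length cs = k" and sub: "set cs \<subseteq> listset Gs" and b: "b \<in> listset Gs"
      "\<And>c. c \<in> set cs \<Longrightarrow> cell_le b c" by (auto simp: cell_tuples_def)
    show "transposed ?n cs \<in> product_tuples k Gs"
      unfolding product_tuples_nth
    proof (intro conjI allI impI)
      fix i assume i: "i < ?n"
      have "b ! i \<in> Gs ! i" using b(1) i by (simp add: mem)
      then obtain v where "v \<in> b ! i" using sc[OF i] by (auto simp: simplicial_complex_def)
      then have "v \<in> c ! i" if "c \<in> set cs" for c
        using b(2)[OF that] b(1) i by (auto simp: list_all2_conv_all_nth mem)
      moreover have "c ! i \<in> Gs ! i" if "c \<in> set cs" for c using sub that i by (auto simp: mem)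
      ultimately show "transposed ?n cs ! i \<in> tuples k (Gs ! i)"
        using i len by (auto simp: transposed_def tuples_def)
    qed simp
  qed
qed

theorem betti_cell_tuples:
  assumes k: "k \<ge> 1" and Gs: "product_complex Gs"
  shows "real (betti (\<lambda>_. 1) k Gs p) = trace_dim (cell_tuples k (listset Gs))
    (harmonic (cell_tuples k (listset Gs)) total_dim (deriv_kernel (\<lambda>_. 1)) p)"
  unfolding betti_harmonic[OF orientation_one Gs]
proof (rule trace_dim_isomorphic[symmetric, where \<tau> = "transposition_sign (length Gs) k"])
  let ?n = "length Gs"
  show "finite (product_tuples k Gs)" by (rule finite_product_tuples[OF Gs])
  show "bij_betw (transposed k) (product_tuples k Gs) (cell_tuples k (listset Gs))"
    by (rule bij_betw_transposed[OF k Gs])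
  show "transposition_sign ?n k Xs * transposition_sign ?n k Xs = 1" for Xs :: "'a set list list"
    by (simp add: transposition_sign_def flip: power_add)
  note rect = product_tuples_rectangular
  fix Xs assume X: "Xs \<in> product_tuples k Gs"
  have len: "length Xs = ?n" "\<And>i. i < ?n \<Longrightarrow> length (Xs ! i) = k"
    using rect[OF X] by (auto simp: rectangular_def)
  have "total_dim (transposed k Xs) = (\<Sum>j<k. \<Sum>i<?n. card (Xs ! i ! j) - 1)"
    using len by (simp add: total_dim_sum tuple_dim_sum transposed_def)
  also have "\<dots> = total_dim Xs"
    using len by (subst sum.swap) (simp add: total_dim_sum tuple_dim_sum)
  finally show "total_dim (transposed k Xs) = total_dim Xs" .
  fix Ys assume Y: "Ys \<in> product_tuples k Gs"
  note smp = product_tuples_simplices[OF Gs X]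
  have "product_deriv (\<lambda>_. 1) (\<lambda>Zs. transposition_sign ?n k Zs * of_bool (transposed k Zs = transposed k Ys)) Xs =
      product_deriv (\<lambda>_. 1) (\<lambda>Zs. transposition_sign ?n k Ys * of_bool (Zs = Ys)) Xs"
  proof (rule product_deriv_cong[OF smp])
    fix Zs assume "Zs \<in> product_faces Xs"
    then have "nested_le Zs Xs" using product_facesD[OF smp] by blast
    then have "rectangular ?n k Zs"
      using len by (auto simp: nested_le_def rectangular_def list_all2_conv_all_nth)
    then have "transposed k Zs = transposed k Ys \<longleftrightarrow> Zs = Ys"
      using transposed_transposed rect[OF Y] by metis
    then show "transposition_sign ?n k Zs * of_bool (transposed k Zs = transposed k Ys) =
        transposition_sign ?n k Ys * of_bool (Zs = Ys)" by auto
  qed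
  then show "deriv_kernel (\<lambda>_. 1) (transposed k Xs) (transposed k Ys) =
      transposition_sign ?n k Xs * transposition_sign ?n k Ys * deriv_kernel (\<lambda>_. 1) Xs Ys"
    by (simp add: deriv_kernel_def product_deriv_transposed[OF rect[OF X] smp] product_deriv_scale)
qed



section \<open>Incidence numbers are unique up to signs of the cells\<close>

text \<open>The signs \<open>\<tau>\<close> are built up by dimension, starting with 1 on the cells of dimension zero. Compatibility with a facet \<open>c'\<close>
  of \<open>c\<close> prescribes \<open>\<tau> c\<close> as the product \<open>r c c'\<close> of known signs, and the point is that all facets prescribe the
  same value. Two facets with a common facet agree by the diamond relation, the two ends of an edge agree
  by the edge relation, and in dimension at least two every pair of facets is linked by facets that have
  common facets.\<close>

theorem incidence_unique:
  fixes P :: "'c set" and facets :: "'c \<Rightarrow> 'c set" and dm :: "'c \<Rightarrow> nat" and \<eta> \<eta>' :: "'c \<Rightarrow> 'c \<Rightarrow> real"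
  assumes P: "\<And>c c'. c \<in> P \<Longrightarrow> c' \<in> facets c \<Longrightarrow> c' \<in> P"
    and dm: "\<And>c c'. c \<in> P \<Longrightarrow> c' \<in> facets c \<Longrightarrow> dm c = Suc (dm c')"
    and unit: "\<And>c c'. c \<in> P \<Longrightarrow> c' \<in> facets c \<Longrightarrow> \<eta> c c' * \<eta> c c' = 1 \<and> \<eta>' c c' * \<eta>' c c' = 1"
    and diamond: "\<And>c c1 c2 b. c \<in> P \<Longrightarrow> c1 \<in> facets c \<Longrightarrow> c2 \<in> facets c \<Longrightarrow> c1 \<noteq> c2 \<Longrightarrow>
        b \<in> facets c1 \<Longrightarrow> b \<in> facets c2 \<Longrightarrow>
        \<eta> c c1 * \<eta> c1 b = - (\<eta> c c2 * \<eta> c2 b) \<and> \<eta>' c c1 * \<eta>' c1 b = - (\<eta>' c c2 * \<eta>' c2 b)"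
    and edge: "\<And>c c1 c2. c \<in> P \<Longrightarrow> dm c = 1 \<Longrightarrow> c1 \<in> facets c \<Longrightarrow> c2 \<in> facets c \<Longrightarrow> c1 \<noteq> c2 \<Longrightarrow>
        \<eta> c c1 = - \<eta> c c2 \<and> \<eta>' c c1 = - \<eta>' c c2"
    and connected: "\<And>c c1 c2. c \<in> P \<Longrightarrow> dm c \<ge> 2 \<Longrightarrow> c1 \<in> facets c \<Longrightarrow> c2 \<in> facets c \<Longrightarrow> c1 \<noteq> c2 \<Longrightarrow>
        facets c1 \<inter> facets c2 \<noteq> {} \<or>
        (\<exists>c3\<in>facets c. c3 \<noteq> c1 \<and> c3 \<noteq> c2 \<and> facets c1 \<inter> facets c3 \<noteq> {} \<and> facets c3 \<inter> facets c2 \<noteq> {})"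
    and fin: "finite P"
  shows "\<exists>\<tau>. \<forall>c\<in>P. \<tau> c * \<tau> c = 1 \<and> (\<forall>c'\<in>facets c. \<eta>' c c' = \<tau> c * \<tau> c' * \<eta> c c')"
proof -
  have "\<exists>\<tau>. \<forall>c\<in>P. dm c \<le> N \<longrightarrow> (dm c = 0 \<longrightarrow> \<tau> c = 1) \<and> \<tau> c * \<tau> c = 1 \<and>
      (\<forall>c'\<in>facets c. \<eta>' c c' = \<tau> c * \<tau> c' * \<eta> c c')" for N
  proof (induction N)
    case 0
    have "facets c = {}" if "c \<in> P" "dm c = 0" for c using dm[OF that(1)] that(2) by fastforce
    then show ?case by (intro exI[of _ "\<lambda>_. 1"]) auto
  next
    case (Suc N)
    then obtain \<tau> where \<tau>: "\<And>c. c \<in> P \<Longrightarrow> dm c \<le> N \<Longrightarrow> dm c = 0 \<Longrightarrow> \<tau> c = 1"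
      "\<And>c. c \<in> P \<Longrightarrow> dm c \<le> N \<Longrightarrow> \<tau> c * \<tau> c = (1::real)"
      "\<And>c c'. c \<in> P \<Longrightarrow> dm c \<le> N \<Longrightarrow> c' \<in> facets c \<Longrightarrow> \<eta>' c c' = \<tau> c * \<tau> c' * \<eta> c c'"
      by metis
    define r where "r c c' = \<tau> c' * \<eta> c c' * \<eta>' c c'" for c c'
    have facet: "c' \<in> P" "dm c' = N" if "c \<in> P" "dm c = Suc N" "c' \<in> facets c" for c c'
      using P[OF that(1,3)] dm[OF that(1,3)] that(2) by simp_all
    have r_square: "r c c' * r c c' = 1" and r_eq: "\<eta>' c c' = r c c' * \<tau> c' * \<eta> c c'"
      if c: "c \<in> P" "dm c = Suc N" "c' \<in> facets c" for c c'
    proof -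
      have t: "\<tau> c' * \<tau> c' = 1" using facet[OF c] \<tau>(2) by simp
      note u = unit[OF c(1,3)]
      have "r c c' * r c c' = (\<tau> c' * \<tau> c') * (\<eta> c c' * \<eta> c c') * (\<eta>' c c' * \<eta>' c c')"
        by (simp add: r_def mult_ac)
      then show "r c c' * r c c' = 1" using t u by simp
      have "r c c' * \<tau> c' * \<eta> c c' = (\<tau> c' * \<tau> c') * (\<eta> c c' * \<eta> c c') * \<eta>' c c'"
        by (simp add: r_def mult_ac)
      then show "\<eta>' c c' = r c c' * \<tau> c' * \<eta> c c'" using t u by simp
    qed
    have adjacent: "r c c1 = r c c2"
      if c: "c \<in> P" "dm c = Suc N" and c12: "c1 \<in> facets c" "c2 \<in> facets c" "c1 \<noteq> c2"
        and ne: "facets c1 \<inter> facets c2 \<noteq> {}" for c c1 c2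
    proof -
      obtain b where b: "b \<in> facets c1" "b \<in> facets c2" using ne by blast
      note f1 = facet[OF c c12(1)] and f2 = facet[OF c c12(2)]
      note d = diamond[OF c(1) c12 b]
      let ?x = "\<tau> b * (\<eta> c c1 * \<eta> c1 b)"
      \<comment> \<open>Along a chain from \<open>c\<close> through \<open>c'\<close> to \<open>b\<close> the sign \<open>\<tau> c'\<close> cancels.\<close>
      have eq: "\<eta>' c c' * \<eta>' c' b = r c c' * (\<tau> b * (\<eta> c c' * \<eta> c' b))"
        if "c' \<in> facets c" "b \<in> facets c'" for c'
      proof -
        note f = facet[OF c that(1)]
        have "\<eta>' c c' * \<eta>' c' b = (r c c' * \<tau> c' * \<eta> c c') * (\<tau> c' * \<tau> b * \<eta> c' b)"
          using r_eq[OF c that(1)] \<tau>(3)[OF f(1) _ that(2)] f(2) by simp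
        also have "\<dots> = (\<tau> c' * \<tau> c') * (r c c' * (\<tau> b * (\<eta> c c' * \<eta> c' b)))" by (simp only: mult_ac)
        finally show ?thesis using \<tau>(2)[OF f(1)] f(2) by simp
      qed
      have "r c c1 * ?x = \<eta>' c c1 * \<eta>' c1 b" by (rule eq[OF c12(1) b(1), symmetric])
      also have "\<dots> = - (\<eta>' c c2 * \<eta>' c2 b)" by (rule conjunct2[OF d])
      also have "\<dots> = - (r c c2 * (\<tau> b * (\<eta> c c2 * \<eta> c2 b)))" by (simp only: eq[OF c12(2) b(2)])
      also have "\<dots> = r c c2 * ?x" unfolding conjunct1[OF d] by simp
      finally have "r c c1 * ?x = r c c2 * ?x" .
      moreover have "?x \<noteq> 0"
      proof -
        have "dm b \<le> N" "b \<in> P" using dm[OF f1(1) b(1)] f1 P[OF f1(1) b(1)] by auto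
        then have "\<tau> b \<noteq> 0" using \<tau>(2) by force
        moreover have "\<eta> c c1 \<noteq> 0" "\<eta> c1 b \<noteq> 0" using unit[OF c(1) c12(1)] unit[OF f1(1) b(1)] by auto
        ultimately show ?thesis by simp
      qed
      ultimately show ?thesis by simp
    qed
    have const: "r c c1 = r c c2" if c: "c \<in> P" "dm c = Suc N" and c12: "c1 \<in> facets c" "c2 \<in> facets c" for c c1 c2
    proof (cases "c1 = c2")
      case False
      show ?thesis
      proof (cases "N = 0")
        case True
        then have "\<tau> c1 = 1" "\<tau> c2 = 1" using \<tau>(1) facet[OF c] c12 by auto
        then show ?thesis using edge[OF c(1) _ c12 False] c(2) True by (simp add: r_def)
      next
        assume "N \<noteq> 0"
        then have "dm c \<ge> 2" using c by simp
        from connected[OF c(1) this c12 False] show ?thesis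
          using adjacent[OF c] c12 False by metis
      qed
    qed simp
    define \<tau>' where "\<tau>' c = (if dm c \<le> N then \<tau> c else if facets c = {} then 1 else r c (SOME c'. c' \<in> facets c))" for c
    show ?case
    proof (intro exI[of _ \<tau>'] ballI impI)
      fix c assume c: "c \<in> P" "dm c \<le> Suc N"
      have facet_eq: "\<tau>' c' = \<tau> c'" if "c' \<in> facets c" for c' using dm[OF c(1) that] c(2) by (simp add: \<tau>'_def)
      show "(dm c = 0 \<longrightarrow> \<tau>' c = 1) \<and> \<tau>' c * \<tau>' c = 1 \<and> (\<forall>c'\<in>facets c. \<eta>' c c' = \<tau>' c * \<tau>' c' * \<eta> c c')"
      proof (cases "dm c \<le> N")
        case True
        then have "\<tau>' c = \<tau> c" by (simp add: \<tau>'_def)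
        then show ?thesis using \<tau>[OF c(1) True] facet_eq by simp
      next
        case False
        then have N: "dm c = Suc N" using c by simp
        show ?thesis
        proof (cases "facets c = {}")
          case True
          then show ?thesis using False by (simp add: \<tau>'_def)
        next
          assume ne: "facets c \<noteq> {}"
          then have some: "(SOME c'. c' \<in> facets c) \<in> facets c" by (simp add: some_in_eq)
          have t: "\<tau>' c = r c c'" if "c' \<in> facets c" for c'
            using const[OF c(1) N some that] ne False by (simp add: \<tau>'_def)
          then show ?thesis using r_square[OF c(1) N] r_eq[OF c(1) N] facet_eq some N by (metis nat.distinct(1))
        qed
      qed
    qed
  qed
  from this[of "Max (dm ` P)"] show ?thesis using fin by (metis Max_ge finite_imageI imageI)
qed


section \<open>The cells of a product complex\<close>

text \<open>Recording the position together with each vertex turns the order of cells into inclusion and the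
  passage to a face into the removal of one element.\<close>

definition vertices :: "'a set list \<Rightarrow> (nat \<times> 'a) set" where
  "vertices c = {(i, v). i < length c \<and> v \<in> c ! i}"

definition cell_facets :: "'a set list \<Rightarrow> 'a set list set" where
  "cell_facets c = del c ` faces c"

definition cell_incidence :: "'a::linorder set list \<Rightarrow> 'a set list \<Rightarrow> real" where
  "cell_incidence c c' = interaction_deriv (\<lambda>_. 1) (\<lambda>Y. of_bool (Y = c')) c"

lemma vertices_del: "vertices (del c e) = vertices c - {e}"
  by (cases e) (auto simp: vertices_def nth_del split: if_splits)

lemma faces_vertices: "e \<in> faces c \<Longrightarrow> e \<in> vertices c"
  by (auto simp: faces_def vertices_def)

lemma vertices_le: "length c = length c' \<Longrightarrow> cell_le c c' \<longleftrightarrow> vertices c \<subseteq> vertices c'"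
  by (auto simp: vertices_def list_all2_conv_all_nth)

lemma vertices_eqD: "length c = length c' \<Longrightarrow> vertices c = vertices c' \<Longrightarrow> c = c'"
  by (intro cell_le_antisym) (simp_all add: vertices_le)

lemma del_inj:
  assumes "e \<in> faces c" "e' \<in> faces c" "del c e = del c e'"
  shows "e = e'"
proof -
  have "vertices c - {e} = vertices c - {e'}" using assms(3) vertices_del by metis
  then show ?thesis using faces_vertices[OF assms(1)] faces_vertices[OF assms(2)] by blast
qed

lemma cell_incidence_del:
  assumes "simplices c" "e \<in> faces c"
  shows "cell_incidence c (del c e) = face_sign (\<lambda>_. 1) c e"
proof -
  have "cell_incidence c (del c e) = (\<Sum>e'\<in>faces c. face_sign (\<lambda>_. 1) c e' * of_bool (del c e' = del c e))"
    by (simp add: cell_incidence_def interaction_deriv_faces[OF assms(1)])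
  also have "\<dots> = (\<Sum>e'\<in>faces c. if e' = e then face_sign (\<lambda>_. 1) c e' else 0)"
    using del_inj[OF _ assms(2)] by (intro sum.cong) auto
  also have "\<dots> = face_sign (\<lambda>_. 1) c e" by (simp add: faces_finite[OF assms(1)] assms(2))
  finally show ?thesis .
qed

lemma cell_incidence_nonzero:
  assumes "simplices c" "cell_incidence c c' \<noteq> 0"
  shows "c' \<in> cell_facets c"
proof (rule ccontr)
  assume "c' \<notin> cell_facets c"
  then have "cell_incidence c c' = 0"
    unfolding cell_incidence_def interaction_deriv_faces[OF assms(1)]
    by (intro sum.neutral) (auto simp: cell_facets_def)
  with assms(2) show False by simp
qed

lemma face_sign_square: "face_sign (\<lambda>_. 1) c e * face_sign (\<lambda>_. 1) c e = 1"
  by (simp add: face_sign_def incidence_def flip: power_add)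

text \<open>Removing one vertex can prevent the removal of another only if the two are the whole simplex.\<close>

lemma faces_of_face:
  assumes "(i, v) \<in> faces c" "(j, w) \<in> faces c" "(i, v) \<noteq> (j, w)"
  shows "(j, w) \<in> faces (del c (i, v)) \<or> i = j \<and> c ! i = {v, w}"
  using assms by (auto simp: faces_def nth_del)

text \<open>The cell \<open>b\<close> arises from \<open>c\<close> by removing the same two vertices along both chains, so the chains differ
  in the order of removal.\<close>

lemma cell_incidence_diamond:
  assumes c: "simplices c" and c12: "c1 \<in> cell_facets c" "c2 \<in> cell_facets c" "c1 \<noteq> c2"
    and b: "b \<in> cell_facets c1" "b \<in> cell_facets c2"
  shows "cell_incidence c c1 * cell_incidence c1 b = - (cell_incidence c c2 * cell_incidence c2 b)"
proof -
  obtain e1 e2 e1' e2' where e: "c1 = del c e1" "e1 \<in> faces c" "c2 = del c e2" "e2 \<in> faces c"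
    "b = del c1 e1'" "e1' \<in> faces c1" "b = del c2 e2'" "e2' \<in> faces c2"
    using c12(1,2) b unfolding cell_facets_def by (elim imageE)
  have "vertices c - {e1} - {e1'} = vertices c - {e2} - {e2'}"
    using e(1,3,5,7) vertices_del by metis
  moreover have "e1 \<noteq> e2" using c12(3) e by auto
  ultimately have "e1' = e2" "e2' = e1"
    using faces_vertices[OF e(2)] faces_vertices[OF e(4)] by blast+
  then show ?thesis
    using diamond(4)[OF orientation_one c e(2), of e2] e cell_incidence_del simplices_del[OF c] c by metis
qed

lemma tuple_dim_other_simplex:
  assumes "simplices c" "i < length c" "card (c ! i) = 2" "tuple_dim c \<ge> 2"
  obtains j where "j < length c" "j \<noteq> i" "card (c ! j) - 1 \<noteq> 0"
proof -
  have "tuple_dim c = card (c ! i) - 1 + (\<Sum>j\<in>{..<length c} - {i}. card (c ! j) - 1)"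
    using assms(2) by (simp add: tuple_dim_sum sum.remove[of _ i])
  then have "(\<Sum>j\<in>{..<length c} - {i}. card (c ! j) - 1) \<noteq> 0" using assms(3,4) by linarith
  then obtain j where "j \<in> {..<length c} - {i}" "card (c ! j) - 1 \<noteq> 0" by (rule sum.not_neutral_contains_not_neutral)
  then show ?thesis using that by auto
qed

text \<open>Two facets have a common facet unless they remove the two ends of a one-dimensional simplex. In that
  case dimension at least two provides another simplex that is not a point, and removing one of its
  vertices gives a facet adjacent to both.\<close>

lemma cell_facets_connected:
  fixes c :: "'a::linorder set list"
  assumes c: "simplices c" and dim: "tuple_dim c \<ge> 2"
    and c12: "c1 \<in> cell_facets c" "c2 \<in> cell_facets c" "c1 \<noteq> c2"
  shows "cell_facets c1 \<inter> cell_facets c2 \<noteq> {} \<or> (\<exists>c3\<in>cell_facets c. c3 \<noteq> c1 \<and> c3 \<noteq> c2 \<and>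
      cell_facets c1 \<inter> cell_facets c3 \<noteq> {} \<and> cell_facets c3 \<inter> cell_facets c2 \<noteq> {})"
proof -
  have common: "cell_facets (del c e) \<inter> cell_facets (del c e') \<noteq> {}"
    if e: "e \<in> faces c" "e' \<in> faces (del c e)" for e e'
  proof -
    have "del (del c e) e' \<in> cell_facets (del c e)" using e by (simp add: cell_facets_def)
    moreover have "del (del c e) e' \<in> cell_facets (del c e')"
      using diamond(2,3)[OF orientation_one c e] by (simp add: cell_facets_def)
    ultimately show ?thesis by blast
  qed
  obtain i v j w where e: "c1 = del c (i, v)" "(i, v) \<in> faces c" "c2 = del c (j, w)" "(j, w) \<in> faces c"
    using c12 by (auto simp: cell_facets_def)
  then have "(i, v) \<noteq> (j, w)" using c12(3) by auto
  from faces_of_face[OF e(2,4) this] show ?thesis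
  proof
    assume "(j, w) \<in> faces (del c (i, v))"
    then show ?thesis using common[OF e(2)] e by blast
  next
    assume eq: "i = j \<and> c ! i = {v, w}"
    then have "v \<noteq> w" using \<open>(i, v) \<noteq> (j, w)\<close> by auto
    then have "card (c ! i) = 2" unfolding conjunct2[OF eq] by simp
    then obtain l where l: "l < length c" "l \<noteq> i" "card (c ! l) - 1 \<noteq> 0"
      using tuple_dim_other_simplex[OF c facesD(1)[OF e(2)] _ dim] by blast
    obtain u where "u \<in> c ! l" using simplices_nth[OF c l(1)] by blast
    moreover have "c ! l \<noteq> {u}" using l(3) by auto
    ultimately have u: "(l, u) \<in> faces c" using l by (simp add: faces_def)
    have "(l, u) \<in> faces (del c (i, v))" "(j, w) \<in> faces (del c (l, u))"
      using faces_of_face[OF e(2) u] faces_of_face[OF u e(4)] l(2) eq by auto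
    then have "cell_facets c1 \<inter> cell_facets (del c (l, u)) \<noteq> {}" "cell_facets (del c (l, u)) \<inter> cell_facets c2 \<noteq> {}"
      using common[OF e(2)] common[OF u] e by blast+
    moreover have "del c (l, u) \<in> cell_facets c" using u by (simp add: cell_facets_def)
    moreover have "del c (l, u) \<noteq> c1" "del c (l, u) \<noteq> c2"
      using del_inj[OF u e(2)] del_inj[OF u e(4)] l(2) eq e by auto
    ultimately show ?thesis by blast
  qed
qed

text \<open>A cell of dimension one is a single edge times points, and its two facets are the ends of the edge.\<close>

lemma cell_incidence_edge:
  assumes c: "simplices c" and dim: "tuple_dim c = 1"
    and c12: "c1 \<in> cell_facets c" "c2 \<in> cell_facets c" "c1 \<noteq> c2"
  shows "cell_incidence c c1 = - cell_incidence c c2"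
proof -
  obtain i v j w where e: "c1 = del c (i, v)" "(i, v) \<in> faces c" "c2 = del c (j, w)" "(j, w) \<in> faces c"
    using c12 by (auto simp: cell_facets_def)
  then have ne: "(i, v) \<noteq> (j, w)" using c12(3) by auto
  have "(j, w) \<notin> faces (del c (i, v))"
    using tuple_dim_del[OF simplices_del[OF c e(2)], of "(j, w)"] tuple_dim_del[OF c e(2)] dim by auto
  then have eq: "i = j" "c ! i = {v, w}" using faces_of_face[OF e(2,4) ne] by auto
  then have "v \<noteq> w" using ne by auto
  then have "{u \<in> {v, w}. u < v} = (if w < v then {w} else {})" "{u \<in> {v, w}. u < w} = (if w < v then {} else {v})"
    by auto
  then have "incidence (\<lambda>_. 1) (c ! i) v = - incidence (\<lambda>_. 1) (c ! i) w"
    using eq(2) by (auto simp: incidence_def)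
  then show ?thesis
    unfolding e(1,3) cell_incidence_del[OF c e(2)] cell_incidence_del[OF c e(4)]
    using eq(1) by (simp add: face_sign_def)
qed



lemma listset_simplices:
  assumes "product_complex Gs" "c \<in> listset Gs"
  shows "simplices c"
proof -
  have "finite (c ! i) \<and> c ! i \<noteq> {}" if "i < length Gs" for i
  proof -
    have "simplicial_complex (Gs ! i)" "c ! i \<in> Gs ! i"
      using assms that by (simp_all add: listset_nth product_complex_def)
    then show ?thesis unfolding simplicial_complex_def by blast
  qed
  then show ?thesis using assms(2) by (auto simp: simplices_def in_set_conv_nth listset_nth)
qed

lemma listset_face_closed:
  assumes Gs: "product_complex Gs" and c: "c \<in> listset Gs" and le: "cell_le c' c" and ne: "{} \<notin> set c'"
  shows "c' \<in> listset Gs"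
proof -
  have len: "length c' = length Gs" "length c = length Gs"
    using c le by (auto simp: listset_nth dest: list_all2_lengthD)
  have "c' ! i \<in> Gs ! i" if i: "i < length Gs" for i
  proof (rule simplicial_complex_face)
    show "simplicial_complex (Gs ! i)" using Gs i by (simp add: product_complex_def)
    show "c ! i \<in> Gs ! i" using c i by (simp add: listset_nth)
    show "c' ! i \<subseteq> c ! i" using le i len by (simp add: list_all2_conv_all_nth)
    show "c' ! i \<noteq> {}" using ne i len by (metis nth_mem)
  qed
  then show ?thesis using len by (simp add: listset_nth)
qed

lemma cell_facets_closed:
  assumes Gs: "product_complex Gs" and c: "c \<in> listset Gs" and c': "c' \<in> cell_facets c"
  shows "c' \<in> listset Gs"
proof (rule listset_face_closed[OF Gs c])
  show "cell_le c' c" using c' by (auto simp: cell_facets_def cell_le_del)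
  show "{} \<notin> set c'"
    using c' simplices_del[OF listset_simplices[OF Gs c]] by (auto simp: cell_facets_def simplices_def)
qed

text \<open>Facets are recognizable from the order alone, as the cells covered by \<open>c\<close>. A cell strictly below \<open>c\<close>
  misses a vertex of \<open>c\<close> and is therefore below the facet that removes this vertex.\<close>

lemma cell_facets_cover:
  assumes Gs: "product_complex Gs" and c: "c \<in> listset Gs" and c': "c' \<in> listset Gs"
  shows "c' \<in> cell_facets c \<longleftrightarrow> cell_le c' c \<and> c' \<noteq> c \<and>
    (\<forall>m\<in>listset Gs. cell_le c' m \<and> cell_le m c \<longrightarrow> m = c' \<or> m = c)"
proof -
  have len: "length m = length Gs" if "m \<in> listset Gs" for m using that by (simp add: listset_nth)
  have le: "cell_le m m' \<longleftrightarrow> vertices m \<subseteq> vertices m'" if "m \<in> listset Gs" "m' \<in> listset Gs" for m m'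
    using len that by (intro vertices_le) simp
  have eq: "m = m'" if "m \<in> listset Gs" "m' \<in> listset Gs" "vertices m = vertices m'" for m m'
    using len that by (intro vertices_eqD) simp_all
  show ?thesis
  proof
    assume "c' \<in> cell_facets c"
    then obtain e where e: "c' = del c e" "e \<in> faces c" unfolding cell_facets_def by (elim imageE)
    have V: "vertices c' = vertices c - {e}" "e \<in> vertices c"
      using e faces_vertices by (simp_all add: vertices_del)
    have "m = c' \<or> m = c" if m: "m \<in> listset Gs" "cell_le c' m" "cell_le m c" for m
    proof -
      have "vertices m = vertices c' \<or> vertices m = vertices c"
        using m le[OF c' m(1)] le[OF m(1) c] V by blast
      then show ?thesis using eq m(1) c c' by blast
    qed
    then show "cell_le c' c \<and> c' \<noteq> c \<and> (\<forall>m\<in>listset Gs. cell_le c' m \<and> cell_le m c \<longrightarrow> m = c' \<or> m = c)"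
      using le[OF c' c] V by auto
  next
    assume cover: "cell_le c' c \<and> c' \<noteq> c \<and> (\<forall>m\<in>listset Gs. cell_le c' m \<and> cell_le m c \<longrightarrow> m = c' \<or> m = c)"
    then obtain i v where iv: "(i, v) \<in> vertices c" "(i, v) \<notin> vertices c'"
      using le[OF c' c] eq[OF c' c] by fastforce
    then have i: "i < length c" "v \<in> c ! i" "v \<notin> c' ! i"
      using len[OF c] len[OF c'] by (auto simp: vertices_def)
    have "c' ! i \<subseteq> c ! i" using cover i(1) by (auto simp: list_all2_conv_all_nth)
    moreover have "c' ! i \<noteq> {}"
      using simplices_nth[OF listset_simplices[OF Gs c'], of i] i len[OF c] len[OF c'] by simp
    ultimately have f: "(i, v) \<in> faces c" using i by (auto simp: faces_def)
    then have m: "del c (i, v) \<in> listset Gs"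
      using cell_facets_closed[OF Gs c] by (simp add: cell_facets_def)
    have "vertices c' \<subseteq> vertices (del c (i, v))"
      using cover le[OF c' c] iv by (auto simp: vertices_del)
    then have "cell_le c' (del c (i, v))" using le[OF c' m] by simp
    moreover have "del c (i, v) \<noteq> c"
    proof
      assume "del c (i, v) = c"
      then have "vertices c - {(i, v)} = vertices c" using vertices_del[of c "(i, v)"] by simp
      with iv(1) show False by blast
    qed
    moreover note cell_le_del[of c "(i, v)"]
    ultimately have "del c (i, v) = c'" using conjunct2[OF conjunct2[OF cover]] m by blast
    then show "c' \<in> cell_facets c" using f by (auto simp: cell_facets_def)
  qed
qed

lemma tuple_dim_zero_iff:
  assumes "simplices c"
  shows "tuple_dim c = 0 \<longleftrightarrow> cell_facets c = {}"
proof
  assume "tuple_dim c = 0"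
  then show "cell_facets c = {}" using tuple_dim_del[OF assms] by (auto simp: cell_facets_def)
next
  assume "cell_facets c = {}"
  then have none: "faces c = {}" by (simp add: cell_facets_def)
  have "card (c ! i) - 1 = 0" if i: "i < length c" for i
  proof -
    obtain v where v: "v \<in> c ! i" using simplices_nth[OF assms i] by blast
    then have "c ! i = {v}" using none i by (auto simp: faces_def)
    then show ?thesis by simp
  qed
  then show "tuple_dim c = 0" by (simp add: tuple_dim_sum)
qed

lemma cell_facets_dim:
  "simplices c \<Longrightarrow> c' \<in> cell_facets c \<Longrightarrow> tuple_dim c = Suc (tuple_dim c')"
  unfolding cell_facets_def by (elim imageE) (simp only: tuple_dim_del)

section \<open>Invariance under isomorphism\<close>

text \<open>On tuples of cells the derivative is expressed by the incidence numbers of the cells; a summand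
  survives only at a position outside of which the two tuples agree.\<close>

lemma deriv_kernel_cells:
  assumes "length cs = length cs'"
  shows "deriv_kernel (\<lambda>_. 1) cs cs' = (\<Sum>j<length cs. (- 1) ^ total_dim (take j cs) *
    (of_bool (cs' = cs[j := cs' ! j]) * cell_incidence (cs ! j) (cs' ! j)))"
  unfolding deriv_kernel_def product_deriv_flat
proof (rule sum.cong[OF HOL.refl])
  fix j assume j: "j \<in> {..<length cs}"
  have "cs[j := Y] = cs' \<longleftrightarrow> cs' = cs[j := cs' ! j] \<and> Y = cs' ! j" for Y
  proof
    assume eq: "cs[j := Y] = cs'"
    have "cs' ! j = Y" using j by (simp add: eq[symmetric])
    with eq show "cs' = cs[j := cs' ! j] \<and> Y = cs' ! j" by simp
  qed metis
  then have "(\<lambda>Y. of_bool (cs[j := Y] = cs')) = (\<lambda>Y. of_bool (cs' = cs[j := cs' ! j]) * (of_bool (Y = cs' ! j) :: real))"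
    by (auto simp: fun_eq_iff)
  then show "(- 1) ^ total_dim (take j cs) * interaction_deriv (\<lambda>_. 1) (\<lambda>Y. of_bool (cs[j := Y] = cs')) (cs ! j) =
    (- 1) ^ total_dim (take j cs) * (of_bool (cs' = cs[j := cs' ! j]) * cell_incidence (cs ! j) (cs' ! j))"
    by (simp only: interaction_deriv_scale cell_incidence_def)
qed

text \<open>An order isomorphism preserves facets, hence dimensions, hence tuples with a common lower bound, and by
  \<open>incidence_unique\<close> it preserves incidence numbers up to a sign for every cell. The product of these signs
  over a tuple is the change of sign required by \<open>trace_dim_isomorphic\<close>.\<close>

theorem betti_isomorphic:
  assumes k: "k \<ge> 1" and Gs: "product_complex Gs" and Hs: "product_complex Hs" and iso: "complex_iso Gs Hs"
  shows "betti (\<lambda>_. 1) k Gs p = betti (\<lambda>_. 1) k Hs p"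
proof -
  let ?P = "listset Gs" and ?Q = "listset Hs"
  obtain f where f: "bij_betw f ?P ?Q"
    and le: "\<And>c c'. c \<in> ?P \<Longrightarrow> c' \<in> ?P \<Longrightarrow> cell_le c c' \<longleftrightarrow> cell_le (f c) (f c')"
    using complex_isoE[OF Gs Hs iso] by blast
  have fQ: "f c \<in> ?Q" if "c \<in> ?P" for c using bij_betwE[OF f] that by blast
  have f_inj: "f c = f c' \<longleftrightarrow> c = c'" if "c \<in> ?P" "c' \<in> ?P" for c c'
    using inj_on_eq_iff[OF bij_betw_imp_inj_on[OF f] that] .
  have f_surj: "?Q = f ` ?P" using f by (simp add: bij_betw_def)
  note smp = listset_simplices[OF Gs] and smp' = listset_simplices[OF Hs]
  have facets: "c' \<in> cell_facets c \<longleftrightarrow> f c' \<in> cell_facets (f c)" if c: "c \<in> ?P" "c' \<in> ?P" for c c'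
  proof -
    have "(\<forall>m\<in>?Q. cell_le (f c') m \<and> cell_le m (f c) \<longrightarrow> m = f c' \<or> m = f c) \<longleftrightarrow>
      (\<forall>m\<in>?P. cell_le c' m \<and> cell_le m c \<longrightarrow> m = c' \<or> m = c)"
      unfolding f_surj using le f_inj c by simp
    then show ?thesis
      unfolding cell_facets_cover[OF Gs c] cell_facets_cover[OF Hs fQ[OF c(1)] fQ[OF c(2)]]
      using le[OF c(2,1)] f_inj[OF c(2,1)] by simp
  qed
  have dim: "tuple_dim (f c) = tuple_dim c" if "c \<in> ?P" for c
    using that
  proof (induction "tuple_dim c" arbitrary: c)
    case 0
    have "cell_facets c = {}" using tuple_dim_zero_iff[OF smp[OF 0(2)]] 0(1) by simp
    moreover have "\<exists>c'\<in>?P. d = f c' \<and> c' \<in> cell_facets c" if d: "d \<in> cell_facets (f c)" for d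
      using cell_facets_closed[OF Hs fQ[OF 0(2)] d] facets[OF 0(2)] d unfolding f_surj by blast
    ultimately have "cell_facets (f c) = {}" by blast
    then show ?case using tuple_dim_zero_iff[OF smp'[OF fQ[OF 0(2)]]] 0(1) by simp
  next
    case (Suc N)
    have "cell_facets c \<noteq> {}" using tuple_dim_zero_iff[OF smp[OF Suc.prems]] Suc.hyps(2) by simp
    then obtain c' where c': "c' \<in> cell_facets c" by blast
    have P: "c' \<in> ?P" by (rule cell_facets_closed[OF Gs Suc.prems c'])
    have "tuple_dim c = Suc (tuple_dim c')" by (rule cell_facets_dim[OF smp[OF Suc.prems] c'])
    moreover have "tuple_dim (f c) = Suc (tuple_dim (f c'))"
      using facets[OF Suc.prems P] c' by (intro cell_facets_dim smp' fQ Suc.prems) simp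
    moreover have "tuple_dim (f c') = tuple_dim c'" using Suc.hyps calculation(1) P by simp
    ultimately show ?case by simp
  qed
  have fin: "finite ?P"
    using Gs by (intro finite_listset) (simp add: product_complex_def simplicial_complex_def)
  have unit: "cell_incidence c c' * cell_incidence c c' = 1" if "simplices c" "c' \<in> cell_facets c" for c c' :: "'a set list"
    using that cell_incidence_del face_sign_square unfolding cell_facets_def by fastforce
  have "\<exists>\<tau>. \<forall>c\<in>?P. \<tau> c * \<tau> c = 1 \<and>
      (\<forall>c'\<in>cell_facets c. cell_incidence (f c) (f c') = \<tau> c * \<tau> c' * cell_incidence c c')"
  proof (rule incidence_unique[where dm = tuple_dim])
    fix c assume c: "c \<in> ?P"
    show "c' \<in> ?P" if "c' \<in> cell_facets c" for c' by (rule cell_facets_closed[OF Gs c that])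
    then have fc: "f c' \<in> cell_facets (f c)" if "c' \<in> cell_facets c" for c' using facets[OF c] that by blast
    note P = cell_facets_closed[OF Gs c]
    show "tuple_dim c = Suc (tuple_dim c')" if "c' \<in> cell_facets c" for c'
      by (rule cell_facets_dim[OF smp[OF c] that])
    show "cell_incidence c c' * cell_incidence c c' = 1 \<and> cell_incidence (f c) (f c') * cell_incidence (f c) (f c') = 1"
      if "c' \<in> cell_facets c" for c'
      using unit[OF smp[OF c] that] unit[OF smp'[OF fQ[OF c]] fc[OF that]] by blast
    fix c1 c2 assume c12: "c1 \<in> cell_facets c" "c2 \<in> cell_facets c" "c1 \<noteq> c2"
    have f12: "f c1 \<noteq> f c2" using f_inj[OF P[OF c12(1)] P[OF c12(2)]] c12(3) by simp
    show "cell_incidence c c1 * cell_incidence c1 b = - (cell_incidence c c2 * cell_incidence c2 b) \<and>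
        cell_incidence (f c) (f c1) * cell_incidence (f c1) (f b) = - (cell_incidence (f c) (f c2) * cell_incidence (f c2) (f b))"
      if b: "b \<in> cell_facets c1" "b \<in> cell_facets c2" for b
    proof -
      have "b \<in> ?P" by (rule cell_facets_closed[OF Gs P[OF c12(1)] b(1)])
      then have "f b \<in> cell_facets (f c1)" "f b \<in> cell_facets (f c2)"
        using facets[OF P[OF c12(1)]] facets[OF P[OF c12(2)]] b by blast+
      then show ?thesis
        using cell_incidence_diamond[OF smp[OF c] c12 b]
          cell_incidence_diamond[OF smp'[OF fQ[OF c]] fc[OF c12(1)] fc[OF c12(2)] f12] by blast
    qed
    show "cell_incidence c c1 = - cell_incidence c c2 \<and> cell_incidence (f c) (f c1) = - cell_incidence (f c) (f c2)"
      if "tuple_dim c = 1"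
      using cell_incidence_edge[OF smp[OF c] that c12]
        cell_incidence_edge[OF smp'[OF fQ[OF c]] _ fc[OF c12(1)] fc[OF c12(2)] f12] dim[OF c] that by simp
    show "cell_facets c1 \<inter> cell_facets c2 \<noteq> {} \<or> (\<exists>c3\<in>cell_facets c. c3 \<noteq> c1 \<and> c3 \<noteq> c2 \<and>
      cell_facets c1 \<inter> cell_facets c3 \<noteq> {} \<and> cell_facets c3 \<inter> cell_facets c2 \<noteq> {})" if "2 \<le> tuple_dim c"
      by (rule cell_facets_connected[OF smp[OF c] that c12])
  qed (rule fin)
  then obtain \<tau> where \<tau>: "\<And>c. c \<in> ?P \<Longrightarrow> \<tau> c * \<tau> c = (1::real)"
    "\<And>c c'. c \<in> ?P \<Longrightarrow> c' \<in> cell_facets c \<Longrightarrow> cell_incidence (f c) (f c') = \<tau> c * \<tau> c' * cell_incidence c c'"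
    by blast
  have incidence: "cell_incidence (f c) (f c') = \<tau> c * \<tau> c' * cell_incidence c c'" if c: "c \<in> ?P" "c' \<in> ?P" for c c'
  proof (cases "c' \<in> cell_facets c")
    case False
    then have "cell_incidence c c' = 0" "cell_incidence (f c) (f c') = 0"
      using cell_incidence_nonzero[OF smp[OF c(1)], of c'] cell_incidence_nonzero[OF smp'[OF fQ[OF c(1)]], of "f c'"]
        facets[OF c] by blast+
    then show ?thesis by simp
  qed (rule \<tau>(2)[OF c(1)])
  let ?S = "cell_tuples k ?P" and ?T = "cell_tuples k ?Q"
  define \<Sigma> where "\<Sigma> cs = (\<Prod>j<length cs. \<tau> (cs ! j))" for cs
  have S: "length cs = k" "\<And>j. j < k \<Longrightarrow> cs ! j \<in> ?P" if "cs \<in> ?S" for cs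
    using that nth_mem[of _ cs] by (auto simp: cell_tuples_def)
  have "trace_dim ?T (harmonic ?T total_dim (deriv_kernel (\<lambda>_. 1)) p) =
    trace_dim ?S (harmonic ?S total_dim (deriv_kernel (\<lambda>_. 1)) p)"
  proof (rule trace_dim_isomorphic[where \<phi> = "map f" and \<tau> = \<Sigma>])
    show "finite ?S"
      by (rule finite_subset[OF _ finite_lists_length_eq[OF fin, of k]]) (auto simp: cell_tuples_def)
    have bound: "(\<exists>b\<in>?P. \<forall>c\<in>set cs. cell_le b c) \<longleftrightarrow> (\<exists>b\<in>?Q. \<forall>c\<in>set (map f cs). cell_le b c)"
      if "set cs \<subseteq> ?P" for cs
      unfolding f_surj using le that by (auto simp: subset_iff)
    show "bij_betw (map f) ?S ?T"
      unfolding bij_betw_def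
    proof (intro conjI equalityI subsetI)
      have "inj_on (map f) (lists ?P)" by (rule inj_on_mapI) (use f in \<open>auto simp: bij_betw_def intro: inj_on_subset\<close>)
      then show "inj_on (map f) ?S" by (rule inj_on_subset) (auto simp: cell_tuples_def)
      show "ds \<in> ?T" if "ds \<in> map f ` ?S" for ds
        using that bound fQ by (fastforce simp: cell_tuples_def)
      fix ds assume ds: "ds \<in> ?T"
      then have sub: "set ds \<subseteq> f ` ?P" by (simp add: cell_tuples_def f_surj)
      define cs where "cs = map (inv_into ?P f) ds"
      have cs: "ds = map f cs" "set cs \<subseteq> ?P"
        using sub by (auto simp: cs_def comp_def f_inv_into_f subset_iff inv_into_into intro!: map_idI[symmetric])
      then have "cs \<in> ?S" using ds bound[OF cs(2)] by (simp add: cell_tuples_def)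
      then show "ds \<in> map f ` ?S" using cs by blast
    qed
    fix cs assume cs: "cs \<in> ?S"
    note c = S[OF cs]
    show "\<Sigma> cs * \<Sigma> cs = 1"
      using c \<tau>(1) by (simp add: \<Sigma>_def flip: prod.distrib)
    show "total_dim (map f cs) = total_dim cs"
      using c dim by (simp add: total_dim_sum)
    have take: "total_dim (take j (map f cs)) = total_dim (take j cs)" if "j < k" for j
      using c dim that by (simp add: total_dim_sum)
    fix cs' assume cs': "cs' \<in> ?S"
    note c' = S[OF cs']
    have step: "of_bool (map f cs' = (map f cs)[j := map f cs' ! j]) * cell_incidence (map f cs ! j) (map f cs' ! j) =
      \<Sigma> cs * \<Sigma> cs' * (of_bool (cs' = cs[j := cs' ! j]) * cell_incidence (cs ! j) (cs' ! j))" if j: "j < k" for j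
    proof (cases "cs' = cs[j := cs' ! j]")
      case True
      \<comment> \<open>Outside position \<open>j\<close> the two tuples agree, so their signs there square to one.\<close>
      have "\<Sigma> cs * \<Sigma> cs' = (\<Prod>l<k. \<tau> (cs ! l) * \<tau> (cs' ! l))"
        using c c' by (simp add: \<Sigma>_def prod.distrib)
      also have "\<dots> = \<tau> (cs ! j) * \<tau> (cs' ! j) * (\<Prod>l\<in>{..<k} - {j}. \<tau> (cs ! l) * \<tau> (cs' ! l))"
        using j by (subst prod.remove[of _ j]) simp_all
      also have "(\<Prod>l\<in>{..<k} - {j}. \<tau> (cs ! l) * \<tau> (cs' ! l)) = 1"
      proof (rule prod.neutral, rule ballI)
        fix l assume l: "l \<in> {..<k} - {j}"
        then have "cs' ! l = cs ! l" by (subst True) simp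
        then show "\<tau> (cs ! l) * \<tau> (cs' ! l) = 1" using \<tau>(1) c(2) l by simp
      qed
      finally have "\<Sigma> cs * \<Sigma> cs' = \<tau> (cs ! j) * \<tau> (cs' ! j)" by simp
      moreover have "map f cs' = (map f cs)[j := map f cs' ! j]"
        using j c' True by (metis map_update nth_map)
      ultimately show ?thesis
        using True j c c' incidence[OF c(2)[OF j] c'(2)[OF j]] by simp
    next
      case False
      have "map f cs' \<noteq> (map f cs)[j := map f cs' ! j]"
      proof
        assume eq: "map f cs' = (map f cs)[j := map f cs' ! j]"
        have "cs' ! l = cs[j := cs' ! j] ! l" if l: "l < k" for l
        proof (cases "l = j")
          case False
          then have "f (cs' ! l) = f (cs ! l)"
            using arg_cong[OF eq, of "\<lambda>xs. xs ! l"] l c c' by simp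
          then show ?thesis using f_inj c(2)[OF l] c'(2)[OF l] False by simp
        qed (use c j in simp)
        then have "cs' = cs[j := cs' ! j]" using c c' by (intro nth_equalityI) auto
        with False show False by simp
      qed
      with False show ?thesis by simp
    qed
    have len: "length cs = length cs'" "length (map f cs) = length (map f cs')" using c c' by simp_all
    show "deriv_kernel (\<lambda>_. 1) (map f cs) (map f cs') = \<Sigma> cs * \<Sigma> cs' * deriv_kernel (\<lambda>_. 1) cs cs'"
      unfolding deriv_kernel_cells[OF len(1)] deriv_kernel_cells[OF len(2)] length_map c(1) sum_distrib_left
    proof (rule sum.cong[OF HOL.refl])
      fix j assume "j \<in> {..<k}"
      then have j: "j < k" by simp
      show "(- 1) ^ total_dim (take j (map f cs)) * (of_bool (map f cs' = (map f cs)[j := map f cs' ! j]) *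
          cell_incidence (map f cs ! j) (map f cs' ! j)) =
        \<Sigma> cs * \<Sigma> cs' * ((- 1) ^ total_dim (take j cs) * (of_bool (cs' = cs[j := cs' ! j]) *
          cell_incidence (cs ! j) (cs' ! j)))"
        unfolding step[OF j] take[OF j] by (simp only: mult_ac)
    qed
  qed
  then have "real (betti (\<lambda>_. 1) k Gs p) = real (betti (\<lambda>_. 1) k Hs p)"
    by (simp add: betti_cell_tuples[OF k Gs] betti_cell_tuples[OF k Hs])
  then show ?thesis by simp
qed



section \<open>Connected components\<close>

text \<open>The cell as a set of lists determines its list of simplices, because nonempty simplices can be read off
  from their product; so an inclusion of cells is an inclusion of lists of simplices.\<close>

lemma listset_subcomplex:
  assumes G: "product_complex G" and C: "product_complex C" and sub: "cells C \<subseteq> cells G"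
  shows "listset C = {c \<in> listset G. listset c \<in> cells C}"
proof -
  have "c \<in> listset G" if c: "c \<in> listset C" for c
  proof -
    have "listset c \<in> cells G" using listset_cells[OF c] sub by blast
    then obtain d where d: "listset c = listset d" "d \<in> listset G" by (rule cellsE)
    have ne: "{} \<notin> set c" "{} \<notin> set d"
      using product_complex_listset(2) C c G d(2) by blast+
    obtain z where "z \<in> listset c" using listset_nonempty[OF ne(1)] by blast
    then have "length c = length d" using d(1) by (metis listset_iff list_all2_lengthD)
    then have "c = d"
      using listset_mono_iff[of c d] listset_mono_iff[of d c] ne d(1) by (intro cell_le_antisym) auto
    then show ?thesis using d(2) by simp
  qed
  moreover have "c \<in> listset C" if c: "c \<in> listset G" "listset c \<in> cells C" for c
  proof -
    obtain d where d: "listset c = listset d" "d \<in> listset C" using c(2) by (rule cellsE)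
    then have "c = d" using listset_inj[OF G c(1) calculation] by blast
    then show ?thesis using d(2) by simp
  qed
  ultimately show ?thesis using listset_cells by blast
qed

text \<open>A common lower bound connects all cells of a tuple, so the tuples of the whole complex are the disjoint
  union of the tuples of the components. The derivative does not mix components, because a face of a tuple
  lies below it.\<close>

theorem betti_components:
  assumes k: "k \<ge> 1" and G: "product_complex G"
    and C: "\<And>K. K \<in> components (cells G) \<Longrightarrow> product_complex (C K) \<and> cells (C K) = K"
  shows "betti (\<lambda>_. 1) k G p = (\<Sum>K\<in>components (cells G). betti (\<lambda>_. 1) k (C K) p)"
proof -
  let ?I = "components (cells G)" and ?D = "deriv_kernel (\<lambda>_. 1)"
  let ?T = "\<lambda>K. cell_tuples k (listset (C K))"
  have CK: "product_complex (C K)" "cells (C K) = K" if "K \<in> ?I" for K using C[OF that] by auto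
  have sub: "K \<subseteq> cells G" if "K \<in> ?I" for K using that Union_components[of "cells G"] by blast
  have list: "listset (C K) = {c \<in> listset G. listset c \<in> K}" if "K \<in> ?I" for K
    using listset_subcomplex[OF G CK(1)[OF that]] sub[OF that] CK(2)[OF that] by simp
  have closed: "y \<in> K" if "K \<in> ?I" "x \<in> K" "y \<in> cells G" "x \<subseteq> y \<or> y \<subseteq> x" for K x y
  proof -
    have "(x, y) \<in> connected_in (cells G)" using that sub by (intro connected_step) blast+
    then show ?thesis
      using in_quotient_imp_closed[OF equiv_connected] that(1,2) unfolding components_def by metis
  qed
  have disj: "K = K'" if "K \<in> ?I" "K' \<in> ?I" "x \<in> K" "x \<in> K'" for K K' x
    using quotient_disj[OF equiv_connected, of K "cells G" K'] that unfolding components_def by blast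
  have le: "cell_le c c' \<Longrightarrow> listset c \<subseteq> listset c'" if "c \<in> listset G" "c' \<in> listset G" for c c'
    using cell_le_iff[OF G that] by simp
  have first: "cs ! 0 \<in> listset G" "listset (cs ! 0) \<in> K" if "K \<in> ?I" "cs \<in> ?T K" for K cs
  proof -
    have "cs ! 0 \<in> set cs" using that(2) k by (simp add: cell_tuples_def)
    then have "cs ! 0 \<in> listset (C K)" using that(2) by (auto simp: cell_tuples_def)
    then show "cs ! 0 \<in> listset G" "listset (cs ! 0) \<in> K" using list[OF that(1)] by auto
  qed
  have union: "\<Union>(?T ` ?I) = cell_tuples k (listset G)"
  proof (intro equalityI subsetI)
    fix cs assume "cs \<in> \<Union>(?T ` ?I)"
    then obtain K where K: "K \<in> ?I" "cs \<in> ?T K" by blast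
    moreover have "listset (C K) \<subseteq> listset G" using list[OF K(1)] by blast
    ultimately show "cs \<in> cell_tuples k (listset G)" by (auto simp: cell_tuples_def)
  next
    fix cs assume cs: "cs \<in> cell_tuples k (listset G)"
    then obtain b where b: "b \<in> listset G" "\<And>c. c \<in> set cs \<Longrightarrow> cell_le b c" by (auto simp: cell_tuples_def)
    obtain K where K: "K \<in> ?I" "listset b \<in> K"
      using listset_cells[OF b(1)] Union_components[of "cells G"] by blast
    have "c \<in> listset (C K)" if c: "c \<in> set cs" for c
    proof -
      have cG: "c \<in> listset G" using cs c by (auto simp: cell_tuples_def)
      have "listset c \<in> K"
        using closed[OF K listset_cells[OF cG]] le[OF b(1) cG b(2)[OF c]] by blast
      then show ?thesis using list[OF K(1)] cG by blast
    qed
    moreover have "b \<in> listset (C K)" using list[OF K(1)] b(1) K(2) by blast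
    ultimately have "cs \<in> ?T K" using cs b(2) by (auto simp: cell_tuples_def)
    then show "cs \<in> \<Union>(?T ` ?I)" using K(1) by blast
  qed
  have "trace_dim (\<Union>(?T ` ?I)) (harmonic (\<Union>(?T ` ?I)) total_dim ?D p) =
    (\<Sum>K\<in>?I. trace_dim (?T K) (harmonic (?T K) total_dim ?D p))"
  proof (rule trace_dim_disjoint_union)
    show "finite ?I" using finite_components finite_cells[OF G] by blast
    have fin: "finite (listset G)"
      using G by (intro finite_listset) (simp add: product_complex_def simplicial_complex_def)
    show "finite (?T K)" if "K \<in> ?I" for K
      by (rule finite_subset[OF _ finite_lists_length_eq[OF fin, of k]]) (auto simp: cell_tuples_def list[OF that])
    fix K K' assume K: "K \<in> ?I" "K' \<in> ?I" "K \<noteq> K'"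
    show "?T K \<inter> ?T K' = {}" using first[OF K(1)] first[OF K(2)] disj[OF K(1,2)] K(3) by blast
    fix cs cs' assume cs: "cs \<in> ?T K" "cs' \<in> ?T K'"
    show "?D cs cs' = 0"
    proof (rule ccontr)
      assume D: "?D cs cs' \<noteq> 0"
      have "all_simplices cs"
        using cs(1) listset_simplices[OF CK(1)[OF K(1)]] by (auto simp: all_simplices_def cell_tuples_def)
      from product_facesD(3)[OF this deriv_kernel_nonzero[OF this D]] have "cell_le (cs' ! 0) (cs ! 0)"
        using cs k by (simp add: nested_le_def list_all2_conv_all_nth cell_tuples_def)
      then have "listset (cs' ! 0) \<subseteq> listset (cs ! 0)"
        using le first(1)[OF K(1) cs(1)] first(1)[OF K(2) cs(2)] by blast
      then have "listset (cs ! 0) \<in> K'"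
        using closed[OF K(2) first(2)[OF K(2) cs(2)] listset_cells[OF first(1)[OF K(1) cs(1)]]] by blast
      then show False using disj[OF K(1,2) first(2)[OF K(1) cs(1)]] K(3) by blast
    qed
  qed
  then have "real (betti (\<lambda>_. 1) k G p) = (\<Sum>K\<in>?I. real (betti (\<lambda>_. 1) k (C K) p))"
    unfolding union using betti_cell_tuples[OF k CK(1)] by (simp add: betti_cell_tuples[OF k G])
  then show ?thesis by (simp only: of_nat_sum[symmetric] of_nat_eq_iff)
qed

text \<open>The relation \<open>split\<close> prescribes only the cells of the summands, so they need not be the chosen
  complexes \<open>C K\<close>, but they are isomorphic to them.\<close>

lemma betti_splitting:
  assumes k: "k \<ge> 1" and G: "product_complex G" and M: "\<forall>H\<in>#M. product_complex H"
    and cells: "image_mset cells M = mset_set (components (cells G))"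
  shows "(\<Sum>H\<in>#M. betti (\<lambda>_. 1) k H p) = betti (\<lambda>_. 1) k G p"
proof -
  obtain C where C: "\<And>K. K \<in> components (cells G) \<Longrightarrow> product_complex (C K) \<and> cells (C K) = K"
    using component_product_complex[OF G] by metis
  have fin: "finite (components (cells G))" using finite_components finite_cells[OF G] by blast
  have "betti (\<lambda>_. 1) k H p = betti (\<lambda>_. 1) k (C (cells H)) p" if H: "H \<in># M" for H
  proof -
    have "cells H \<in># image_mset cells M" using H by simp
    then have K: "cells H \<in> components (cells G)" unfolding cells using fin by simp
    have iso: "complex_iso H (C (cells H))"
      using C[OF K] unfolding complex_iso_def by (intro exI[of _ "\<lambda>x. x"]) (simp add: bij_betw_def)
    show ?thesis using betti_isomorphic[OF k _ _ iso] M H C[OF K] by blast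
  qed
  then have "(\<Sum>H\<in>#M. betti (\<lambda>_. 1) k H p) = (\<Sum>K\<in>#image_mset cells M. betti (\<lambda>_. 1) k (C K) p)"
    by (simp add: image_mset.compositionality comp_def cong: image_mset_cong)
  also have "\<dots> = betti (\<lambda>_. 1) k G p"
    using betti_components[OF k G C] by (simp add: cells sum_unfold_sum_mset)
  finally show ?thesis .
qed


section \<open>The ring homomorphism\<close>

lemma signed_betti_simps [simp]:
  "signed_betti s k {#} p = 0"
  "signed_betti s k (add_mset (e, G) A) p = e * int (betti s k G p) + signed_betti s k A p"
  "signed_betti s k (A + B) p = signed_betti s k A p + signed_betti s k B p"
  by (simp_all add: signed_betti_def)

lemma signed_betti_orientation:
  assumes "orientation s" "signed_complex A"
  shows "signed_betti s k A p = signed_betti (\<lambda>_. 1) k A p"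
  using assms(2)
proof (induction A)
  case (add a A)
  then show ?case by (cases a) (simp add: betti_orientation[OF assms(1)])
qed simp

lemma signed_betti_strong_eq:
  assumes "k \<ge> 1" "strong_eq A B"
  shows "signed_betti (\<lambda>_. 1) k A p = signed_betti (\<lambda>_. 1) k B p"
  using assms(2)
proof (induction rule: strong_eq.induct)
  case (iso e G A H)
  then show ?case using betti_isomorphic[OF assms(1), of G H] by simp
next
  case (split e G A M)
  have "signed_betti (\<lambda>_. 1) k (image_mset (\<lambda>H. (e, H)) M) p = e * int (\<Sum>H\<in>#M. betti (\<lambda>_. 1) k H p)"
    by (induction M) (simp_all add: distrib_left)
  also have "(\<Sum>H\<in>#M. betti (\<lambda>_. 1) k H p) = betti (\<lambda>_. 1) k G p"
    using split by (intro betti_splitting[OF assms(1)]) auto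
  finally show ?case by simp
qed simp_all

lemma signed_betti_mult:
  assumes A: "signed_complex A" and B: "signed_complex B"
  shows "signed_betti (\<lambda>_. 1) k (sc_mult A B) p =
    (\<Sum>a\<le>p. signed_betti (\<lambda>_. 1) k A a * signed_betti (\<lambda>_. 1) k B (p - a))"
  using A
proof (induction A)
  case (add x A)
  obtain e G where x: "x = (e, G)" by (cases x)
  have G: "product_complex G" and A: "signed_complex A" using add.prems x by auto
  have "signed_betti (\<lambda>_. 1) k (sc_mult {#(e, G)#} B) p =
      (\<Sum>a\<le>p. e * int (betti (\<lambda>_. 1) k G a) * signed_betti (\<lambda>_. 1) k B (p - a))"
    using B
  proof (induction B)
    case (add y B)
    obtain f H where y: "y = (f, H)" by (cases y)
    have "product_complex H" "signed_complex B" using add.prems y by auto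
    then show ?case
      using add.IH
      by (simp add: y sc_mult_add_mset(2)[of _ _ B] betti_append[OF G] sum.distrib sum_distrib_left algebra_simps)
  qed simp
  then show ?case
    using add.IH[OF A]
    by (simp add: x sc_mult_add_mset(1)[of _ A] sum.distrib distrib_right)
qed simp

theorem theorem12:
  fixes k :: nat
  assumes "k \<ge> 1"
  shows "\<exists>h :: 'a::linorder strong_ring \<Rightarrow> int poly.
    h 1 = 1 \<and> (\<forall>x y. h (x + y) = h x + h y) \<and> (\<forall>x y. h (x * y) = h x * h y) \<and>
    (\<forall>s A. orientation s \<and> signed_complex A \<longrightarrow> h (strong_class A) = interaction_poly s k A)"
proof -
  define P :: "'a summand multiset \<Rightarrow> int poly" where "P = interaction_poly (\<lambda>_. 1) k"
  define h where "h x = P (rep_strong_ring x)" for x :: "'a strong_ring"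
  have coeff: "coeff (P A) p = signed_betti (\<lambda>_. 1) k A p" if "signed_complex A" for A p
    unfolding P_def by (rule coeff_interaction_poly[OF that])
  have h: "h (strong_class A) = P A" if A: "signed_complex A" for A
  proof -
    have eq: "strong_eq (rep_strong_ring (strong_class A)) A"
      using Quotient3_rep_abs[OF Quotient3_strong_ring] A by simp
    then have "signed_complex (rep_strong_ring (strong_class A))" using strong_eq_signed by blast
    then show ?thesis
      by (simp add: h_def poly_eq_iff coeff A signed_betti_strong_eq[OF assms eq])
  qed
  have rep: "strong_class (rep_strong_ring x) = x" "signed_complex (rep_strong_ring x)" for x :: "'a strong_ring"
    using Quotient3_abs_rep[OF Quotient3_strong_ring] Quotient3_rep_reflp[OF Quotient3_strong_ring] by simp_all
  show ?thesis
  proof (intro exI[of _ h] conjI allI impI)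
    have "P {#(1, [{{undefined}}])#} = 1"
      using coeff[OF signed_one] by (intro poly_eqI) (simp add: betti_point coeff_1)
    then show "h 1 = 1" unfolding one_strong_ring_def h[OF signed_one] .
  next
    fix x y :: "'a strong_ring"
    define A where "A = rep_strong_ring x"
    define B where "B = rep_strong_ring y"
    have AB: "signed_complex A" "signed_complex B" "x = strong_class A" "y = strong_class B"
      using rep by (simp_all add: A_def B_def)
    have "P (A + B) = P A + P B" using AB coeff by (intro poly_eqI) simp
    then show "h (x + y) = h x + h y"
      using AB(1,2) unfolding AB(3,4) by (simp add: plus_strong_ring.abs_eq h)
    have "P (sc_mult A B) = P A * P B"
      using AB coeff by (intro poly_eqI) (simp add: coeff_mult signed_betti_mult)
    then show "h (x * y) = h x * h y"
      using AB(1,2) unfolding AB(3,4) by (simp add: times_strong_ring.abs_eq h)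
  next
    fix s :: "'a set \<Rightarrow> real" and A :: "'a summand multiset"
    assume "orientation s \<and> signed_complex A"
    then have s: "orientation s" and A: "signed_complex A" by simp_all
    show "h (strong_class A) = interaction_poly s k A"
      by (simp add: poly_eq_iff h[OF A] coeff[OF A] coeff_interaction_poly[OF A] signed_betti_orientation[OF s A])
  qed
qed

end
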